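(* Let $G=(V,E)$ be an undirected weighted graph with $n$ vertices and nonnegative edge weights, let $k\geq3$ be an integer, let $\epsilon>0$ with $\epsilon\leq O(\log k)$, and let $\mathcal{P}\subseteq V^2$ be a set of vertex pairs. Then $G$ admits an interactive $(1+\epsilon)$-distance preserver for $\mathcal{P}$ with query time $O(1)$ and size \[O\left(|\mathcal{P}|\cdot\gamma_{4/3}(\epsilon,k)+n\log k+n^{1+\frac{1}{k}}\right),\qquad\text{where } \gamma_{4/3}(\epsilon,k)=O\left(\frac{\log k}{\epsilon}\right)^{\lceil\log_{4/3}k\rceil}.\] In addition, $G$ admits a universal $(1+\epsilon,\gamma_{4/3}(\epsilon,k))$-hopset with size $O(n^{1+\frac{1}{k}})$ and support size $O(n^{1+\frac{1}{k}}+n\log k)$.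
   Context: $d_G(u,v)$ is the shortest-path distance in $G$; $w(P)$ is the total weight of a path $P$. An $\alpha$-distance preserver for $G,\mathcal{P}$ is an edge set $S\subseteq E$ with $d_{(V,S)}(u,v)\leq\alpha\, d_G(u,v)$ for every $(u,v)\in\mathcal{P}$. An interactive $\alpha$-distance preserver is a pair $(S,D)$ where $S$ is an $\alpha$-distance preserver for $G,\mathcal{P}$ and $D$ is a data structure (oracle) that, given any query $(u,v)\in\mathcal{P}$, returns a $u$–$v$ path $P_{u,v}\subseteq S$ with $d_G(u,v)\leq w(P_{u,v})\leq\alpha\, d_G(u,v)$. Its size is $\max\{|S|,|D|\}$, where $|D|$ is the storage of $D$ in machine words; query time $q$ means a query is answered in time $O(q+|P_{u,v}|)$. A set $H$ of vertex pairs is an $(\alpha,\beta)$-hopset of $G$ if, letting $G\cup H$ be the graph obtained by adding each pair $(x,y)\in H$ as an edge of weight $d_G(x,y)$, for all $u,v\in V$ the minimum weight of a $u$–$v$ path in $G\cup H$ with at most $\beta$ edges is at most $\alpha\, d_G(u,v)$. Its size is $|H|$. A set $E_H\subseteq E$ is a supporting edge-set of $H$ if for every $(x,y)\in H$, $E_H$ contains a shortest $x$–$y$ path of $G$; the support size of $H$ is the minimum size of a supporting edge-set. A hopset is universal $(1+\epsilon,\beta(\epsilon))$ if the same set $H$ is a $(1+\epsilon,\beta(\epsilon))$-hopset for all $\epsilon$ in the range simultaneously. *)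

theory Defs
  imports Complex_Main "HOL-Library.Extended_Real"
begin

section \<open>Weighted undirected graphs\<close>

text \<open>A graph has vertex set \<open>{..<n}\<close>, so that vertices are also machine words for the oracles
  below. An edge is a two-element set of vertices.\<close>

definition wgraph :: "nat \<Rightarrow> nat set set \<Rightarrow> (nat set \<Rightarrow> real) \<Rightarrow> bool" where
  "wgraph n E w \<longleftrightarrow> (\<forall>e\<in>E. (\<exists>x<n. \<exists>y<n. x \<noteq> y \<and> e = {x, y}) \<and> 0 \<le> w e)"

definition is_path :: "nat \<Rightarrow> nat set set \<Rightarrow> nat \<Rightarrow> nat \<Rightarrow> nat list \<Rightarrow> bool" where
  "is_path n E u v p \<longleftrightarrow>
     p \<noteq> [] \<and> hd p = u \<and> last p = v \<and> distinct p \<and> set p \<subseteq> {..<n} \<and>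
     successively (\<lambda>x y. {x, y} \<in> E) p"

definition num_edges :: "nat list \<Rightarrow> nat" where
  "num_edges p = length p - 1"

definition path_weight :: "(nat \<Rightarrow> nat \<Rightarrow> ereal) \<Rightarrow> nat list \<Rightarrow> ereal" where
  "path_weight c p = (\<Sum>i<num_edges p. c (p ! i) (p ! Suc i))"

definition edge_cost :: "(nat set \<Rightarrow> real) \<Rightarrow> nat \<Rightarrow> nat \<Rightarrow> ereal" where
  "edge_cost w x y = ereal (w {x, y})"

text \<open>The distance is \<open>\<infinity>\<close> if there is no path.\<close>

definition gdist :: "nat \<Rightarrow> nat set set \<Rightarrow> (nat set \<Rightarrow> real) \<Rightarrow> nat \<Rightarrow> nat \<Rightarrow> ereal" where
  "gdist n E w u v = (INF p\<in>{p. is_path n E u v p}. path_weight (edge_cost w) p)"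

definition distance_preserver ::
  "nat \<Rightarrow> nat set set \<Rightarrow> (nat set \<Rightarrow> real) \<Rightarrow> (nat \<times> nat) set \<Rightarrow> real \<Rightarrow> nat set set \<Rightarrow> bool" where
  "distance_preserver n E w P \<alpha> S \<longleftrightarrow>
     S \<subseteq> E \<and> (\<forall>(u, v)\<in>P. gdist n S w u v \<le> ereal \<alpha> * gdist n E w u v)"


section \<open>Oracles on a word RAM\<close>

text \<open>Every instruction costs one time unit. The stored data are a read-only list of words, accessed
  by \<open>Fetch\<close>; \<open>Load\<close> and \<open>Store\<close> access a scratch memory that is zero at the start of each query,
  so a query cannot modify the data structure. All values are reduced modulo \<open>W\<close>, the
  number of distinct words. A computation halts when the program counter leaves the program.\<close>

datatype instr =
    Const nat nat
  | Add nat nat nat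
  | Sub nat nat nat
  | Mul nat nat nat
  | Div nat nat nat
  | Mod nat nat nat
  | Fetch nat nat
  | Load nat nat
  | Store nat nat
  | JumpLess nat nat nat
  | Output nat

record state =
  pc :: nat
  reg :: "nat \<Rightarrow> nat"
  mem :: "nat \<Rightarrow> nat"
  out :: "nat list"

definition set_reg :: "nat \<Rightarrow> nat \<Rightarrow> nat \<Rightarrow> state \<Rightarrow> state" where
  "set_reg W r x s = s\<lparr>pc := Suc (pc s), reg := (reg s)(r := x mod W)\<rparr>"

text \<open>Subtraction is truncated at zero; fetching beyond the end of the data yields zero.\<close>

fun exec :: "nat \<Rightarrow> nat list \<Rightarrow> instr \<Rightarrow> state \<Rightarrow> state" where
  "exec W D (Const r x) s = set_reg W r x s"
| "exec W D (Add r a b) s = set_reg W r (reg s a + reg s b) s"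
| "exec W D (Sub r a b) s = set_reg W r (reg s a - reg s b) s"
| "exec W D (Mul r a b) s = set_reg W r (reg s a * reg s b) s"
| "exec W D (Div r a b) s = set_reg W r (reg s a div reg s b) s"
| "exec W D (Mod r a b) s = set_reg W r (reg s a mod reg s b) s"
| "exec W D (Fetch r a) s =
     set_reg W r (if reg s a < length D then D ! reg s a else 0) s"
| "exec W D (Load r a) s = set_reg W r (mem s (reg s a)) s"
| "exec W D (Store a b) s = s\<lparr>pc := Suc (pc s), mem := (mem s)(reg s a := reg s b)\<rparr>"
| "exec W D (JumpLess a b l) s = s\<lparr>pc := (if reg s a < reg s b then l else Suc (pc s))\<rparr>"
| "exec W D (Output a) s = s\<lparr>pc := Suc (pc s), out := out s @ [reg s a]\<rparr>"

definition step :: "nat \<Rightarrow> nat list \<Rightarrow> instr list \<Rightarrow> state \<Rightarrow> state" where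
  "step W D Q s = (if pc s < length Q then exec W D (Q ! pc s) s else s)"

definition query_start :: "nat \<Rightarrow> nat \<Rightarrow> state" where
  "query_start u v = \<lparr>pc = 0, reg = (\<lambda>_. 0)(0 := u, 1 := v), mem = (\<lambda>_. 0), out = []\<rparr>"

text \<open>On the query \<open>(u, v)\<close>, the program halts after at most \<open>t\<close> instructions with output \<open>p\<close>.\<close>

definition answers ::
  "nat \<Rightarrow> nat list \<Rightarrow> instr list \<Rightarrow> nat \<Rightarrow> nat \<Rightarrow> nat \<Rightarrow> nat list \<Rightarrow> bool" where
  "answers W D Q u v t p \<longleftrightarrow>
     (let s = (step W D Q ^^ t) (query_start u v) in pc s \<ge> length Q \<and> out s = p)"

text \<open>Words have \<open>\<Theta>(log n)\<close> bits: \<open>b\<close> times the number of bits needed to write \<open>n\<close>.\<close>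

definition num_words :: "nat \<Rightarrow> nat \<Rightarrow> nat" where
  "num_words b n = 2 ^ (b * nat \<lceil>log 2 (real n + 1)\<rceil>)"

text \<open>The data structure consists of the words \<open>D\<close>, which depend on the instance, and of the query
  program \<open>Q\<close>. The query time is \<open>q\<close> with hidden constant \<open>c\<close>. A pair that is not connected in
  the graph has no path, so nothing is asked of the oracle for such a pair.\<close>

definition interactive_preserver ::
  "nat \<Rightarrow> instr list \<Rightarrow> real \<Rightarrow> real \<Rightarrow> nat \<Rightarrow> nat set set \<Rightarrow> (nat set \<Rightarrow> real) \<Rightarrow>
     (nat \<times> nat) set \<Rightarrow> real \<Rightarrow> nat set set \<Rightarrow> nat list \<Rightarrow> bool" where
  "interactive_preserver b Q c q n E w P \<alpha> S D \<longleftrightarrow>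
     distance_preserver n E w P \<alpha> S \<and>
     (\<forall>x\<in>set D. x < num_words b n) \<and>
     (\<forall>(u, v)\<in>P. gdist n E w u v < \<infinity> \<longrightarrow>
        (\<exists>p t. answers (num_words b n) D Q u v t p \<and>
           real t \<le> c * (q + real (num_edges p)) \<and>
           is_path n S u v p \<and>
           gdist n E w u v \<le> path_weight (edge_cost w) p \<and>
           path_weight (edge_cost w) p \<le> ereal \<alpha> * gdist n E w u v))"

definition preserver_size :: "nat set set \<Rightarrow> nat list \<Rightarrow> nat" where
  "preserver_size S D = max (card S) (length D)"


section \<open>Hopsets\<close>

definition hop_edges :: "(nat \<times> nat) set \<Rightarrow> nat set set" where
  "hop_edges H = {{x, y} |x y. (x, y) \<in> H}"

text \<open>A pair may be joined both by an edge of the graph and by a hop; a minimum-weight path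
  uses the cheaper one.\<close>

definition union_cost ::
  "nat \<Rightarrow> nat set set \<Rightarrow> (nat set \<Rightarrow> real) \<Rightarrow> (nat \<times> nat) set \<Rightarrow> nat \<Rightarrow> nat \<Rightarrow> ereal" where
  "union_cost n E w H x y =
     min (if {x, y} \<in> E then edge_cost w x y else \<infinity>)
         (if {x, y} \<in> hop_edges H then gdist n E w x y else \<infinity>)"

definition hop_dist ::
  "nat \<Rightarrow> nat set set \<Rightarrow> (nat set \<Rightarrow> real) \<Rightarrow> (nat \<times> nat) set \<Rightarrow> real \<Rightarrow> nat \<Rightarrow> nat \<Rightarrow> ereal" where
  "hop_dist n E w H \<beta> u v =
     (INF p\<in>{p. is_path n (E \<union> hop_edges H) u v p \<and> real (num_edges p) \<le> \<beta>}.
        path_weight (union_cost n E w H) p)"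

definition hopset ::
  "nat \<Rightarrow> nat set set \<Rightarrow> (nat set \<Rightarrow> real) \<Rightarrow> real \<Rightarrow> real \<Rightarrow> (nat \<times> nat) set \<Rightarrow> bool" where
  "hopset n E w \<alpha> \<beta> H \<longleftrightarrow>
     H \<subseteq> {..<n} \<times> {..<n} \<and>
     (\<forall>u<n. \<forall>v<n. hop_dist n E w H \<beta> u v \<le> ereal \<alpha> * gdist n E w u v)"

definition universal_hopset ::
  "nat \<Rightarrow> nat set set \<Rightarrow> (nat set \<Rightarrow> real) \<Rightarrow> real set \<Rightarrow> (real \<Rightarrow> real) \<Rightarrow> (nat \<times> nat) set \<Rightarrow> bool"
where
  "universal_hopset n E w R \<beta> H \<longleftrightarrow> (\<forall>\<epsilon>\<in>R. hopset n E w (1 + \<epsilon>) (\<beta> \<epsilon>) H)"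

definition supporting ::
  "nat \<Rightarrow> nat set set \<Rightarrow> (nat set \<Rightarrow> real) \<Rightarrow> (nat \<times> nat) set \<Rightarrow> nat set set \<Rightarrow> bool" where
  "supporting n E w H F \<longleftrightarrow>
     F \<subseteq> E \<and>
     (\<forall>(x, y)\<in>H. \<exists>p. is_path n F x y p \<and> path_weight (edge_cost w) p = gdist n E w x y)"

text \<open>This is \<open>\<infinity>\<close> if there is no supporting edge-set, that is, if some pair of \<open>H\<close> is
  disconnected.\<close>

definition support_size ::
  "nat \<Rightarrow> nat set set \<Rightarrow> (nat set \<Rightarrow> real) \<Rightarrow> (nat \<times> nat) set \<Rightarrow> ereal" where
  "support_size n E w H = (INF F\<in>{F. supporting n E w H F}. ereal (real (card F)))"

text \<open>The hopbound, where \<open>c\<close> is the constant hidden in the \<open>O\<close>-notation inside the power.\<close>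

definition gamma43 :: "real \<Rightarrow> real \<Rightarrow> nat \<Rightarrow> real" where
  "gamma43 c \<epsilon> k = (c * (ln (real k) / \<epsilon>)) ^ nat \<lceil>log (4/3) (real k)\<rceil>"

end

theory Submission
  imports Defs "HOL-Library.Sublist" "HOL-Library.Nat_Bijection"
begin

text \<open>Sample \<open>A 0 = V \<supseteq> A 1 \<supseteq> \<dots> \<supseteq> A (Suc l) = {}\<close> with \<open>card (A i)\<close> about \<open>n N powr (1 - (4/3)^i) / 2^i\<close>, where \<open>N\<close> is
  the \<open>k\<close>-th root of \<open>n\<close>. The hops join each \<open>x\<close> in \<open>A i\<close> to its pivot, a nearest vertex of \<open>A (Suc i)\<close>,
  and to the vertices of \<open>A i\<close> that are less than half as far away as the pivot. If the shortest paths
  of two such half-bunch pairs meet, then three of the four endpoints lie in the bunch of the fourth, so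
  the number of meetings is at most a sum of cubes of bunch sizes. This cube gives the rate \<open>4/3\<close>, and the
  factor \<open>2^i\<close> makes the sum over the levels geometric.

  To follow a shortest path with few hops, call a vertex near at level \<open>m\<close> if its chain of \<open>m\<close> pivots has
  length at most \<open>4 r^m s / r\<close>. From a vertex whose highest near level is \<open>m\<close>, jump along the chain, over a
  hop, and back along the chain of the farthest level-\<open>m\<close> near vertex within distance \<open>r^m s\<close>, then take an
  edge. Two jumps of level \<open>m\<close> start more than \<open>r^m s\<close> apart, so the total error and the number of hops
  are geometric sums.

  For the query structure, ties between shortest paths are broken consistently, so two paths separate
  at most twice. At a vertex of degree at most 2 in the union of the paths of a level, the next vertex
  is the sum of the two neighbours minus the previous vertex; only the vertices of higher degree have to be
  stored per hop, and the meetings bound their number. Pivot paths form a forest, which is stored by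
  parent pointers and followed downwards by reversing in scratch memory. Queried pairs are found by
  two-level perfect hashing.\<close>

section \<open>Walks and their weights\<close>

text \<open>The hops depend on the graph and on \<open>k\<close>, but not on
  \<open>\<epsilon>\<close>: it enters only the analysis, through the ratio
  \<open>r = 16 * (l + 3) / \<epsilon>\<close> of the scales, and this gives universality. The unit
  \<open>s\<close> of the scales is chosen for each pair from its distance, so the spread of the
  weights never enters. At distance zero a relative error leaves no slack; there \<open>s\<close> is
  taken so small that the walk has to cost exactly zero. Walks concatenate, whereas hop paths and
  answers must be simple. Cutting loops destroys whole hops but keeps contiguous parts of them, so
  the oracle must be able to start and stop inside the path of a hop. Words have
  \<open>O(log n)\<close> bits while the number of levels grows with \<open>k\<close>. Halving the
  levels empties those from \<open>n\<close> on, which keeps all addresses polynomial in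
  \<open>n\<close>.\<close>

fun edge_set :: "nat list \<Rightarrow> nat set set" where
  "edge_set (x # y # p) = insert {x, y} (edge_set (y # p))"
| "edge_set _ = {}"

fun wt :: "(nat set \<Rightarrow> real) \<Rightarrow> nat list \<Rightarrow> real" where
  "wt w (x # y # p) = w {x, y} + wt w (y # p)"
| "wt w _ = 0"

lemma successively_edge_set: "successively (\<lambda>x y. {x, y} \<in> E) p \<longleftrightarrow> edge_set p \<subseteq> E"
  by (induction p rule: edge_set.induct) auto

lemma is_path_iff:
  "is_path n E u v p \<longleftrightarrow>
     p \<noteq> [] \<and> hd p = u \<and> last p = v \<and> distinct p \<and> set p \<subseteq> {..<n} \<and> edge_set p \<subseteq> E"
  by (simp add: is_path_def successively_edge_set)

lemma path_weight_Cons: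
  "path_weight c (x # y # p) = c x y + path_weight c (y # p)"
  unfolding path_weight_def num_edges_def
  by (simp add: sum.lessThan_Suc_shift del: sum.lessThan_Suc)

lemma path_weight_single: "path_weight c [x] = 0" "path_weight c [] = 0"
  by (simp_all add: path_weight_def num_edges_def)

lemma path_weight_edge_cost: "path_weight (edge_cost w) p = ereal (wt w p)"
  by (induction p rule: edge_set.induct)
     (auto simp: path_weight_Cons path_weight_single edge_cost_def)

lemma edge_set_append: "edge_set (p @ x # q) = edge_set (p @ [x]) \<union> edge_set (x # q)"
  by (induction p rule: edge_set.induct) auto

lemma wt_append: "wt w (p @ x # q) = wt w (p @ [x]) + wt w (x # q)"
  by (induction p rule: edge_set.induct) auto

lemma edge_set_rev: "edge_set (rev p) = edge_set p"
proof (induction p rule: edge_set.induct)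
  case (1 x y p)
  then show ?case using edge_set_append[of "rev p" y "[x]"] by (auto simp: insert_commute)
qed auto

lemma wt_rev: "wt w (rev p) = wt w p"
proof (induction p rule: edge_set.induct)
  case (1 x y p)
  then show ?case using wt_append[of w "rev p" y "[x]"] by (auto simp: insert_commute)
qed auto

lemma wt_nonneg: "(\<And>e. e \<in> edge_set p \<Longrightarrow> 0 \<le> w e) \<Longrightarrow> 0 \<le> wt w p"
  by (induction p rule: edge_set.induct) auto

lemma edge_set_subset: "e \<in> edge_set p \<Longrightarrow> e \<subseteq> set p"
  by (induction p rule: edge_set.induct) auto

lemma edge_set_sublist: "sublist p q \<Longrightarrow> edge_set p \<subseteq> edge_set q"
proof -
  assume "sublist p q"
  then obtain a b where q: "q = a @ p @ b" by (auto simp: sublist_def)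
  have "edge_set p \<subseteq> edge_set (p @ b)" for b
    by (induction p rule: edge_set.induct) auto
  moreover have "edge_set p \<subseteq> edge_set (a @ p)" for p
  proof (cases p)
    case (Cons x p')
    then show ?thesis using edge_set_append[of a x p'] by auto
  qed auto
  ultimately show ?thesis using q by blast
qed

lemma wt_eq_sum: "distinct p \<Longrightarrow> wt w p = (\<Sum>e\<in>edge_set p. w e)"
proof (induction p rule: edge_set.induct)
  case (1 x y p)
  have "{x, y} \<notin> edge_set (y # p)" using edge_set_subset[of "{x,y}" "y # p"] 1 by auto
  moreover have "finite (edge_set (y # p))" for y p
    by (induction p arbitrary: y) auto
  ultimately show ?case using 1 by simp
qed auto

lemma finite_edge_set: "finite (edge_set p)"
  by (induction p rule: edge_set.induct) auto

lemma wt_add: "wt (\<lambda>e. f e + g e) p = wt f p + wt g p"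
  by (induction p rule: edge_set.induct) auto

lemma wt_scale: "wt (\<lambda>e. c * f e) p = c * wt f p"
  by (induction p rule: edge_set.induct) (auto simp: algebra_simps)

text \<open>Loops are cut from the end of the walk backwards: if the new vertex already lies on the
  simple path built for the rest, that path is replaced by its suffix from there. Nonnegative
  weights make this harmless.\<close>

lemma simple_subwalk:
  assumes "p \<noteq> []" "\<And>e. e \<in> edge_set p \<Longrightarrow> 0 \<le> w e"
  shows "\<exists>q. q \<noteq> [] \<and> hd q = hd p \<and> last q = last p \<and> distinct q \<and> set q \<subseteq> set p \<and>
           edge_set q \<subseteq> edge_set p \<and> wt w q \<le> wt w p"
  using assms
proof (induction p rule: edge_set.induct)
  case (1 x y p)
  then obtain q where q: "q \<noteq> []" "hd q = y" "last q = last (y # p)" "distinct q"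
    "set q \<subseteq> set (y # p)" "edge_set q \<subseteq> edge_set (y # p)" "wt w q \<le> wt w (y # p)" by auto
  show ?case
  proof (cases "x \<in> set q")
    case True
    then obtain a b where ab: "q = a @ x # b" by (meson split_list)
    have "wt w q = wt w (a @ [x]) + wt w (x # b)" unfolding ab by (rule wt_append)
    moreover have "edge_set q = edge_set (a @ [x]) \<union> edge_set (x # b)"
      unfolding ab by (rule edge_set_append)
    moreover from this have "0 \<le> wt w (a @ [x])" using q 1 by (intro wt_nonneg) auto
    moreover have "0 \<le> w {x, y}" using 1 by auto
    ultimately show ?thesis using q ab by (intro exI[of _ "x # b"]) auto
  next
    case False
    then show ?thesis using q 1 by (cases q) (auto intro!: exI[of _ "x # q"])
  qed
next
  case ("2_2" v)
  then show ?case by (intro exI[of _ "[v]"]) auto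
qed auto

text \<open>The start of a simple path lies on at most one of its edges, so the edges determine the
  second vertex, and so on. Hence it suffices that the perturbed weights tell edge sets
  apart.\<close>

lemma simple_path_unique:
  assumes "distinct p" "distinct q" "p \<noteq> []" "q \<noteq> []" "hd p = hd q" "edge_set p = edge_set q"
  shows "p = q"
  using assms
proof (induction p arbitrary: q rule: edge_set.induct)
  case (1 x y p)
  then obtain z q' where q: "q = x # z # q'"
    by (cases q rule: edge_set.cases) auto
  have nx: "{x, a} \<notin> edge_set (y # p)" "{x, a} \<notin> edge_set (z # q')" for a
    using edge_set_subset[of "{x,a}"] 1 q by fastforce+
  have "{x, y} \<in> edge_set q" using 1(7) by auto
  then have "y = z" using nx q by (auto simp: doubleton_eq_iff)
  moreover have "edge_set (y # p) = edge_set (z # q')"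
    using 1(7) q nx \<open>y = z\<close> by (metis edge_set.simps(1) insert_ident)
  ultimately show ?case using 1(1)[of "z # q'"] 1(2,3) q by auto
next
  case ("2_2" v)
  then show ?case by (cases q rule: edge_set.cases) auto
qed auto

lemma finite_is_path: "finite {p. is_path n E u v p}"
  by (rule finite_subset[OF _ finite_subset_distinct[OF finite_lessThan[of n]]])
    (auto simp: is_path_iff)

lemma is_path_rev: "is_path n E u v p \<Longrightarrow> is_path n E v u (rev p)"
  by (auto simp: is_path_iff edge_set_rev hd_rev last_rev)

lemma is_path_sublist:
  assumes "is_path n E u v p" "sublist m p" "m \<noteq> []"
  shows "is_path n E (hd m) (last m) m"
  using assms edge_set_sublist[OF assms(2)] by (auto simp: is_path_iff sublist_def)

lemma is_path_mono: "is_path n E u v p \<Longrightarrow> E \<subseteq> E' \<Longrightarrow> is_path n E' u v p"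
  by (auto simp: is_path_iff)

definition conn :: "nat \<Rightarrow> nat set set \<Rightarrow> nat \<Rightarrow> nat \<Rightarrow> bool" where
  "conn n E u v \<longleftrightarrow> (\<exists>p. is_path n E u v p)"

lemma conn_sym: "conn n E u v \<Longrightarrow> conn n E v u"
  using is_path_rev unfolding conn_def by blast

lemma conn_refl: "u < n \<Longrightarrow> conn n E u u"
  unfolding conn_def by (rule exI[of _ "[u]"]) (auto simp: is_path_iff)

lemma conn_less: "conn n E u v \<Longrightarrow> u < n \<and> v < n"
  unfolding conn_def is_path_iff using hd_in_set last_in_set by blast

lemma join_paths:
  assumes p: "is_path n E u x p" and q: "is_path n E x v q" and w: "\<And>e. e \<in> E \<Longrightarrow> 0 \<le> w e"
  shows "\<exists>r. is_path n E u v r \<and> wt w r \<le> wt w p + wt w q"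
proof -
  obtain p' q' where p': "p = p' @ [x]" and q': "q = x # q'"
    using p q by (cases p rule: rev_cases; cases q) (auto simp: is_path_iff)
  have *: "edge_set (p' @ x # q') = edge_set p \<union> edge_set q" "wt w (p' @ x # q') = wt w p + wt w q"
    unfolding p' q' by (rule edge_set_append wt_append)+
  have sub: "edge_set (p' @ x # q') \<subseteq> E" using p q * by (auto simp: is_path_iff)
  obtain r where "r \<noteq> []" "hd r = hd (p' @ x # q')" "last r = last (p' @ x # q')" "distinct r"
    "set r \<subseteq> set (p' @ x # q')" "edge_set r \<subseteq> edge_set (p' @ x # q')" "wt w r \<le> wt w (p' @ x # q')"
    using simple_subwalk[of "p' @ x # q'" w] sub w by blast
  then show ?thesis using p q sub * p' q'
    by (intro exI[of _ r]) (auto simp: is_path_iff hd_append split: if_splits)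
qed

lemma conn_trans: "conn n E u x \<Longrightarrow> conn n E x v \<Longrightarrow> conn n E u v"
  using join_paths[of n E u x _ v _ "\<lambda>_. 0"] unfolding conn_def by force


section \<open>A consistent system of shortest paths\<close>

text \<open>Distinct edges get distinct powers of two, so the sum is a binary code from which the
  set can be recovered.\<close>

lemma sum_pow2_eq_set_encode:
  assumes "finite X" "\<And>e. e \<in> X \<Longrightarrow> finite e"
  shows "(\<Sum>e\<in>X. 2 ^ set_encode e) = set_encode (set_encode ` X)"
proof -
  have "inj_on set_encode X" using assms inj_on_set_encode by (auto simp: inj_on_def)
  then show ?thesis using assms by (simp add: set_encode_def sum.reindex)
qed

lemma finite_gap:
  fixes X :: "real set"
  assumes "finite X"
  shows "\<exists>g>0. \<forall>x\<in>X. 0 < x \<longrightarrow> g \<le> x"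
proof -
  let ?Y = "insert 1 {x \<in> X. 0 < x}"
  have "finite ?Y" using assms by auto
  then show ?thesis by (intro exI[of _ "Min ?Y"]) auto
qed

text \<open>Every edge receives its own power of two, scaled down. Different simple paths with the
  same ends have different edge sets and so different perturbations, and the scale is too small to
  reverse a strict inequality of the original weights.\<close>

lemma perturbed_weights:
  assumes "wgraph n E w"
  shows "\<exists>w'. (\<forall>e\<in>E. 0 \<le> w' e) \<and>
    (\<forall>u v p q. is_path n E u v p \<and> is_path n E u v q \<longrightarrow>
       (wt w' p = wt w' q \<longrightarrow> p = q) \<and> (wt w' p \<le> wt w' q \<longrightarrow> wt w p \<le> wt w q))"
proof -
  define f where "f = (\<lambda>e. 2 ^ set_encode e :: nat)"
  define U where "U = {p. distinct p \<and> set p \<subseteq> {..<n}}"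
  have finU: "finite U" unfolding U_def using finite_subset_distinct[of "{..<n}"] 
    by (simp add: conj_commute)
  have wtf: "wt (\<lambda>e. real (f e)) p = real (set_encode (set_encode ` edge_set p))" if
    "distinct p" for p
  proof -
    have "finite e" if "e \<in> edge_set p" for e using edge_set_subset[OF that] finite_subset by auto
    then have "(\<Sum>e\<in>edge_set p. f e) = set_encode (set_encode ` edge_set p)"
      unfolding f_def by (intro sum_pow2_eq_set_encode finite_edge_set)
    then show ?thesis using that by (simp add: wt_eq_sum flip: of_nat_sum)
  qed
  define g where "g = (\<lambda>p. wt (\<lambda>e. real (f e)) p)"
  have g0: "0 \<le> g p" for p unfolding g_def by (intro wt_nonneg) auto
  obtain M where M: "M > 0" "\<And>p. p \<in> U \<Longrightarrow> g p < M"
  proof -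
    have fin: "finite (insert 0 (g ` U))" using finU by auto
    have "g p < Max (insert 0 (g ` U)) + 1" if "p \<in> U" for p
      using Max_ge[OF fin, of "g p"] that by fastforce
    moreover have "0 \<le> Max (insert 0 (g ` U))" using fin by auto
    ultimately show ?thesis using that[of "Max (insert 0 (g ` U)) + 1"] by auto
  qed
  \<comment> \<open>\<open>M\<close> bounds the unscaled perturbation of any simple path, so
    \<open>\<delta> * M\<close> only has to stay below the least positive difference of path
    weights; it is made half of such a gap.\<close>
  obtain \<delta> where \<delta>: "\<delta> > 0" "\<And>p q. p \<in> U \<Longrightarrow> q \<in> U \<Longrightarrow> 0 < wt w p - wt w q \<Longrightarrow> \<delta> * M < wt w p - wt w q"
  proof -
    have "finite ((\<lambda>(p, q). wt w p - wt w q) ` (U \<times> U))" using finU by auto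
    from finite_gap[OF this] obtain G where
      "G > 0" "\<forall>p\<in>U. \<forall>q\<in>U. 0 < wt w p - wt w q \<longrightarrow> G \<le> wt w p - wt w q" by auto
    then show ?thesis using M by (intro that[of "G / (2 * M)"]) (auto simp: field_simps, fastforce)
  qed
  define w' where "w' = (\<lambda>e. w e + \<delta> * real (f e))"
  have w': "wt w' p = wt w p + \<delta> * g p" for p
    unfolding w'_def g_def wt_add wt_scale ..
  have inj: "p = q" if "is_path n E u v p" "is_path n E u v q" "g p = g q" for u v p q
  proof -
    have fin: "finite (set_encode ` edge_set p)" "finite e" if "distinct p" "e \<in> edge_set p" for p e
      using edge_set_subset[OF that(2)] finite_subset finite_edge_set by auto
    have "set_encode (set_encode ` edge_set p) = set_encode (set_encode ` edge_set q)"
      using that wtf by (simp add: g_def is_path_iff)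
    then have "set_encode ` edge_set p = set_encode ` edge_set q"
      by (simp add: set_encode_eq finite_edge_set)
    \<comment> \<open>\<open>set_encode\<close> is injective on finite sets only.\<close>
    moreover have "edge_set p \<subseteq> Collect finite" for p
      using edge_set_subset finite_subset[of _ "set p"] by auto
    ultimately have "edge_set p = edge_set q"
      using inj_on_image_eq_iff[OF inj_on_set_encode] by metis
    then show ?thesis using that simple_path_unique by (simp add: is_path_iff)
  qed
  have key: "wt w p \<le> wt w q" if "p \<in> U" "q \<in> U" "wt w' p \<le> wt w' q" for p q
  proof (rule ccontr)
    assume "\<not> wt w p \<le> wt w q"
    then have "\<delta> * M < wt w p - wt w q" using \<delta> that by auto
    moreover have "\<delta> * g q \<le> \<delta> * M" "0 \<le> \<delta> * g p" using M(2)[OF that(2)] \<delta> g0 by auto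
    ultimately show False using that(3) unfolding w' by auto
  qed
  have "p = q" if "is_path n E u v p" "is_path n E u v q" "wt w' p = wt w' q" for u v p q
  proof -
    have "p \<in> U" "q \<in> U" using that by (auto simp: U_def is_path_iff)
    then have "wt w p = wt w q" using key[of p q] key[of q p] that by auto
    then have "g p = g q" using that \<delta> w' by auto
    then show ?thesis using inj that by blast
  qed
  moreover have "0 \<le> w' e" if "e \<in> E" for e
    using assms that \<delta> by (auto simp: w'_def wgraph_def intro!: add_nonneg_nonneg)
  ultimately show ?thesis using key
    by (intro exI[of _ w']) (auto simp: U_def is_path_iff)
qed

text \<open>\<open>consistent\<close> is the form in which tie-breaking is used: it makes two
  selected paths share one contiguous part, and it turns distances along a path into differences of
  positions.\<close>

locale shortest_paths =
  fixes n :: nat and E :: "nat set set" and w :: "nat set \<Rightarrow> real" and \<pi> :: "nat \<Rightarrow> nat \<Rightarrow> nat list"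
  assumes wgraph: "wgraph n E w"
    and path: "conn n E u v \<Longrightarrow> is_path n E u v (\<pi> u v)"
    and shortest: "is_path n E u v q \<Longrightarrow> wt w (\<pi> u v) \<le> wt w q"
    and symmetric: "conn n E u v \<Longrightarrow> \<pi> v u = rev (\<pi> u v)"
    and consistent: "conn n E u v \<Longrightarrow> sublist m (\<pi> u v) \<Longrightarrow> m \<noteq> [] \<Longrightarrow> \<pi> (hd m) (last m) = m"

text \<open>Paths of least perturbed weight are unique. Reversal and restriction to a contiguous
  part preserve minimality, so they must give the selected path again.\<close>

lemma shortest_paths_exist:
  assumes wg: "wgraph n E w"
  shows "\<exists>\<pi>. shortest_paths n E w \<pi>"
proof -
  obtain w' where w': "\<And>e. e \<in> E \<Longrightarrow> 0 \<le> w' e"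
    "\<And>u v p q. is_path n E u v p \<Longrightarrow> is_path n E u v q \<Longrightarrow> wt w' p = wt w' q \<Longrightarrow> p = q"
    "\<And>u v p q. is_path n E u v p \<Longrightarrow> is_path n E u v q \<Longrightarrow> wt w' p \<le> wt w' q \<Longrightarrow> wt w p \<le> wt w q"
    using perturbed_weights[OF wg] by metis
  define opt where "opt = (\<lambda>u v p. is_path n E u v p \<and> (\<forall>q. is_path n E u v q \<longrightarrow> wt w' p \<le> wt w' q))"
  have ex: "\<exists>p. opt u v p" if "conn n E u v" for u v
    using ex_min_if_finite[of "wt w' ` {p. is_path n E u v p}"] finite_is_path that
    unfolding opt_def conn_def by (fastforce simp: not_less)
  have uniq: "p = q" if "opt u v p" "opt u v q" for u v p q
    using that w'(2)[of u v p q] unfolding opt_def by (meson order_antisym)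
  define \<pi> where "\<pi> = (\<lambda>u v. SOME p. opt u v p)"
  have \<pi>: "opt u v (\<pi> u v)" if "conn n E u v" for u v
    unfolding \<pi>_def using ex[OF that] by (rule someI_ex)
  have \<pi>I: "\<pi> u v = p" if "opt u v p" for u v p
    using uniq[OF \<pi> that] that by (auto simp: opt_def conn_def)
  have "\<pi> v u = rev (\<pi> u v)" if "conn n E u v" for u v
  proof (rule \<pi>I)
    show "opt v u (rev (\<pi> u v))"
      using \<pi>[OF that] is_path_rev wt_rev unfolding opt_def by metis
  qed
  moreover have "\<pi> (hd m) (last m) = m" if c: "conn n E u v" and s: "sublist m (\<pi> u v)" and
    "m \<noteq> []" for u v m
  proof -
    let ?x = "hd m" and ?y = "last m"
    have P: "is_path n E u v (\<pi> u v)" using \<pi>[OF c] by (auto simp: opt_def)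
    have m: "is_path n E ?x ?y m" using is_path_sublist[OF P s] that by auto
    \<comment> \<open>A competitor \<open>q\<close> for the middle part is spliced between the two
      unchanged ends. The result need not be simple, but \<open>join_paths\<close> shortens it
      without raising the weight, and minimality of the whole path applies.\<close>
    have "wt w' m \<le> wt w' q" if q: "is_path n E ?x ?y q" for q
    proof -
      obtain a b where ab: "\<pi> u v = a @ m @ b" using s by (auto simp: sublist_def)
      obtain m0 where m0: "m = ?x # m0" using \<open>m \<noteq> []\<close> by (cases m) auto
      obtain m1 where m1: "m = m1 @ [?y]" using \<open>m \<noteq> []\<close> by (cases m rule: rev_cases) auto
      have pa: "is_path n E u ?x (a @ [?x])"
      proof -
        have "sublist (a @ [?x]) (\<pi> u v)" unfolding ab
          by (subst (2) m0) (metis append.assoc append_Cons append_Nil sublist_append_rightI)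
        then have "is_path n E (hd (a @ [?x])) (last (a @ [?x])) (a @ [?x])"
          using P is_path_sublist by blast
        moreover have "hd (a @ [?x]) = u" using P ab \<open>m \<noteq> []\<close>
          by (cases a) (auto simp: is_path_iff)
        ultimately show ?thesis by simp
      qed
      have pb: "is_path n E ?y v (?y # b)"
      proof -
        have "sublist (?y # b) (\<pi> u v)" unfolding ab
          by (subst (2) m1) (metis append.assoc append_Cons append_Nil sublist_append_leftI)
        then have "is_path n E (hd (?y # b)) (last (?y # b)) (?y # b)"
          using P is_path_sublist by blast
        moreover have "last (?y # b) = v" using P ab \<open>m \<noteq> []\<close>
          by (cases b rule: rev_cases) (auto simp: is_path_iff)
        ultimately show ?thesis by simp
      qed
      obtain r where r: "is_path n E u ?y r" "wt w' r \<le> wt w' (a @ [?x]) + wt w' q"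
        using join_paths[OF pa q, of w'] w'(1) by auto
      obtain r' where r': "is_path n E u v r'" "wt w' r' \<le> wt w' r + wt w' (?y # b)"
        using join_paths[OF r(1) pb, of w'] w'(1) by auto
      have "wt w' (\<pi> u v) \<le> wt w' r'" using \<pi>[OF c] r' by (auto simp: opt_def)
      moreover have "wt w' (\<pi> u v) = wt w' (a @ [?x]) + wt w' m + wt w' (?y # b)"
      proof -
        have "\<pi> u v = a @ ?x # m0 @ b" using ab m0 by (metis append_Cons)
        then have "wt w' (\<pi> u v) = wt w' (a @ [?x]) + wt w' (?x # m0 @ b)"
          using wt_append by metis
        also have "?x # m0 @ b = m1 @ ?y # b" using m0 m1
          by (metis append.assoc append_Cons append_Nil)
        also have "wt w' \<dots> = wt w' m + wt w' (?y # b)" using m1 wt_append by metis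
        finally show ?thesis by simp
      qed
      ultimately show ?thesis using r r' by auto
    qed
    then show ?thesis using m by (intro \<pi>I) (auto simp: opt_def)
  qed
  moreover have "wt w (\<pi> u v) \<le> wt w q" if "is_path n E u v q" for u v q
  proof -
    have "opt u v (\<pi> u v)" using \<pi> that by (auto simp: conn_def)
    then show ?thesis using w'(3)[of u v "\<pi> u v" q] that by (auto simp: opt_def)
  qed
  moreover have "is_path n E u v (\<pi> u v)" if "conn n E u v" for u v
    using \<pi>[OF that] by (simp add: opt_def)
  ultimately have "shortest_paths n E w \<pi>"
    using wg by unfold_locales
  then show ?thesis by blast
qed

section \<open>Sampling a hierarchy of vertex sets\<close>

text \<open>Expectation over the random subset of \<open>A\<close> that contains every element independently with
  probability \<open>q\<close>.\<close>

definition expect :: "real \<Rightarrow> 'a set \<Rightarrow> ('a set \<Rightarrow> real) \<Rightarrow> real" where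
  "expect q A f = (\<Sum>S\<in>Pow A. q ^ card S * (1 - q) ^ (card A - card S) * f S)"

lemma expect_empty: "expect q {} f = f {}"
  by (simp add: expect_def)

text \<open>Conditioning on whether \<open>a\<close> is sampled; this is the recursion behind the
  inductions below.\<close>

lemma expect_insert:
  assumes "finite A" "a \<notin> A"
  shows "expect q (insert a A) f = q * expect q A (\<lambda>S. f (insert a S)) + (1 - q) * expect q A f"
proof -
  have inj: "inj_on (insert a) (Pow A)" using assms by (auto simp: inj_on_def)
  have fin: "finite (Pow A)" using assms by auto
  let ?g = "\<lambda>S. q ^ card S * (1 - q) ^ (card (insert a A) - card S) * f S"
  have c: "card S \<le> card A" if "S \<in> Pow A" for S using that assms by (auto intro: card_mono)
  have "expect q (insert a A) f = (\<Sum>S\<in>Pow A. ?g S) + (\<Sum>S\<in>insert a ` Pow A. ?g S)"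
    unfolding expect_def Pow_insert using assms fin
    by (intro sum.union_disjoint) auto
  also have "(\<Sum>S\<in>Pow A. ?g S) = (1 - q) * expect q A f"
    unfolding expect_def sum_distrib_left
    using c assms by (intro sum.cong) (auto simp: Suc_diff_le)
  also have "(\<Sum>S\<in>insert a ` Pow A. ?g S) = (\<Sum>S\<in>Pow A. ?g (insert a S))"
    using sum.reindex[OF inj, of ?g] by simp
  also have "\<dots> = q * expect q A (\<lambda>S. f (insert a S))"
    unfolding expect_def sum_distrib_left
  proof (intro sum.cong refl)
    fix S assume S: "S \<in> Pow A"
    then have "finite S" "a \<notin> S" using assms finite_subset by auto
    then show "?g (insert a S) = q * (q ^ card S * (1 - q) ^ (card A - card S) * f (insert a S))"
      using assms by simp
  qed
  finally show ?thesis by simp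
qed

lemma expect_add: "expect q A (\<lambda>S. f S + g S) = expect q A f + expect q A g"
  by (simp add: expect_def sum.distrib algebra_simps)

lemma expect_scale: "expect q A (\<lambda>S. c * f S) = c * expect q A f"
  by (simp add: expect_def sum_distrib_left algebra_simps)

lemma expect_sum: "expect q A (\<lambda>S. \<Sum>x\<in>X. f x S) = (\<Sum>x\<in>X. expect q A (f x))"
  by (simp add: expect_def sum_distrib_left sum.swap[of _ X])

lemma expect_const: "finite A \<Longrightarrow> expect q A (\<lambda>_. c) = c"
  by (induction A rule: finite_induct) (auto simp: expect_empty expect_insert algebra_simps)

lemma expect_mono:
  assumes "0 \<le> q" "q \<le> 1" "\<And>S. S \<subseteq> A \<Longrightarrow> f S \<le> g S"
  shows "expect q A f \<le> expect q A g"
  unfolding expect_def using assms by (intro sum_mono mult_left_mono) auto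

lemma expect_exists:
  assumes "finite A" "0 \<le> q" "q \<le> 1" "expect q A f \<le> c"
  shows "\<exists>S\<subseteq>A. f S \<le> c"
proof (rule ccontr)
  assume "\<not> ?thesis"
  then have less: "\<And>S. S \<subseteq> A \<Longrightarrow> c < f S" by (meson not_le)
  let ?m = "Min (f ` Pow A)"
  have "finite (f ` Pow A)" "f ` Pow A \<noteq> {}" using assms by auto
  then have m: "c < ?m" "\<And>S. S \<subseteq> A \<Longrightarrow> ?m \<le> f S"
    using less Min_gr_iff[of "f ` Pow A" c] by (auto intro!: Min_le)
  have "?m = expect q A (\<lambda>_. ?m)" using assms by (simp add: expect_const)
  also have "\<dots> \<le> expect q A f" using assms m by (intro expect_mono) auto
  finally show False using assms m by simp
qed

lemma expect_card: "finite A \<Longrightarrow> expect q A (\<lambda>S. real (card S)) = q * real (card A)"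
proof (induction A rule: finite_induct)
  case (insert a A)
  have "expect q A (\<lambda>S. real (card (insert a S))) = expect q A (\<lambda>S. 1 + real (card S))"
    unfolding expect_def
  proof (intro sum.cong refl)
    fix S assume "S \<in> Pow A"
    then have "finite S" "a \<notin> S" using insert finite_subset by auto
    then show "q ^ card S * (1 - q) ^ (card A - card S) * real (card (insert a S)) =
      q ^ card S * (1 - q) ^ (card A - card S) * (1 + real (card S))" by simp
  qed
  then show ?case using insert by (simp add: expect_insert expect_add expect_const algebra_simps)
qed (auto simp: expect_empty)

text \<open>For empty \<open>S\<close> the infimum is \<open>\<infinity>\<close>, so at the top
  level a bunch consists of all elements at finite distance.\<close>

definition bunch :: "('a \<Rightarrow> 'a \<Rightarrow> ereal) \<Rightarrow> 'a set \<Rightarrow> 'a set \<Rightarrow> 'a \<Rightarrow> 'a set" where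
  "bunch d A S x = {y \<in> A. d x y < (INF z\<in>S. d x z)}"

text \<open>Reading \<open>A\<close> in the order of distance from a vertex, the bunch is the part before the
  first sampled element, so its size is dominated by a geometric variable.\<close>

lemma expect_exp_card_less:
  fixes f :: "'a \<Rightarrow> ereal" and q l :: real
  assumes "finite A" "0 \<le> q" "q \<le> 1" "1 \<le> l" "(1 - q) * l \<le> 1 - q / 2"
  shows "expect q A (\<lambda>S. l ^ card {y \<in> A. f y < (INF z\<in>S. f z)}) \<le> 2"
proof -
  \<comment> \<open>The ranked induction inserts the element of greatest rank; negation makes this
    the nearest one, so each step conditions on the first element in the order of distance.\<close>
  define g where "g = (\<lambda>y. - f y)"
  from assms(1) show ?thesis
  proof (induction A rule: finite_ranking_induct[where f = g])
    case empty
    then show ?case by (simp add: expect_empty)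
  next
    case (insert a A)
    show ?case
    proof (cases "a \<in> A")
      case True
      then show ?thesis using insert by (simp add: insert_absorb)
    next
      case False
      have min: "f a \<le> f y" if "y \<in> A" for y using insert(2)[OF that] by (simp add: g_def)
      let ?h = "\<lambda>B S. l ^ card {y \<in> B. f y < (INF z\<in>S. f z)}"
      \<comment> \<open>If the nearest element is sampled, the bunch is empty and contributes 1;
        otherwise the bunch grows by at most that element, a factor \<open>l\<close>. The bound 2
        reproduces itself since \<open>q + (1 - q / 2) * 2 = 2\<close>.\<close>
      have "expect q A (\<lambda>S. ?h (insert a A) (insert a S)) \<le> expect q A (\<lambda>_. 1)"
      proof (rule expect_mono)
        fix S assume "S \<subseteq> A"
        have "{y \<in> insert a A. f y < (INF z\<in>insert a S. f z)} = {}"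
          using min by (auto simp: not_less min_le_iff_disj)
        then show "?h (insert a A) (insert a S) \<le> 1" by (simp only: card.empty power_0)
      qed (use assms in auto)
      moreover have "expect q A (?h (insert a A)) \<le> expect q A (\<lambda>S. l * ?h A S)"
      proof (rule expect_mono)
        fix S assume "S \<subseteq> A"
        have "card {y \<in> insert a A. f y < (INF z\<in>S. f z)}
            \<le> card (insert a {y \<in> A. f y < (INF z\<in>S. f z)})"
          using insert by (intro card_mono) auto
        also have "\<dots> \<le> Suc (card {y \<in> A. f y < (INF z\<in>S. f z)})"
          by (rule card_insert_le_m1) auto
        finally show "?h (insert a A) S \<le> l * ?h A S"
          using assms power_increasing[OF _ assms(4)] by fastforce
      qed (use assms in auto)
      ultimately have "expect q (insert a A) (?h (insert a A)) \<le>
          q * 1 + (1 - q) * (l * expect q A (?h A))"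
        unfolding expect_insert[OF insert(1) False] using insert(1) assms
        by (intro add_mono mult_left_mono) (auto simp only: expect_const expect_scale)
      also have "\<dots> \<le> q + (1 - q / 2) * 2"
      proof -
        have "(1 - q) * (l * expect q A (?h A)) \<le> (1 - q) * (l * 2)"
          using insert(3) assms by (intro mult_left_mono) auto
        also have "\<dots> = (1 - q) * l * 2" by simp
        also have "\<dots> \<le> (1 - q / 2) * 2" using assms(5) by simp
        finally show ?thesis by simp
      qed
      finally show ?thesis by simp
    qed
  qed
qed

text \<open>Exponential moments suit the induction, and Bernoulli's inequality bounds the cube by
  one. With 6 the base is \<open>1 + q / 2\<close> to first order, just small enough for
  \<open>(1 - q) * l \<le> 1 - q / 2\<close>.\<close>

lemma cube_le_power:
  fixes q :: real
  assumes "0 < q" "q \<le> 1"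
  shows "real t ^ 3 \<le> (6 / q) ^ 3 * ((1 + q / 6) ^ 3) ^ t"
proof -
  have "1 + real t * (q / 6) \<le> (1 + q / 6) ^ t"
    using assms by (intro Bernoulli_inequality) auto
  then have "real t * (q / 6) \<le> (1 + q / 6) ^ t" by simp
  then have "real t \<le> (6 / q) * (1 + q / 6) ^ t" using assms by (simp add: field_simps)
  then have "real t ^ 3 \<le> ((6 / q) * (1 + q / 6) ^ t) ^ 3" by (intro power_mono) auto
  also have "\<dots> = (6 / q) ^ 3 * ((1 + q / 6) ^ t) ^ 3" by (rule power_mult_distrib)
  also have "((1 + q / 6) ^ t) ^ 3 = ((1 + q / 6) ^ 3) ^ t"
    by (simp add: mult.commute flip: power_mult)
  finally show ?thesis .
qed

lemma expect_card_bunch: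
  assumes "finite A" "0 < q" "q \<le> 1"
  shows "expect q A (\<lambda>S. real (card (bunch d A S x)) ^ 3) \<le> 432 / q ^ 3"
proof -
  let ?l = "(1 + q / 6) ^ 3"
  have "(1 - q) * ?l \<le> 1 - q / 2"
  proof -
    have "(1 - q) * ?l = 1 - q / 2 - (q^2 * 90 + q^3 * 17 + q^4) / 216"
      by (simp add: power3_eq_cube power2_eq_square power4_eq_xxxx field_simps)
    then show ?thesis using assms by simp
  qed
  then have "expect q A (\<lambda>S. ?l ^ card (bunch d A S x)) \<le> 2"
    unfolding bunch_def using assms by (intro expect_exp_card_less) (auto intro: one_le_power)
  then have "(6 / q) ^ 3 * expect q A (\<lambda>S. ?l ^ card (bunch d A S x)) \<le> (6 / q) ^ 3 * 2"
    using assms by (intro mult_left_mono) auto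
  also have "\<dots> = 432 / q ^ 3" by (simp add: power_divide)
  finally have "expect q A (\<lambda>S. (6 / q) ^ 3 * ?l ^ card (bunch d A S x)) \<le> 432 / q ^ 3"
    by (simp only: expect_scale)
  moreover have "expect q A (\<lambda>S. real (card (bunch d A S x)) ^ 3)
      \<le> expect q A (\<lambda>S. (6 / q) ^ 3 * ?l ^ card (bunch d A S x))"
    using assms by (intro expect_mono cube_le_power) auto
  ultimately show ?thesis by simp
qed

text \<open>Both quantities are divided by the bounds for their means, so the sum has mean at most
  2, and some sample keeps each within twice its bound. Sampling at rate \<open>q / 2\<close>
  absorbs this 2 in the size; the cubes receive \<open>2 * 432 * 2 ^ 3 = 6912\<close>.\<close>

lemma sample:
  fixes q :: real
  assumes "finite A" "0 < q" "q \<le> 1"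
  shows "\<exists>S\<subseteq>A. real (card S) \<le> q * card A \<and>
           (\<Sum>x\<in>A. real (card (bunch d A S x)) ^ 3) \<le> 6912 / q ^ 3 * card A"
proof (cases "A = {}")
  case False
  define p where "p = q / 2"
  have p: "0 < p" "p \<le> 1" using assms by (auto simp: p_def)
  define m where "m = real (card A)"
  have m: "m > 0" using False assms by (auto simp: m_def card_gt_0_iff)
  let ?B = "\<lambda>S. \<Sum>x\<in>A. real (card (bunch d A S x)) ^ 3"
  have "expect p A (\<lambda>S. (1 / (p * m)) * real (card S) + (p ^ 3 / (432 * m)) * ?B S)
    = (1 / (p * m)) * (p * m) + (p ^ 3 / (432 * m)) * (\<Sum>x\<in>A. expect p A (\<lambda>S. real (card (bunch d A S
      x)) ^ 3))"
    using assms by (simp only: expect_add expect_scale expect_sum expect_card m_def)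
  also have "\<dots> \<le> 1 + (p ^ 3 / (432 * m)) * (\<Sum>x\<in>A. 432 / p ^ 3)"
    using m p assms by (intro add_mono mult_left_mono sum_mono expect_card_bunch) auto
  also have "\<dots> = 2" using m p by (simp add: m_def)
  finally obtain S where S: "S \<subseteq> A" "(1 / (p * m)) * real (card S) + (p ^ 3 / (432 * m)) * ?B S \<le> 2"
    using expect_exists[of A p] assms p by (meson less_imp_le)
  have nn: "0 \<le> (1 / (p * m)) * real (card S)" "0 \<le> (p ^ 3 / (432 * m)) * ?B S"
    using p m by (simp_all add: sum_nonneg)
  have "(1 / (p * m)) * real (card S) \<le> 2" using S nn by linarith
  then have 1: "real (card S) \<le> q * card A" using p m by (simp add: field_simps p_def m_def)
  have "(p ^ 3 / (432 * m)) * ?B S \<le> 2" using S nn by linarith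
  then have "?B S \<le> 864 * m / p ^ 3" using p m by (simp add: field_simps)
  also have "864 * m / p ^ 3 = 6912 / q ^ 3 * card A" by (simp add: p_def m_def power_divide)
  finally show ?thesis using S 1 by blast
qed auto

lemma hierarchy_rates:
  fixes q :: "nat \<Rightarrow> real"
  assumes "finite V" "\<And>i. 0 < q i" "\<And>i. q i \<le> 1"
  shows "\<exists>A. A 0 = V \<and> (\<forall>i. finite (A i) \<and> A (Suc i) \<subseteq> A i \<and>
    real (card (A (Suc i))) \<le> q i * card (A i) \<and>
           (\<Sum>x\<in>A i. real (card (bunch d (A i) (A (Suc i)) x)) ^ 3) \<le> 6912 / q i ^ 3 * card (A i))"
proof -
  have "\<exists>A. \<forall>i. (finite (A i) \<and> (i = 0 \<longrightarrow> A i = V)) \<and>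
     (A (Suc i) \<subseteq> A i \<and> real (card (A (Suc i))) \<le> q i * card (A i) \<and>
           (\<Sum>x\<in>A i. real (card (bunch d (A i) (A (Suc i)) x)) ^ 3) \<le> 6912 / q i ^ 3 * card (A i))"
  proof (rule dependent_nat_choice)
    fix X and i :: nat assume "finite X \<and> (i = 0 \<longrightarrow> X = V)"
    then show "\<exists>Y. (finite Y \<and> (Suc i = 0 \<longrightarrow> Y = V)) \<and> Y \<subseteq> X \<and>
        real (card Y) \<le> q i * card X \<and>
        (\<Sum>x\<in>X. real (card (bunch d X Y x)) ^ 3) \<le> 6912 / q i ^ 3 * card X"
      using sample[of X "q i" d] assms finite_subset by (metis nat.distinct(1))
  qed (use assms in auto)
  then show ?thesis by metis
qed

lemma hierarchy:
  fixes d :: "nat \<Rightarrow> nat \<Rightarrow> ereal"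
  assumes k: "3 \<le> k" and l: "real k + 1 \<le> (4 / 3) ^ Suc l"
  shows "\<exists>A. A 0 = {..<n} \<and> (\<forall>i. A (Suc i) \<subseteq> A i) \<and> A (Suc l) = {} \<and> (\<forall>i\<ge>n. A i = {}) \<and>
     (\<forall>i. real (card (A i)) \<le> real n / 2 ^ i) \<and>
     (\<Sum>i\<le>l. \<Sum>x\<in>A i. real (card (bunch d (A i) (A (Suc i)) x)) ^ 3)
        \<le> 110592 * real n powr (1 + 1 / real k)"
proof (cases "n = 0")
  case True
  then show ?thesis by (intro exI[of _ "\<lambda>_. {}"]) auto
next
  case False
  define N where "N = real n powr (1 / real k)"
  have N: "1 \<le> N" unfolding N_def using False k by (intro ge_one_powr_ge_zero) auto
  \<comment> \<open>The size exponent drops by \<open>(4/3) ^ i / 3\<close> from level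
    \<open>i\<close> to the next, which turns \<open>1 - (4/3) ^ i\<close> into
    \<open>1 - (4/3) ^ Suc i\<close>. The inverse cube of the rate gives back
    \<open>N powr (4/3) ^ i\<close>, so the size times this is \<open>n * N\<close> up to constants,
    with the additional decay \<open>1 / 2 ^ i\<close> from halving.\<close>
  define q where "q = (\<lambda>i. N powr (- ((4/3) ^ i / 3)) / 2)"
  have q: "0 < q i" "q i \<le> 1" for i
  proof -
    show "0 < q i" using N by (simp add: q_def)
    have "N powr (- ((4/3) ^ i / 3)) \<le> N powr 0" using N by (intro powr_mono) auto
    then show "q i \<le> 1" using N by (simp add: q_def)
  qed
  obtain A where A: "A 0 = {..<n}" "\<And>i. finite (A i)" "\<And>i. A (Suc i) \<subseteq> A i"
    "\<And>i. real (card (A (Suc i))) \<le> q i * card (A i)"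
    "\<And>i. (\<Sum>x\<in>A i. real (card (bunch d (A i) (A (Suc i)) x)) ^ 3) \<le> 6912 / q i ^ 3 * card (A i)"
    using hierarchy_rates[of "{..<n}" q d] q by (metis finite_lessThan)
  have size: "real (card (A i)) \<le> real n * N powr (1 - (4/3) ^ i) / 2 ^ i" for i
  proof (induction i)
    case 0
    then show ?case using A N by simp
  next
    case (Suc i)
    have "real (card (A (Suc i))) \<le> q i * card (A i)" by (rule A)
    also have "\<dots> \<le> q i * (real n * N powr (1 - (4/3) ^ i) / 2 ^ i)"
      using Suc q[of i] by (intro mult_left_mono) auto
    also have "\<dots> = real n * (N powr (- ((4/3) ^ i / 3)) * N powr (1 - (4/3) ^ i)) / 2 ^ Suc i"
      by (simp add: q_def)
    also have "N powr (- ((4/3) ^ i / 3)) * N powr (1 - (4/3) ^ i) = N powr (1 - (4/3) ^ Suc i)"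
      by (simp flip: powr_add)
    finally show ?case .
  qed
  have size2: "real (card (A i)) \<le> real n / 2 ^ i" for i
  proof -
    have "N powr (1 - (4/3) ^ i) \<le> N powr 0" using N by (intro powr_mono) auto
    then have "real n * N powr (1 - (4/3) ^ i) \<le> real n * 1" using N by (intro mult_left_mono) auto
    then have "real n * N powr (1 - (4/3) ^ i) / 2 ^ i \<le> real n / 2 ^ i"
      by (simp add: divide_right_mono)
    then show ?thesis using size[of i] by linarith
  qed
  have emp: "A i = {}" if "real (card (A i)) < 1" for i
    using that A(2)[of i] by auto
  \<comment> \<open>Halving alone empties these levels, however large \<open>k\<close> is.\<close>
  have "A i = {}" if "i \<ge> n" for i
  proof (rule emp)
    have "real n < 2 ^ n" by (rule of_nat_less_two_power)
    also have "\<dots> \<le> 2 ^ i" using that by (intro power_increasing) auto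
    finally show "real (card (A i)) < 1" using size2[of i]
      by (smt (verit) divide_less_eq_1_pos zero_less_power)
  qed
  moreover have "A (Suc l) = {}"
  proof (rule emp)
    \<comment> \<open>The hypothesis on \<open>l\<close> makes the exponent at most
      \<open>- k\<close>, and \<open>N powr (- k)\<close> is \<open>1 / n\<close>, so the set has
      fewer than one element.\<close>
    have "N powr (1 - (4/3) ^ Suc l) \<le> N powr (- real k)" using N l by (intro powr_mono) auto
    also have "\<dots> = 1 / real n" using k False by (simp add: N_def powr_powr powr_minus
      divide_inverse)
    finally have "real n * N powr (1 - (4/3) ^ Suc l) \<le> 1"
      using False by (simp add: field_simps)
    then have "real n * N powr (1 - (4/3) ^ Suc l) / 2 ^ Suc l \<le> 1 / 2 ^ Suc l"
      by (intro divide_right_mono) auto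
    also have "\<dots> < 1" using one_less_power[of "2::real" "Suc l"] by (simp del: power_Suc)
    finally show "real (card (A (Suc l))) < 1" using size[of "Suc l"] by linarith
  qed
  moreover have "(\<Sum>i\<le>l. \<Sum>x\<in>A i. real (card (bunch d (A i) (A (Suc i)) x)) ^ 3)
        \<le> 110592 * real n powr (1 + 1 / real k)"
  proof -
    have nN: "real n powr (1 + 1 / real k) = real n * N" using False by (simp add: N_def powr_add)
    have "(\<Sum>x\<in>A i. real (card (bunch d (A i) (A (Suc i)) x)) ^ 3) \<le> 55296 * (real n * N) * (1/2) ^
      i" for i
    proof -
      have "(\<Sum>x\<in>A i. real (card (bunch d (A i) (A (Suc i)) x)) ^ 3) \<le> 6912 / q i ^ 3 * card (A i)"
        by (rule A)
      also have "\<dots> \<le> 6912 / q i ^ 3 * (real n * N powr (1 - (4/3) ^ i) / 2 ^ i)"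
        using size[of i] q[of i] by (intro mult_left_mono) auto
      also have "q i ^ 3 = N powr (- ((4/3) ^ i)) / 8"
      proof -
        have "q i ^ 3 = (N powr (- ((4/3) ^ i / 3))) ^ 3 / 8" by (simp add: q_def power_divide)
        also have "(N powr (- ((4/3) ^ i / 3))) ^ 3 = N powr (- ((4/3) ^ i / 3) * 3)"
          using N by (simp add: powr_powr flip: powr_numeral)
        finally show ?thesis by simp
      qed
      also have "6912 / (N powr (- ((4/3) ^ i)) / 8) = 55296 * N powr ((4/3) ^ i)"
        by (simp add: powr_minus field_simps)
      also have "55296 * N powr ((4/3) ^ i) * (real n * N powr (1 - (4/3) ^ i) / 2 ^ i) =
         55296 * real n * (N powr ((4/3) ^ i) * N powr (1 - (4/3) ^ i)) / 2 ^ i" by simp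
      also have "N powr ((4/3) ^ i) * N powr (1 - (4/3) ^ i) = N" using N by (simp flip: powr_add)
      finally show ?thesis by (simp add: power_divide)
    qed
    then have "(\<Sum>i\<le>l. \<Sum>x\<in>A i. real (card (bunch d (A i) (A (Suc i)) x)) ^ 3)
       \<le> (\<Sum>i\<le>l. 55296 * (real n * N) * (1/2) ^ i)" by (intro sum_mono)
    also have "\<dots> = 55296 * (real n * N) * (\<Sum>i\<le>l. (1/2) ^ i)" by (simp only: sum_distrib_left)
    also have "\<dots> \<le> 55296 * (real n * N) * 2"
      using N by (intro mult_left_mono) (auto simp: sum_gp0)
    finally show ?thesis by (simp add: nN)
  qed
  ultimately show ?thesis using A size2 by blast
qed

section \<open>The hopset\<close>

text \<open>Vertices may repeat, so walks concatenate freely; simple paths are extracted from them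
  afterwards without raising the count or the cost.\<close>

inductive kwalk :: "('a \<times> 'a) set \<Rightarrow> ('a \<Rightarrow> 'a \<Rightarrow> real) \<Rightarrow> nat \<Rightarrow> real \<Rightarrow> 'a \<Rightarrow> 'a \<Rightarrow> bool"
  for K d where
  kwalk_refl: "kwalk K d 0 0 u u"
| kwalk_step: "(u, x) \<in> K \<Longrightarrow> kwalk K d t c x v \<Longrightarrow> kwalk K d (Suc t) (d u x + c) u v"

lemma kwalk_trans:
  "kwalk K d t c u x \<Longrightarrow> kwalk K d t' c' x v \<Longrightarrow> kwalk K d (t + t') (c + c') u v"
  by (induction rule: kwalk.induct) (auto simp: add.assoc intro: kwalk.intros)

lemma kwalk_single: "(u, v) \<in> K \<Longrightarrow> kwalk K d 1 (d u v) u v"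
  using kwalk_step[OF _ kwalk_refl, of u v K d] by simp

text \<open>The payment for one jump of level \<open>m\<close>: no potential rises, and the drop of
  the potential of level \<open>m\<close> by 1 releases its price \<open>h m\<close>.\<close>

lemma sum_drop_one:
  fixes f g h :: "nat \<Rightarrow> real"
  assumes "m \<le> l" "\<And>i. i \<le> l \<Longrightarrow> g i \<le> f i" "g m \<le> f m - 1" "\<And>i. 0 \<le> h i"
  shows "h m + (\<Sum>i\<le>l. g i * h i) \<le> (\<Sum>i\<le>l. f i * h i)"
proof -
  have split: "(\<Sum>i\<le>l. F i) = F m + (\<Sum>i\<in>{..l} - {m}. F i)" for F :: "nat \<Rightarrow> real"
    using assms by (subst sum.remove[of _ m]) auto
  have "g m * h m \<le> (f m - 1) * h m" using assms by (intro mult_right_mono) auto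
  moreover have "(\<Sum>i\<in>{..l} - {m}. g i * h i) \<le> (\<Sum>i\<in>{..l} - {m}. f i * h i)"
    using assms by (intro sum_mono mult_right_mono) auto
  ultimately show ?thesis unfolding split by (simp add: algebra_simps)
qed

section \<open>Distances and positions along the selected paths\<close>

context shortest_paths
begin

text \<open>Meaningful for connected pairs only, since \<open>\<pi>\<close> is unconstrained on the
  others.\<close>

definition dst :: "nat \<Rightarrow> nat \<Rightarrow> real" where
  "dst u v = wt w (\<pi> u v)"

lemma gdist_conn: "conn n E u v \<Longrightarrow> gdist n E w u v = ereal (dst u v)"
  unfolding gdist_def dst_def
  using path[of u v] shortest[of u v]
  by (intro antisym INF_lower2[of "\<pi> u v"] INF_greatest) (auto simp: path_weight_edge_cost)

lemma gdist_not_conn: "\<not> conn n E u v \<Longrightarrow> gdist n E w u v = \<infinity>"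
proof -
  assume "\<not> conn n E u v"
  then have "{p. is_path n E u v p} = {}" by (auto simp: conn_def)
  then show ?thesis by (simp only: gdist_def image_empty Inf_empty top_ereal_def)
qed

lemma gdist_less_top: "gdist n E w u v < \<infinity> \<longleftrightarrow> conn n E u v"
  using gdist_conn gdist_not_conn by fastforce

lemma E_nonneg: "e \<in> E \<Longrightarrow> 0 \<le> w e"
  using wgraph by (auto simp: wgraph_def)

lemma dst_nonneg: "conn n E u v \<Longrightarrow> 0 \<le> dst u v"
  unfolding dst_def using path[of u v] E_nonneg by (intro wt_nonneg) (auto simp: is_path_iff)

lemma dst_sym: "conn n E u v \<Longrightarrow> dst v u = dst u v"
  by (simp add: dst_def symmetric wt_rev)

lemma dst_triangle:
  assumes "conn n E u x" "conn n E x v"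
  shows "dst u v \<le> dst u x + dst x v"
proof -
  obtain r where "is_path n E u v r" "wt w r \<le> wt w (\<pi> u x) + wt w (\<pi> x v)"
    using join_paths[OF path[OF assms(1)] path[OF assms(2)], of w] E_nonneg by auto
  then show ?thesis using shortest[of u v r] by (simp add: dst_def)
qed

lemma \<pi>_refl: "u < n \<Longrightarrow> \<pi> u u = [u]"
proof -
  assume "u < n"
  then have "is_path n E u u (\<pi> u u)" by (intro path conn_refl)
  then show ?thesis by (cases "\<pi> u u") (auto simp: is_path_iff split: if_splits)
qed

lemma dst_refl: "u < n \<Longrightarrow> dst u u = 0"
  by (simp add: dst_def \<pi>_refl)

lemma \<pi>_nth:
  assumes "conn n E u v" "i \<le> j" "j < length (\<pi> u v)"
  shows "\<pi> (\<pi> u v ! i) (\<pi> u v ! j) = take (Suc j - i) (drop i (\<pi> u v))"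
    and "conn n E (\<pi> u v ! i) (\<pi> u v ! j)"
proof -
  let ?m = "take (Suc j - i) (drop i (\<pi> u v))"
  have ne: "?m \<noteq> []" using assms by auto
  have s: "sublist ?m (\<pi> u v)"
    by (metis append_take_drop_id sublist_append_leftI sublist_appendI sublist_order.order_trans
      sublist_append_rightI)
  have h: "hd ?m = \<pi> u v ! i" using assms by (simp add: hd_drop_conv_nth)
  have "last ?m = ?m ! (length ?m - 1)" using ne by (rule last_conv_nth)
  also have "\<dots> = \<pi> u v ! j" using assms by (simp add: nth_take)
  finally have l: "last ?m = \<pi> u v ! j" .
  show "\<pi> (\<pi> u v ! i) (\<pi> u v ! j) = ?m" using consistent[OF assms(1) s ne] h l by simp
  show "conn n E (\<pi> u v ! i) (\<pi> u v ! j)"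
    using is_path_sublist[OF path[OF assms(1)] s ne] h l unfolding conn_def by auto
qed

definition pos :: "nat \<Rightarrow> nat \<Rightarrow> nat \<Rightarrow> real" where
  "pos u v i = dst u (\<pi> u v ! i)"

lemma dst_along:
  assumes "conn n E u v" "i \<le> j" "j < length (\<pi> u v)"
  shows "dst (\<pi> u v ! i) (\<pi> u v ! j) = pos u v j - pos u v i"
proof -
  let ?p = "\<pi> u v"
  have p0: "?p ! 0 = u" using path[OF assms(1)] by (auto simp: is_path_iff hd_conv_nth)
  have "wt w (take (Suc j) ?p) = wt w (take (Suc i) ?p) + wt w (take (Suc j - i) (drop i ?p))"
  proof -
    have "take (Suc j) ?p = take i ?p @ ?p ! i # drop (Suc i) (take (Suc j) ?p)"
      using assms id_take_nth_drop[of i "take (Suc j) ?p"] by (simp add: min_def)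
    moreover have "take (Suc i) ?p = take i ?p @ [?p ! i]"
      using assms by (simp add: take_Suc_conv_app_nth)
    moreover have "take (Suc j - i) (drop i ?p) = ?p ! i # drop (Suc i) (take (Suc j) ?p)"
      using assms by (metis Cons_nth_drop_Suc Suc_diff_le drop_take le_less_trans less_imp_le_nat
        take_Suc_Cons diff_Suc_Suc)
    ultimately show ?thesis using wt_append by metis
  qed
  moreover have "\<pi> u (?p ! a) = take (Suc a) ?p" if "a < length ?p" for a
    using \<pi>_nth(1)[OF assms(1), of 0 a] that p0 by simp
  ultimately show ?thesis using assms \<pi>_nth(1)[OF assms] by (simp add: pos_def dst_def)
qed

lemma pos_mono:
  assumes "conn n E u v" "i \<le> j" "j < length (\<pi> u v)"
  shows "pos u v i \<le> pos u v j"
  using dst_along[OF assms] dst_nonneg[OF \<pi>_nth(2)[OF assms]] by simp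

end

section \<open>Pivots, hops and the greedy walk\<close>

locale hierarchy = shortest_paths +
  fixes A :: "nat \<Rightarrow> nat set" and l :: nat
  assumes A_0: "A 0 = {..<n}"
    and A_Suc: "A (Suc i) \<subseteq> A i"
    and A_top: "A (Suc l) = {}"
begin

lemma A_less: "x \<in> A i \<Longrightarrow> x < n"
proof -
  have "A i \<subseteq> A 0" using A_Suc by (induction i) auto
  then show "x \<in> A i \<Longrightarrow> x < n" using A_0 by auto
qed

lemma finite_A: "finite (A i)"
  using A_less by (intro finite_subset[of "A i" "{..<n}"]) auto

definition reach :: "nat \<Rightarrow> nat \<Rightarrow> bool" where
  "reach i x \<longleftrightarrow> (\<exists>z\<in>A i. conn n E x z)"

definition setdist :: "nat \<Rightarrow> nat \<Rightarrow> ereal" where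
  "setdist i x = (INF z\<in>A i. gdist n E w x z)"

definition nearest :: "nat \<Rightarrow> nat \<Rightarrow> nat \<Rightarrow> bool" where
  "nearest i x z \<longleftrightarrow> z \<in> A i \<and> conn n E x z \<and> (\<forall>z'\<in>A i. conn n E x z' \<longrightarrow> dst x z \<le> dst x z')"

text \<open>Ties are broken by the least index, so that all vertices on the path from \<open>x\<close> to its pivot
  have the same pivot.\<close>

definition pivot :: "nat \<Rightarrow> nat \<Rightarrow> nat" where
  "pivot i x = (LEAST z. nearest i x z)"

lemma nearest_pivot: "reach i x \<Longrightarrow> nearest i x (pivot i x)"
proof -
  assume "reach i x"
  then have "finite (dst x ` {z \<in> A i. conn n E x z})" "dst x ` {z \<in> A i. conn n E x z} \<noteq> {}"
    using finite_A by (auto simp: reach_def)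
  from Min_in[OF this] Min_le[OF this(1)] have "\<exists>z. nearest i x z"
    unfolding nearest_def by fastforce
  then show ?thesis unfolding pivot_def by (metis LeastI)
qed

lemma setdist_reach: "reach i x \<Longrightarrow> setdist i x = ereal (dst x (pivot i x))"
  unfolding setdist_def
proof (rule antisym)
  assume "reach i x"
  note p = nearest_pivot[OF this, unfolded nearest_def]
  show "(INF z\<in>A i. gdist n E w x z) \<le> ereal (dst x (pivot i x))"
    using p gdist_conn by (intro INF_lower2[of "pivot i x"]) auto
  show "ereal (dst x (pivot i x)) \<le> (INF z\<in>A i. gdist n E w x z)"
    using p gdist_conn gdist_not_conn by (intro INF_greatest) (metis ereal_less_eq(1,3))
qed

lemma setdist_not_reach: "\<not> reach i x \<Longrightarrow> setdist i x = \<infinity>"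
  unfolding setdist_def reach_def using gdist_not_conn
  by (intro antisym INF_greatest) auto

text \<open>At level \<open>l\<close> the set distance is infinite, so all connected pairs of
  \<open>A l\<close> are hops. This is what lets a jump from the highest level succeed.\<close>

definition half :: "nat \<Rightarrow> (nat \<times> nat) set" where
  "half i = {(x, y). x \<in> A i \<and> y \<in> A i \<and> conn n E x y \<and> ereal (2 * dst x y) < setdist (Suc i) x}"

definition up :: "nat \<Rightarrow> (nat \<times> nat) set" where
  "up i = {(x, pivot (Suc i) x) |x. x \<in> A i \<and> reach (Suc i) x}"

definition hops :: "(nat \<times> nat) set" where
  "hops = (\<Union>i\<le>l. half i \<union> up i)"

text \<open>Pivot hops are walked in both directions, half-bunch hops only away from the vertex
  whose radius admits them. An edge counts if it is itself the selected path, so that every step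
  costs the distance between its ends.\<close>

definition steps :: "(nat \<times> nat) set" where
  "steps = {(x, y). conn n E x y \<and> \<pi> x y = [x, y]} \<union> (\<Union>i\<le>l. half i \<union> up i \<union> (up i)\<inverse>)"

lemma half_conn: "(x, y) \<in> half i \<Longrightarrow> conn n E x y"
  by (auto simp: half_def)

lemma up_conn: "(x, y) \<in> up i \<Longrightarrow> conn n E x y"
  using nearest_pivot by (auto simp: up_def nearest_def)

lemma steps_conn: "(x, y) \<in> steps \<Longrightarrow> conn n E x y"
  unfolding steps_def using half_conn up_conn conn_sym by blast

abbreviation walk :: "nat \<Rightarrow> real \<Rightarrow> nat \<Rightarrow> nat \<Rightarrow> bool" where
  "walk \<equiv> kwalk steps dst"

fun chain :: "nat \<Rightarrow> nat \<Rightarrow> nat" where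
  "chain 0 x = x"
| "chain (Suc m) x = pivot (Suc m) (chain m x)"

text \<open>The length becomes and stays infinite once a level cannot be reached, so a finite length
  certifies that all pivots of the chain exist.\<close>

fun chain_len :: "nat \<Rightarrow> nat \<Rightarrow> ereal" where
  "chain_len 0 x = 0"
| "chain_len (Suc m) x = chain_len m x + setdist (Suc m) (chain m x)"

lemma setdist_nonneg: "0 \<le> setdist i x"
  unfolding setdist_def using gdist_conn gdist_not_conn dst_nonneg
  by (intro INF_greatest) (metis ereal_less_eq(5) ereal_infty_less_eq(1) linear)

lemma chain_len_nonneg: "0 \<le> chain_len m x"
  by (induction m) (auto simp: setdist_nonneg)

lemma chain_walk:
  assumes "chain_len m x < \<infinity>" "x < n" "m \<le> Suc l"
  shows "chain m x \<in> A m \<and> conn n E x (chain m x) \<and>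
     (\<exists>c. chain_len m x = ereal c \<and> walk m c x (chain m x) \<and> walk m c (chain m x) x \<and>
        dst x (chain m x) \<le> c)"
  using assms
proof (induction m)
  case 0
  then show ?case using A_0 conn_refl dst_refl
    by (auto intro!: kwalk_refl exI[of _ 0] simp: zero_ereal_def)
next
  case (Suc m)
  let ?z = "chain m x" and ?y = "chain (Suc m) x"
  have fin: "chain_len m x < \<infinity>" "setdist (Suc m) ?z < \<infinity>"
    using Suc.prems(1) chain_len_nonneg[of m x] setdist_nonneg[of "Suc m" ?z] by auto
  obtain c where IH: "?z \<in> A m" "conn n E x ?z" "chain_len m x = ereal c" "walk m c x ?z"
    "walk m c ?z x" "dst x ?z \<le> c" using Suc fin by auto
  have r: "reach (Suc m) ?z" using fin setdist_not_reach by force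
  note p = nearest_pivot[OF r, unfolded nearest_def]
  have up: "(?z, ?y) \<in> up m" using IH r by (auto simp: up_def)
  have s: "(?z, ?y) \<in> steps" "(?y, ?z) \<in> steps" using up Suc.prems(3) by (auto simp: steps_def)
  have c2: "conn n E ?z ?y" using p by simp
  have w: "walk (Suc m) (c + dst ?z ?y) x ?y"
    using kwalk_trans[OF IH(4) kwalk_single[OF s(1)]] by simp
  have w': "walk (Suc m) (c + dst ?z ?y) ?y x"
    using kwalk_trans[OF kwalk_single[OF s(2)] IH(5)] dst_sym[OF c2] by (simp add: add.commute)
  have "dst x ?y \<le> c + dst ?z ?y" using dst_triangle[OF IH(2) c2] IH(6) by simp
  moreover have "chain_len (Suc m) x = ereal (c + dst ?z ?y)"
    using setdist_reach[OF r] IH(3) by simp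
  ultimately show ?case using w w' p conn_trans[OF IH(2) c2] by auto
qed

text \<open>Both chains of length \<open>m\<close> are at most \<open>4 * B / r \<le> B / 4\<close>
  long, so their ends are at distance at most \<open>3 * B / 2\<close>, while by \<open>far\<close>
  the next pivot of the first end is more than \<open>15 * B / 4\<close> away. Hence the ends form a
  half-bunch pair. The detour costs each chain twice, in total
  \<open>4 * (4 * B / r)\<close>.\<close>

lemma jump:
  assumes r: "16 \<le> r" and B: "0 < B" and m: "m \<le> l"
    and xy: "conn n E x y" "dst x y \<le> B"
    and near: "chain_len m x \<le> ereal (4 * B / r)" "chain_len m y \<le> ereal (4 * B / r)"
    and far: "ereal (4 * B) < chain_len (Suc m) x"
  shows "\<exists>c. walk (2 * m + 1) c x y \<and> c \<le> dst x y + 16 * B / r"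
proof -
  let ?z = "chain m x" and ?z' = "chain m y"
  have n: "x < n" "y < n" using conn_less[OF xy(1)] by auto
  have fin: "chain_len m x < \<infinity>" "chain_len m y < \<infinity>"
    using near by (metis ereal_infty_less(1) ereal_infty_less_eq(1) PInfty_neq_ereal(1))+
  obtain a where a: "?z \<in> A m" "conn n E x ?z" "chain_len m x = ereal a" "walk m a x ?z"
    "dst x ?z \<le> a"
    using chain_walk[OF fin(1) n(1)] m by auto
  obtain b where b: "?z' \<in> A m" "conn n E y ?z'" "chain_len m y = ereal b" "walk m b ?z' y"
    "dst y ?z' \<le> b"
    using chain_walk[OF fin(2) n(2)] m by auto
  have ab: "a \<le> 4 * B / r" "b \<le> 4 * B / r" using near a b by auto
  have Br: "4 * B / r \<le> B / 4" using r B by (simp add: field_simps)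
  have zx: "conn n E ?z x" using a conn_sym by simp
  have zy: "conn n E ?z y" using conn_trans[OF zx xy(1)] .
  have zz: "conn n E ?z ?z'" using conn_trans[OF zy b(2)] .
  have d: "dst ?z ?z' \<le> a + dst x y + b"
    using dst_triangle[OF zy b(2)] dst_triangle[OF zx xy(1)] dst_sym[OF a(2)] a(5) b(5) by linarith
  have "ereal (2 * dst ?z ?z') < setdist (Suc m) ?z"
  proof (cases "setdist (Suc m) ?z")
    case (real e)
    then have "4 * B < a + e" using far a by simp
    then show ?thesis using real d xy(2) ab Br B by simp
  qed (use setdist_nonneg[of "Suc m" ?z] in auto)
  then have "(?z, ?z') \<in> half m" using a b zz by (auto simp: half_def)
  then have "(?z, ?z') \<in> steps" using m by (auto simp: steps_def)
  from kwalk_trans[OF kwalk_trans[OF a(4) kwalk_single[OF this]] b(4)]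
  have "walk (2 * m + 1) (a + dst ?z ?z' + b) x y" by (simp add: mult_2 add.assoc)
  moreover have "16 * B / r = 4 * (4 * B / r)" by simp
  then have "a + dst ?z ?z' + b \<le> dst x y + 16 * B / r" using d ab by linarith
  ultimately show ?thesis by blast
qed

lemma greedy_walk:
  assumes r: "16 \<le> r" and s: "0 < s" and uv: "conn n E u v"
  shows "\<exists>t c. walk t c u v \<and>
    c \<le> dst u v + (\<Sum>m\<le>l. (1 + dst u v / (r ^ m * s)) * (16 * (r ^ m * s) / r)) \<and>
    real t \<le> (\<Sum>m\<le>l. (1 + dst u v / (r ^ m * s)) * real (2 * m + 2))"
proof -
  let ?p = "\<pi> u v"
  let ?L = "length ?p" and ?P = "pos u v"
  have P: "is_path n E u v ?p" using path[OF uv] .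
  have L: "0 < ?L" using P by (auto simp: is_path_iff)
  have p0: "?p ! 0 = u" using P by (auto simp: is_path_iff hd_conv_nth)
  have pL: "?p ! (?L - 1) = v" using P by (auto simp: is_path_iff last_conv_nth)
  have u: "u < n" using conn_less[OF uv] by simp
  define Bs where "Bs = (\<lambda>m. r ^ m * s)"
  have Bs: "0 < Bs m" for m using r s by (simp add: Bs_def)
  \<comment> \<open>The threshold of level \<open>m + 1\<close> is \<open>4 * Bs m\<close>, so a
    vertex that is not near at level \<open>m + 1\<close> satisfies the hypothesis
    \<open>far\<close> of a jump at level \<open>m\<close>.\<close>
  define near where "near = (\<lambda>m j. chain_len m (?p ! j) \<le> ereal (4 * Bs m / r))"
  have near0: "near 0 j" for j using Bs[of 0] r by (simp add: near_def)
  define ahead where "ahead = (\<lambda>m i. {j. i \<le> j \<and> j < ?L \<and> near m j})"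
  \<comment> \<open>An upper bound for the number of jumps of level \<open>m\<close> still to come:
    the first cannot start before the next near vertex, and consecutive ones start more than
    \<open>Bs m\<close> apart.\<close>
  define \<phi> where "\<phi> = (\<lambda>m i. if ahead m i = {} then 0 else 1 + (dst u v - ?P (Min (ahead m i))) / Bs
    m)"
  have fin: "finite (ahead m i)" for m i by (rule finite_subset[of _
    "{..<?L}"]) (auto simp: ahead_def)
  have Pv: "?P (?L - 1) = dst u v" unfolding pos_def pL ..
  have Pmono: "?P i \<le> ?P j" if "i \<le> j" "j < ?L" for i j using pos_mono[OF uv that] .
  have Pj: "?P j \<le> dst u v" if "j < ?L" for j using Pmono[of j "?L - 1"] that Pv by simp
  have \<phi>0: "0 \<le> \<phi> m i" for m i
  proof (cases "ahead m i = {}")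
    case False
    then have "Min (ahead m i) < ?L" using Min_in[OF fin False] by (simp add: ahead_def)
    then show ?thesis using Pj Bs[of m] False by (simp add: \<phi>_def)
  qed (simp add: \<phi>_def)
  have \<phi>mono: "\<phi> m j \<le> \<phi> m i" if "i \<le> j" for m i j
  proof (cases "ahead m j = {}")
    case True
    then show ?thesis using \<phi>0 by (simp add: \<phi>_def)
  next
    case False
    have sub: "ahead m j \<subseteq> ahead m i" using that by (auto simp: ahead_def)
    then have ne: "ahead m i \<noteq> {}" using False by auto
    have "Min (ahead m i) \<le> Min (ahead m j)" using Min_antimono[OF sub False fin] .
    moreover have "Min (ahead m j) < ?L" using Min_in[OF fin False] by (simp add: ahead_def)
    ultimately have "?P (Min (ahead m i)) \<le> ?P (Min (ahead m j))" using Pmono by simp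
    then show ?thesis using False ne Bs[of m] by (simp add: \<phi>_def divide_right_mono)
  qed
  let ?e = "\<lambda>m. 16 * Bs m / r" and ?h = "\<lambda>m. real (2 * m + 2)"
  have main: "\<exists>t c. walk t c (?p ! i) v \<and> c \<le> dst u v - ?P i + (\<Sum>m\<le>l. \<phi> m i * ?e m) \<and>
     real t \<le> (\<Sum>m\<le>l. \<phi> m i * ?h m)" if "i < ?L" for i
    using that
  proof (induction "?L - i" arbitrary: i rule: less_induct)
    case (less i)
    define M where "M = {m. m \<le> l \<and> near m i}"
    have M: "finite M" "M \<noteq> {}" using near0 by (auto simp: M_def)
    define m where "m = Max M"
    have m: "m \<le> l" "near m i" using Max_in[OF M] by (auto simp: m_def M_def)
    define J where "J = {j. i \<le> j \<and> j < ?L \<and> near m j \<and> ?P j - ?P i \<le> Bs m}"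
    have finJ: "finite J" by (rule finite_subset[of _ "{..<?L}"]) (auto simp: J_def)
    have iJ: "i \<in> J" using m less.prems Bs[of m] by (simp add: J_def)
    define j where "j = Max J"
    have j: "i \<le> j" "j < ?L" "near m j" "?P j - ?P i \<le> Bs m"
    proof -
      have "j \<in> J" unfolding j_def using Max_in[OF finJ] iJ by blast
      then show "i \<le> j" "j < ?L" "near m j" "?P j - ?P i \<le> Bs m" by (auto simp: J_def)
    qed
    have far: "ereal (4 * Bs m) < chain_len (Suc m) (?p ! i)"
    proof (cases "m = l")
      case True
      then have "setdist (Suc m) (chain m (?p ! i)) = \<infinity>"
        using A_top by (simp add: setdist_def top_ereal_def)
      then show ?thesis using chain_len_nonneg[of m] by simp
    next
      case False
      have "Suc m \<notin> M" using Max_ge[OF M(1), of "Suc m"] by (auto simp: m_def)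
      then have "\<not> near (Suc m) i" using m False by (auto simp: M_def)
      then show ?thesis using r by (simp add: near_def Bs_def)
    qed
    obtain c where c: "walk (2 * m + 1) c (?p ! i) (?p ! j)" "c \<le> ?P j - ?P i + ?e m"
      using jump[OF r Bs[of m] m(1) \<pi>_nth(2)[OF uv j(1,2)]] dst_along[OF uv j(1,2)] j(3,4) m(2) far
      by (auto simp: near_def)
    have ah: "ahead m i \<noteq> {}" "Min (ahead m i) = i"
      using m less.prems fin by (auto simp: ahead_def intro!: Min_eqI)
    have \<phi>m: "\<phi> m i = 1 + (dst u v - ?P i) / Bs m" using ah by (simp add: \<phi>_def)
    show ?case
    proof (cases "Suc j < ?L")
      case True
      have less': "?L - Suc j < ?L - i" using j by simp
      from less.hyps[OF less' True] obtain t' c' where IH: "walk t' c' (?p ! Suc j) v"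
        "c' \<le> dst u v - ?P (Suc j) + (\<Sum>m\<le>l. \<phi> m (Suc j) * ?e m)"
        "real t' \<le> (\<Sum>m\<le>l. \<phi> m (Suc j) * ?h m)" by blast
      have "\<pi> (?p ! j) (?p ! Suc j) = [?p ! j, ?p ! Suc j]"
        using \<pi>_nth(1)[OF uv _ True, of j] True
        by (simp add: numeral_2_eq_2 Cons_nth_drop_Suc[symmetric])
      then have "(?p ! j, ?p ! Suc j) \<in> steps"
        using \<pi>_nth(2)[OF uv _ True, of j] by (simp add: steps_def)
      then have "walk 1 (?P (Suc j) - ?P j) (?p ! j) (?p ! Suc j)"
        using kwalk_single dst_along[OF uv _ True, of j] by (metis le_add2 plus_1_eq_Suc)
      from kwalk_trans[OF kwalk_trans[OF c(1) this] IH(1)]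
      have W: "walk (2 * m + 2 + t') (c + (?P (Suc j) - ?P j) + c') (?p ! i) v" by simp
      have drop: "\<phi> m (Suc j) \<le> \<phi> m i - 1"
      proof (cases "ahead m (Suc j) = {}")
        case True
        then show ?thesis using \<phi>m Pj[OF less.prems] Bs[of m] by (simp add: \<phi>_def)
      next
        case False
        define j' where "j' = Min (ahead m (Suc j))"
        have j': "Suc j \<le> j'" "j' < ?L" "near m j'"
          using Min_in[OF fin False] by (auto simp: j'_def ahead_def)
        \<comment> \<open>\<open>j\<close> is the last near vertex within distance
          \<open>Bs m\<close> of \<open>i\<close>, so the next near vertex lies beyond that
          distance.\<close>
        have "j' \<notin> J" using Max_ge[OF finJ, of j'] j' by (auto simp: j_def)
        then have "Bs m < ?P j' - ?P i" using j' j by (auto simp: J_def)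
        then have "(dst u v - ?P j') / Bs m \<le> (dst u v - ?P i - Bs m) / Bs m"
          using Bs[of m] by (intro divide_right_mono) auto
        also have "\<dots> = (dst u v - ?P i) / Bs m - 1" using Bs[of m]
          by (simp add: diff_divide_distrib)
        finally show ?thesis using False \<phi>m by (simp add: \<phi>_def j'_def)
      qed
      have mono: "\<phi> i' (Suc j) \<le> \<phi> i' i" for i' using \<phi>mono[of i "Suc j"] j by simp
      have e: "?e m + (\<Sum>m\<le>l. \<phi> m (Suc j) * ?e m) \<le> (\<Sum>m\<le>l. \<phi> m i * ?e m)"
        using Bs r by (intro sum_drop_one m drop mono) (simp add: less_imp_le)
      have h: "?h m + (\<Sum>m\<le>l. \<phi> m (Suc j) * ?h m) \<le> (\<Sum>m\<le>l. \<phi> m i * ?h m)"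
        by (intro sum_drop_one m drop mono) simp
      have "c + (?P (Suc j) - ?P j) + c' \<le> dst u v - ?P i + (\<Sum>m\<le>l. \<phi> m i * ?e m)"
        using e IH(2) c(2) by linarith
      moreover have "real (2 * m + 2 + t') \<le> (\<Sum>m\<le>l. \<phi> m i * ?h m)"
        using h IH(3) by linarith
      ultimately show ?thesis using W by blast
    next
      case False
      then have jv: "j = ?L - 1" using j by simp
      \<comment> \<open>The jump ends at \<open>v\<close>; as its start is near at level
        \<open>m\<close>, the potential there is at least 1 and pays for it.\<close>
      have g: "0 + 1 \<le> \<phi> m i" using \<phi>m Pj[OF less.prems] Bs[of m] by simp
      have e: "?e m + (\<Sum>m\<le>l. 0 * ?e m) \<le> (\<Sum>m\<le>l. \<phi> m i * ?e m)"
        using g Bs r \<phi>0 by (intro sum_drop_one m) (simp_all add: less_imp_le)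
      have h: "?h m + (\<Sum>m\<le>l. 0 * ?h m) \<le> (\<Sum>m\<le>l. \<phi> m i * ?h m)"
        using g \<phi>0 by (intro sum_drop_one m) simp_all
      have W: "walk (2 * m + 1) c (?p ! i) v" using c(1) jv pL by simp
      have 1: "c \<le> dst u v - ?P i + (\<Sum>m\<le>l. \<phi> m i * ?e m)" using e c(2) jv Pv by simp
      have 2: "real (2 * m + 1) \<le> (\<Sum>m\<le>l. \<phi> m i * ?h m)" using h by simp
      show ?thesis using W 1 2 by blast
    qed
  qed
  have P0: "?P 0 = 0" using p0 dst_refl[OF u] by (simp add: pos_def)
  have \<phi>le: "\<phi> m 0 \<le> 1 + dst u v / (r ^ m * s)" for m
  proof (cases "ahead m 0 = {}")
    case True
    then show ?thesis using Bs[of m] dst_nonneg[OF uv] by (simp add: \<phi>_def Bs_def)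
  next
    case False
    then have "0 \<le> ?P (Min (ahead m 0))"
      using Pmono[of 0 "Min (ahead m 0)"] P0 Min_in[OF fin False] by (simp add: ahead_def)
    then show ?thesis using False Bs[of m] by (simp add: \<phi>_def Bs_def divide_right_mono)
  qed
  from main[OF L] obtain t c where tc: "walk t c u v" "c \<le> dst u v + (\<Sum>m\<le>l. \<phi> m 0 * ?e m)"
    "real t \<le> (\<Sum>m\<le>l. \<phi> m 0 * ?h m)" using p0 P0 by auto
  have "(\<Sum>m\<le>l. \<phi> m 0 * ?e m) \<le> (\<Sum>m\<le>l. (1 + dst u v / (r ^ m * s)) * ?e m)"
    using Bs r by (intro sum_mono mult_right_mono \<phi>le) (simp add: less_imp_le)
  moreover have "(\<Sum>m\<le>l. \<phi> m 0 * ?h m) \<le> (\<Sum>m\<le>l. (1 + dst u v / (r ^ m * s)) * ?h m)"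
    by (intro sum_mono mult_right_mono \<phi>le) simp
  ultimately show ?thesis using tc unfolding Bs_def by (meson add_left_mono order_trans)
qed

text \<open>There are only finitely many distances. The gap serves the pairs at distance zero, whose
  walk must cost nothing at all.\<close>

lemma walk_cost_gap: "\<exists>g>0. \<forall>t c u v. walk t c u v \<longrightarrow> c \<le> 0 \<or> g \<le> c"
proof -
  have "finite ((\<lambda>(x, y). dst x y) ` ({..<n} \<times> {..<n}))" by auto
  from finite_gap[OF this] obtain g where g: "g > 0"
    "\<And>x y. x < n \<Longrightarrow> y < n \<Longrightarrow> 0 < dst x y \<Longrightarrow> g \<le> dst x y" by fastforce
  have "0 \<le> c \<and> (c = 0 \<or> g \<le> c)" if "walk t c u v" for t c u v
    using that
  proof (induction rule: kwalk.induct)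
    case (kwalk_step u x t c v)
    have cn: "conn n E u x" using steps_conn kwalk_step by blast
    have "dst u x = 0 \<or> g \<le> dst u x" using g(2)[of u x] conn_less[OF cn] dst_nonneg[OF cn] by force
    then show ?case using kwalk_step dst_nonneg[OF cn] by auto
  qed auto
  then show ?thesis using g by (metis order_refl)
qed

lemma hop_walk:
  assumes \<epsilon>: "0 < \<epsilon>" "\<epsilon> \<le> real l + 3" and uv: "conn n E u v"
  shows "\<exists>t c. walk t c u v \<and> c \<le> (1 + \<epsilon>) * dst u v \<and> real t \<le> 5 * (16 * (real l + 3) / \<epsilon>) ^ l"
proof -
  \<comment> \<open>For the unit \<open>D / r ^ l\<close>, the parts of the error that grow with the
    scale sum to at most \<open>32 * D / r\<close>, and each of the \<open>l + 1\<close> levels adds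
    \<open>16 * D / r\<close>. The total \<open>16 * (l + 3) * D / r\<close> becomes
    \<open>\<epsilon> * D\<close> by this choice.\<close>
  define r where "r = 16 * (real l + 3) / \<epsilon>"
  have r: "16 \<le> r" using \<epsilon> by (simp add: r_def field_simps)
  have r0: "0 < r" "r \<noteq> 0" using r by auto
  have geo: "(\<Sum>m\<le>l. r ^ m) \<le> 2 * r ^ l"
  proof (induction l)
    case (Suc l)
    have "2 * r ^ l \<le> r ^ Suc l" using r by (simp add: mult_right_mono)
    then show ?case using Suc by simp
  qed auto
  have hsum: "(\<Sum>m\<le>l. (1 + r ^ (l - m)) * real (2 * m + 2)) \<le> 5 * r ^ l"
  proof -
    \<comment> \<open>Since \<open>r \<ge> 16\<close>, the factor \<open>r ^ m\<close> outweighs the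
      at most \<open>2 * 2 ^ m\<close> of \<open>2 * m + 2\<close> by \<open>8 ^ m\<close>; the
      geometric sum is then at most \<open>4 * 8 / 7 < 5\<close> times \<open>r ^ l\<close>.\<close>
    have "(1 + r ^ (l - m)) * real (2 * m + 2) \<le> 4 * r ^ l * (1/8) ^ m" if "m \<le> l" for m
    proof -
      have "1 \<le> r ^ (l - m)" using r by (intro one_le_power) auto
      moreover have "real (2 * m + 2) \<le> 2 * 2 ^ m"
      proof -
        have "m + 1 \<le> 2 ^ m" by (induction m) auto
        then have "real (m + 1) \<le> real (2 ^ m)" by (rule of_nat_mono)
        then show ?thesis by simp
      qed
      ultimately have "(1 + r ^ (l - m)) * real (2 * m + 2) \<le> (2 * r ^ (l - m)) * (2 * 2 ^ m)"
        using r0 by (intro mult_mono) auto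
      also have "\<dots> = 4 * (r ^ (l - m) * 2 ^ m)" by simp
      also have "r ^ (l - m) * 2 ^ m \<le> r ^ l * (1/8) ^ m"
      proof -
        have "(2::real) ^ m * 8 ^ m = 16 ^ m" by (simp flip: power_mult_distrib)
        also have "\<dots> \<le> r ^ m" using r by (intro power_mono) auto
        finally have "r ^ (l - m) * (2 ^ m * 8 ^ m) \<le> r ^ (l - m) * r ^ m"
          using r0 by (intro mult_left_mono) auto
        also have "\<dots> = r ^ l" using that by (simp flip: power_add)
        finally show ?thesis by (simp add: field_simps power_divide)
      qed
      finally show ?thesis by simp
    qed
    then have "(\<Sum>m\<le>l. (1 + r ^ (l - m)) * real (2 * m + 2)) \<le> (\<Sum>m\<le>l. 4 * r ^ l * (1/8) ^ m)"
      by (intro sum_mono) simp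
    also have "\<dots> = 4 * r ^ l * (\<Sum>m\<le>l. (1/8) ^ m)" by (simp only: sum_distrib_left)
    also have "(\<Sum>m\<le>l. (1/8 :: real) ^ m) = 8/7 - (1/8) ^ l / 7" by (induction l) auto
    also have "4 * r ^ l * \<dots> \<le> 4 * r ^ l * (8/7)"
      using r0 by (intro mult_left_mono) auto
    also have "\<dots> \<le> 5 * r ^ l" using r0 by simp
    finally show ?thesis .
  qed
  show ?thesis
  proof (cases "dst u v = 0")
    case True
    obtain g where g: "g > 0" "\<And>t c u v. walk t c u v \<Longrightarrow> c \<le> 0 \<or> g \<le> c"
      using walk_cost_gap by blast
    \<comment> \<open>At distance zero every unit is admissible. This one keeps the total cost at
      most \<open>g / (2 * r) < g\<close>, and below the gap the cost is zero.\<close>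
    define s where "s = g / (64 * r ^ l)"
    have s: "0 < s" using g r0 by (simp add: s_def)
    obtain t c where tc: "walk t c u v" "c \<le> (\<Sum>m\<le>l. 16 * (r ^ m * s) / r)"
      "real t \<le> (\<Sum>m\<le>l. real (2 * m + 2))"
      using greedy_walk[OF r s uv] unfolding True by auto
    have "c \<le> 16 * s / r * (\<Sum>m\<le>l. r ^ m)"
    proof -
      have "(\<Sum>m\<le>l. 16 * (r ^ m * s) / r) = (\<Sum>m\<le>l. 16 * s / r * r ^ m)"
        by (intro sum.cong) auto
      then show ?thesis using tc(2) by (simp only: sum_distrib_left)
    qed
    also have "\<dots> \<le> 16 * s / r * (2 * r ^ l)" using geo s r0 by (intro mult_left_mono) auto
    also have "\<dots> = g / (2 * r)" using r0 by (simp add: s_def field_simps)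
    also have "\<dots> < g" using r g by (simp add: field_simps)
    finally have "c \<le> 0" using g(2)[OF tc(1)] by auto
    moreover have "(\<Sum>m\<le>l. real (2 * m + 2)) \<le> (\<Sum>m\<le>l. (1 + r ^ (l - m)) * real (2 * m + 2))"
    proof (rule sum_mono)
      fix m
      have "1 * real (2 * m + 2) \<le> (1 + r ^ (l - m)) * real (2 * m + 2)"
        using r0 by (intro mult_right_mono) auto
      then show "real (2 * m + 2) \<le> (1 + r ^ (l - m)) * real (2 * m + 2)" by simp
    qed
    ultimately show ?thesis using tc hsum True unfolding r_def[symmetric]
      by (intro exI[of _ t] exI[of _ c]) auto
  next
    case False
    define D where "D = dst u v"
    have D: "0 < D" using False dst_nonneg[OF uv] by (simp add: D_def)
    define s where "s = D / r ^ l"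
    have s: "0 < s" using D r0 by (simp add: s_def)
    have q: "D / (r ^ m * s) = r ^ (l - m)" if "m \<le> l" for m
      using that D r0 by (simp add: s_def power_diff)
    obtain t c where tc: "walk t c u v"
      "c \<le> D + (\<Sum>m\<le>l. (1 + D / (r ^ m * s)) * (16 * (r ^ m * s) / r))"
      "real t \<le> (\<Sum>m\<le>l. (1 + D / (r ^ m * s)) * real (2 * m + 2))"
      using greedy_walk[OF r s uv] unfolding D_def by blast
    have "(\<Sum>m\<le>l. (1 + D / (r ^ m * s)) * real (2 * m + 2)) =
        (\<Sum>m\<le>l. (1 + r ^ (l - m)) * real (2 * m + 2))"
      using q by (intro sum.cong) auto
    then have "real t \<le> 5 * r ^ l" using tc(3) hsum by linarith
    moreover have "(\<Sum>m\<le>l. (1 + D / (r ^ m * s)) * (16 * (r ^ m * s) / r)) \<le> \<epsilon> * D"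
    proof -
      have "(1 + D / (r ^ m * s)) * (16 * (r ^ m * s) / r) = 16 * s / r * r ^ m + 16 * D / r" for m
        using s r0 by (simp add: field_simps)
      then have "(\<Sum>m\<le>l. (1 + D / (r ^ m * s)) * (16 * (r ^ m * s) / r)) =
          16 * s / r * (\<Sum>m\<le>l. r ^ m) + (real l + 1) * (16 * D / r)"
        by (simp add: sum.distrib sum_distrib_left)
      also have "\<dots> \<le> 16 * s / r * (2 * r ^ l) + (real l + 1) * (16 * D / r)"
        using geo s r0 by (intro add_right_mono mult_left_mono) auto
      also have "\<dots> = 16 * (real l + 3) * D / r" using r0 by (simp add: s_def field_simps)
      also have "\<dots> = \<epsilon> * D" using \<epsilon> by (simp add: r_def)
      finally show ?thesis .
    qed
    ultimately show ?thesis using tc(1,2) unfolding r_def[symmetric] D_def[symmetric]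
      by (intro exI[of _ t] exI[of _ c]) (auto simp: algebra_simps)
  qed
qed

end

section \<open>Neighbours on a simple path and meetings of two selected paths\<close>

lemma path_weight_append:
  "path_weight c (p @ x # q) = path_weight c (p @ [x]) + path_weight c (x # q)"
  by (induction p rule: edge_set.induct)
    (auto simp: path_weight_Cons path_weight_single add.assoc)

lemma path_weight_nonneg: "(\<And>x y. 0 \<le> c x y) \<Longrightarrow> 0 \<le> path_weight c p"
  unfolding path_weight_def by (intro sum_nonneg) auto

lemma edge_set_conv_nth: "edge_set p = {{p ! i, p ! Suc i} |i. Suc i < length p}"
proof (induction p rule: edge_set.induct)
  case (1 x y p)
  have "{{(x # y # p) ! i, (x # y # p) ! Suc i} |i. Suc i < length (x # y # p)} =
     insert {x, y} {{(y # p) ! i, (y # p) ! Suc i} |i. Suc i < length (y # p)}"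
    (is "?L = ?R")
  proof (intro set_eqI iffI)
    fix e assume "e \<in> ?L"
    then obtain i where "e = {(x # y # p) ! i, (x # y # p) ! Suc i}"
      "Suc i < length (x # y # p)" by blast
    then show "e \<in> ?R" by (cases i) auto
  next
    fix e assume "e \<in> ?R"
    then consider "e = {x, y}" | i where "e = {(y # p) ! i, (y # p) ! Suc i}"
      "Suc i < length (y # p)" by blast
    then show "e \<in> ?L"
    proof cases
      case 1
      then show ?thesis by (intro CollectI exI[of _ 0]) auto
    next
      case 2
      then show ?thesis by (intro CollectI exI[of _ "Suc i"]) auto
    qed
  qed
  then show ?case using 1 by (simp only: edge_set.simps)
qed auto

lemma path_neighbours:
  assumes "distinct p" "i < length p" "{p ! i, y} \<in> edge_set p"
  shows "(Suc i < length p \<and> y = p ! Suc i) \<or> (0 < i \<and> y = p ! (i - 1))"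
proof -
  obtain j where j: "{p ! i, y} = {p ! j, p ! Suc j}" "Suc j < length p"
    using assms(3) by (auto simp: edge_set_conv_nth)
  from j(1) consider "p ! i = p ! j" "y = p ! Suc j" | "p ! i = p ! Suc j" "y = p ! j"
    by (auto simp: doubleton_eq_iff)
  then show ?thesis
    using j(2) assms(1,2) by cases (auto simp: nth_eq_iff_index_eq)
qed

lemma card_path_neighbours:
  assumes "distinct p"
  shows "finite {y. {z, y} \<in> edge_set p}" "card {y. {z, y} \<in> edge_set p} \<le> 2"
proof -
  have "\<exists>a b. {y. {z, y} \<in> edge_set p} \<subseteq> {a, b}"
  proof (cases "z \<in> set p")
    case True
    then obtain i where "i < length p" "z = p ! i" by (auto simp: in_set_conv_nth)
    then show ?thesis using path_neighbours[OF assms]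
      by (intro exI[of _ "p ! Suc i"] exI[of _ "p ! (i - 1)"]) auto
  qed (use edge_set_subset in fastforce)
  then obtain a b where ab: "{y. {z, y} \<in> edge_set p} \<subseteq> {a, b}" by blast
  show "finite {y. {z, y} \<in> edge_set p}" using finite_subset[OF ab] by simp
  have "card {y. {z, y} \<in> edge_set p} \<le> card {a, b}" using ab by (intro card_mono) auto
  also have "\<dots> \<le> 2" by (simp add: card_insert_if)
  finally show "card {y. {z, y} \<in> edge_set p} \<le> 2" .
qed

context shortest_paths
begin

lemma \<pi>_between:
  assumes "conn n E u v" "a \<in> set (\<pi> u v)" "b \<in> set (\<pi> u v)"
  shows "edge_set (\<pi> a b) \<subseteq> edge_set (\<pi> u v)"
proof -
  obtain i j where ij: "i < length (\<pi> u v)" "\<pi> u v ! i = a" "j < length (\<pi> u v)" "\<pi> u v ! j = b"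
    using assms by (auto simp: in_set_conv_nth)
  have sub: "edge_set (\<pi> (\<pi> u v ! i) (\<pi> u v ! j)) \<subseteq> edge_set (\<pi> u v)"
    if "i \<le> j" "j < length (\<pi> u v)" for i j
  proof -
    have "sublist (take (Suc j - i) (drop i (\<pi> u v))) (\<pi> u v)"
      by (meson sublist_drop sublist_order.order_trans sublist_take)
    then show ?thesis using \<pi>_nth(1)[OF assms(1) that] edge_set_sublist by metis
  qed
  show ?thesis
  proof (cases "i \<le> j")
    case True
    then show ?thesis using sub[of i j] ij by simp
  next
    case False
    have "conn n E b a" using \<pi>_nth(2)[OF assms(1), of j i] False ij by simp
    then have "edge_set (\<pi> a b) = edge_set (\<pi> b a)"
      using symmetric edge_set_rev by metis
    then show ?thesis using sub[of j i] ij False by simp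
  qed
qed

lemma \<pi>_path:
  assumes "conn n E u v"
  shows "\<pi> u v \<noteq> []" "hd (\<pi> u v) = u" "last (\<pi> u v) = v" "distinct (\<pi> u v)"
    "set (\<pi> u v) \<subseteq> {..<n}" "edge_set (\<pi> u v) \<subseteq> E"
  using path[OF assms] by (auto simp: is_path_iff)

text \<open>Two consistent paths meet in a common subpath, so one of them leaves the other at no more
  than two vertices.\<close>

lemma card_leaving:
  assumes c: "conn n E x y" "conn n E x' y'"
  shows "finite {z \<in> set (\<pi> x y). \<exists>a. {z, a} \<in> edge_set (\<pi> x' y') \<and> {z, a} \<notin> edge_set (\<pi> x y)}" (is
    "finite ?Z")
    and "card {z \<in> set (\<pi> x y). \<exists>a. {z, a} \<in> edge_set (\<pi> x' y') \<and> {z, a} \<notin> edge_set (\<pi> x y)} \<le> 2"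
proof -
  show fin: "finite ?Z" by simp
  let ?p = "\<pi> x y" and ?q = "\<pi> x' y'"
  show "card ?Z \<le> 2"
  proof (rule ccontr)
    assume "\<not> card ?Z \<le> 2"
    \<comment> \<open>Of three leaving vertices consider the middle one along \<open>?q\<close>. Its
      edges on \<open>?q\<close> lie between the outer two, and that stretch is the selected path
      between two vertices of \<open>?p\<close>, hence inside \<open>?p\<close> by consistency. So
      it does not leave.\<close>
    define I where "I = {i. i < length ?q \<and> ?q ! i \<in> ?Z}"
    have finI: "finite I" by (simp add: I_def)
    have "?Z \<subseteq> (!) ?q ` I"
    proof
      fix z assume z: "z \<in> ?Z"
      then have "z \<in> set ?q" using edge_set_subset by fastforce
      then show "z \<in> (!) ?q ` I" using z by (auto simp: I_def in_set_conv_nth)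
    qed
    then have "card ?Z \<le> card I" using finI by (rule surj_card_le[rotated])
    then have 3: "3 \<le> card I" using \<open>\<not> card ?Z \<le> 2\<close> by simp
    then have ne: "I \<noteq> {}" by auto
    have "\<not> I \<subseteq> {Min I, Max I}"
    proof
      assume "I \<subseteq> {Min I, Max I}"
      then have "card I \<le> card {Min I, Max I}" by (intro card_mono) auto
      then show False using 3 by (simp add: card_insert_if split: if_splits)
    qed
    then obtain i where i: "i \<in> I" "i \<noteq> Min I" "i \<noteq> Max I" by auto
    define i1 i3 where "i1 = Min I" and "i3 = Max I"
    have i1: "i1 \<in> I" "i1 < i" using Min_in[OF finI ne] Min_le[OF finI i(1)] i
      by (auto simp: i1_def)
    have i3: "i3 \<in> I" "i < i3" using Max_in[OF finI ne] Max_ge[OF finI i(1)] i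
      by (auto simp: i3_def)
    obtain a where a: "{?q ! i, a} \<in> edge_set ?q" "{?q ! i, a} \<notin> edge_set ?p"
      using i by (auto simp: I_def)
    have L: "i3 < length ?q" using i3 by (simp add: I_def)
    let ?m = "take (Suc i3 - i1) (drop i1 ?q)"
    have m: "\<pi> (?q ! i1) (?q ! i3) = ?m" using \<pi>_nth(1)[OF c(2) _ L] i1 i3 by simp
    have nth: "?m ! (j - i1) = ?q ! j" "j - i1 < length ?m" if "i1 \<le> j" "j \<le> i3" for j
      using that L by auto
    have "{?q ! i, a} \<in> edge_set ?m"
    proof -
      from path_neighbours[OF \<pi>_path(4)[OF c(2)] _ a(1)] L i3
      consider "a = ?q ! Suc i" | "0 < i" "a = ?q ! (i - 1)" by auto
      then show ?thesis
      proof cases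
        case 1
        then show ?thesis unfolding edge_set_conv_nth
          using nth[of i] nth[of "Suc i"] i1 i3
          by (intro CollectI exI[of _ "i - i1"]) (auto simp: Suc_diff_le)
      next
        case 2
        then show ?thesis unfolding edge_set_conv_nth
          using nth[of i] nth[of "i - 1"] i1 i3
          by (intro CollectI exI[of _ "i - 1 - i1"]) (auto simp: insert_commute Suc_diff_Suc)
      qed
    qed
    moreover have "edge_set ?m \<subseteq> edge_set ?p"
      using \<pi>_between[OF c(1), of "?q ! i1" "?q ! i3"] i1 i3 m by (auto simp: I_def)
    ultimately show False using a by blast
  qed
qed

end

section \<open>From walks to hop paths\<close>

context hierarchy
begin

lemma union_cost_nonneg: "0 \<le> union_cost n E w H x y"
proof -
  have "0 \<le> gdist n E w x y" using gdist_conn gdist_not_conn dst_nonneg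
    by (metis ereal_infty_less_eq(1) ereal_less_eq(5) linear)
  then show ?thesis using E_nonneg by (auto simp: union_cost_def edge_cost_def)
qed

lemma steps_cost:
  assumes "(x, y) \<in> steps" "x \<noteq> y"
  shows "{x, y} \<in> E \<union> hop_edges hops" "union_cost n E w hops x y \<le> ereal (dst x y)"
proof -
  have c: "conn n E x y" using steps_conn assms by blast
  have g: "gdist n E w x y = ereal (dst x y)" using gdist_conn[OF c] .
  from assms consider "\<pi> x y = [x, y]" | "(x, y) \<in> hops" | "(y, x) \<in> hops"
    unfolding steps_def hops_def by blast
  then have "({x, y} \<in> E \<and> edge_cost w x y = ereal (dst x y)) \<or> {x, y} \<in> hop_edges hops"
  proof cases
    case 1
    then have "{x, y} \<in> E" using \<pi>_path(6)[OF c] by simp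
    then show ?thesis using 1 by (simp add: edge_cost_def dst_def)
  next
    case 2
    then show ?thesis by (auto simp: hop_edges_def)
  next
    case 3
    then have "{y, x} \<in> hop_edges hops" by (auto simp: hop_edges_def)
    then show ?thesis by (simp add: insert_commute)
  qed
  then show "{x, y} \<in> E \<union> hop_edges hops" "union_cost n E w hops x y \<le> ereal (dst x y)"
    using g by (auto simp: union_cost_def)
qed

text \<open>A hop path has to be simple. When a step starts at a vertex already on the path, the
  part before that vertex is dropped, which lowers the number of edges and, costs being nonnegative,
  does not raise the weight.\<close>

lemma walk_hop_path:
  assumes "walk t c u v" "v < n"
  shows "\<exists>q. is_path n (E \<union> hop_edges hops) u v q \<and> num_edges q \<le> t \<and>
           path_weight (union_cost n E w hops) q \<le> ereal c"
  using assms
proof (induction rule: kwalk.induct)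
  case (kwalk_refl u)
  then show ?case
    by (intro exI[of _ "[u]"]) (auto simp: is_path_iff num_edges_def path_weight_single)
next
  case (kwalk_step u x t c v)
  let ?c = "union_cost n E w hops"
  obtain q where q: "is_path n (E \<union> hop_edges hops) x v q" "num_edges q \<le> t"
    "path_weight ?c q \<le> ereal c" using kwalk_step by auto
  have ux: "conn n E u x" using kwalk_step steps_conn by blast
  show ?case
  proof (cases "u \<in> set q")
    case True
    then obtain a b where ab: "q = a @ u # b" by (meson split_list)
    have "is_path n (E \<union> hop_edges hops) (hd (u # b)) (last (u # b)) (u # b)"
      by (rule is_path_sublist[OF q(1)]) (auto simp: ab sublist_append_leftI)
    moreover have "last (u # b) = v" using q(1) by (auto simp: ab is_path_iff)
    moreover have "path_weight ?c q = path_weight ?c (a @ [u]) + path_weight ?c (u # b)"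
      unfolding ab by (rule path_weight_append)
    then have "path_weight ?c (u # b) \<le> path_weight ?c q"
      using path_weight_nonneg[of ?c "a @ [u]"] union_cost_nonneg
      by (metis add.left_neutral add_right_mono)
    moreover have "ereal c \<le> ereal (dst u x + c)" using dst_nonneg[OF ux] by simp
    moreover have "num_edges (u # b) \<le> num_edges q" by (simp add: ab num_edges_def)
    moreover have "hd (u # b) = u" by simp
    ultimately show ?thesis using q by (metis le_SucI order_trans)
  next
    case False
    then obtain q' where q': "q = x # q'" using q(1) by (cases q) (auto simp: is_path_iff)
    have ne: "u \<noteq> x" using False q' by auto
    note s = steps_cost[OF kwalk_step(1) ne]
    have "path_weight ?c (u # q) = ?c u x + path_weight ?c q" unfolding q'
      by (rule path_weight_Cons)
    also have "\<dots> \<le> ereal (dst u x + c)"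
      using add_mono[OF s(2) q(3)] by simp
    finally have "path_weight ?c (u # q) \<le> ereal (dst u x + c)" .
    moreover have "is_path n (E \<union> hop_edges hops) u v (u # q)"
      using q(1) s(1) False conn_less[OF ux] unfolding is_path_iff q' by auto
    moreover have "num_edges (u # q) \<le> Suc t" using q(2) by (simp add: num_edges_def q')
    ultimately show ?thesis by blast
  qed
qed

lemma hops_less: "hops \<subseteq> {..<n} \<times> {..<n}"
  by (auto simp: hops_def dest!: half_conn up_conn conn_less)

text \<open>The separate \<open>\<epsilon>'\<close> admits values of \<open>\<epsilon>\<close> above
  \<open>l + 3\<close>: the walk is then built for the truncated value.\<close>

lemma hopset_hops:
  assumes "0 < \<epsilon>'" "\<epsilon>' \<le> real l + 3" "\<epsilon>' \<le> \<epsilon>" "5 * (16 * (real l + 3) / \<epsilon>') ^ l \<le> \<beta>"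
  shows "hopset n E w (1 + \<epsilon>) \<beta> hops"
  unfolding hopset_def
proof (intro conjI allI impI hops_less)
  fix u v assume uv: "u < n" "v < n"
  show "hop_dist n E w hops \<beta> u v \<le> ereal (1 + \<epsilon>) * gdist n E w u v"
  proof (cases "conn n E u v")
    case True
    obtain t c where tc: "walk t c u v" "c \<le> (1 + \<epsilon>') * dst u v"
      "real t \<le> 5 * (16 * (real l + 3) / \<epsilon>') ^ l" using hop_walk[OF assms(1,2) True] by blast
    obtain q where q: "is_path n (E \<union> hop_edges hops) u v q" "num_edges q \<le> t"
      "path_weight (union_cost n E w hops) q \<le> ereal c" using walk_hop_path[OF tc(1) uv(2)] by blast
    have "hop_dist n E w hops \<beta> u v \<le> ereal c"
      unfolding hop_dist_def using q tc assms by (intro INF_lower2[of q]) auto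
    also have "c \<le> (1 + \<epsilon>) * dst u v"
      using tc(2) assms(3) mult_right_mono[of "1 + \<epsilon>'"
        "1 + \<epsilon>", OF _ dst_nonneg[OF True]] by linarith
    then have "ereal c \<le> ereal (1 + \<epsilon>) * gdist n E w u v" using gdist_conn[OF True] by simp
    finally show ?thesis .
  next
    case False
    then show ?thesis using gdist_not_conn assms by simp
  qed
qed

section \<open>Counting hops by bunch sizes\<close>

definition bun :: "nat \<Rightarrow> nat \<Rightarrow> nat set" where
  "bun i x = bunch (gdist n E w) (A i) (A (Suc i)) x"

lemma bun_iff: "y \<in> bun i x \<longleftrightarrow> y \<in> A i \<and> gdist n E w x y < setdist (Suc i) x"
  by (simp add: bun_def bunch_def setdist_def)

lemma bunI: "y \<in> A i \<Longrightarrow> conn n E x y \<Longrightarrow> ereal (dst x y) < setdist (Suc i) x \<Longrightarrow> y \<in> bun i x"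
  by (simp add: bun_iff gdist_conn)

lemma finite_bun: "finite (bun i x)"
  by (rule finite_subset[OF _ finite_A[of i]]) (auto simp: bun_iff)

lemma half_bun: "half i \<subseteq> Sigma (A i) (bun i)"
proof (clarify)
  fix x y assume xy: "(x, y) \<in> half i"
  then have "ereal (dst x y) \<le> ereal (2 * dst x y)" using dst_nonneg[OF half_conn[OF xy]] by simp
  also have "\<dots> < setdist (Suc i) x" using xy by (simp add: half_def)
  finally show "x \<in> A i \<and> y \<in> bun i x" using xy half_conn[OF xy]
    by (auto simp: half_def intro!: bunI)
qed

lemma finite_half: "finite (half i)"
  using half_bun finite_A finite_bun by (meson finite_SigmaI finite_subset)

text \<open>The common measure of all counts at a level: hops, crossings, incidences and the edges
  at special vertices are bounded by multiples of it.\<close>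

definition cube :: "nat \<Rightarrow> nat" where
  "cube i = (\<Sum>x\<in>A i. card (bun i x) ^ 3)"

lemma card_half: "card (half i) \<le> cube i"
proof -
  have "card (half i) \<le> card (Sigma (A i) (bun i))"
    using half_bun finite_A finite_bun by (intro card_mono) auto
  also have "\<dots> = (\<Sum>x\<in>A i. card (bun i x))" using finite_A finite_bun by simp
  also have "\<dots> \<le> cube i" 
    unfolding cube_def by (intro sum_mono) (metis One_nat_def Suc_leI bot_nat_0.not_eq_extremum
      self_le_power zero_le zero_less_numeral)
  finally show ?thesis .
qed

lemma up_image: "up i = (\<lambda>x. (x, pivot (Suc i) x)) ` {x \<in> A i. reach (Suc i) x}"
  by (auto simp: up_def)

lemma card_up: "card (up i) \<le> card (A i)"
proof -
  have "card (up i) \<le> card {x \<in> A i. reach (Suc i) x}"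
    unfolding up_image using finite_A by (intro card_image_le) auto
  also have "\<dots> \<le> card (A i)" using finite_A by (intro card_mono) auto
  finally show ?thesis .
qed

lemma card_hops: "card hops \<le> (\<Sum>i\<le>l. cube i + card (A i))"
proof -
  have "card hops \<le> (\<Sum>i\<le>l. card (half i \<union> up i))"
    unfolding hops_def by (rule card_UN_le) auto
  also have "\<dots> \<le> (\<Sum>i\<le>l. cube i + card (A i))"
    by (intro sum_mono) (meson add_mono card_Un_le card_half card_up order_trans)
  finally show ?thesis .
qed

subsection \<open>Supporting edges\<close>

definition half_edges :: "nat \<Rightarrow> nat set set" where
  "half_edges i = (\<Union>(x, y)\<in>half i. edge_set (\<pi> x y))"

definition up_edges :: "nat \<Rightarrow> nat set set" where
  "up_edges i = (\<Union>(x, y)\<in>up i. edge_set (\<pi> x y))"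

definition support :: "nat set set" where
  "support = (\<Union>i\<le>l. half_edges i \<union> up_edges i)"

lemma support_subset: "support \<subseteq> E"
  unfolding support_def half_edges_def up_edges_def
  using half_conn up_conn \<pi>_path(6) by blast

lemma supporting_support: "supporting n E w hops support"
  unfolding supporting_def
proof (intro conjI support_subset, clarify)
  fix x y assume xy: "(x, y) \<in> hops"
  then have c: "conn n E x y" using half_conn up_conn by (auto simp: hops_def)
  have "edge_set (\<pi> x y) \<subseteq> support"
    using xy unfolding hops_def support_def half_edges_def up_edges_def by blast
  then have "is_path n support x y (\<pi> x y)" using \<pi>_path[OF c] by (simp add: is_path_iff)
  then show "\<exists>p. is_path n support x y p \<and> path_weight (edge_cost w) p = gdist n E w x y"
    using gdist_conn[OF c] by (auto simp: path_weight_edge_cost dst_def)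
qed

text \<open>For a vertex that is its own pivot the path has one element and the value is
  unspecified; \<open>rule_up\<close> therefore tests whether it is a vertex.\<close>

definition next_up :: "nat \<Rightarrow> nat \<Rightarrow> nat" where
  "next_up i z = \<pi> z (pivot (Suc i) z) ! 1"

text \<open>As distances add up along the path, the triangle inequality makes the pivot of
  \<open>x\<close> nearest to \<open>z\<close> and the pivot of \<open>z\<close> nearest to
  \<open>x\<close>. The least-index rule then identifies the two.\<close>

lemma pivot_along:
  assumes x: "reach i x" and z: "z \<in> set (\<pi> x (pivot i x))"
  shows "reach i z" "pivot i z = pivot i x"
proof -
  let ?p = "pivot i x"
  note px = nearest_pivot[OF x]
  have c: "conn n E x ?p" using px by (simp add: nearest_def)
  let ?q = "\<pi> x ?p"
  obtain j where j: "j < length ?q" "z = ?q ! j" using z by (auto simp: in_set_conv_nth)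
  have h: "?q ! 0 = x" using \<pi>_path[OF c] by (auto simp: hd_conv_nth)
  have lst: "?q ! (length ?q - 1) = ?p" using \<pi>_path[OF c] by (metis last_conv_nth)
  have cz: "conn n E x z" "conn n E z ?p"
    using \<pi>_nth(2)[OF c, of 0 j] \<pi>_nth(2)[OF c, of j "length ?q - 1"] j h lst by auto
  have split: "dst x z + dst z ?p = dst x ?p"
  proof -
    have "dst z ?p = pos x ?p (length ?q - 1) - pos x ?p j"
      using dst_along[OF c, of j "length ?q - 1"] j lst by auto
    then show ?thesis using j lst by (simp add: pos_def)
  qed
  show r: "reach i z" using px cz by (auto simp: reach_def nearest_def)
  have nz: "nearest i z ?p"
    unfolding nearest_def
  proof (intro conjI ballI impI cz)
    show "?p \<in> A i" using px by (simp add: nearest_def)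
    fix y assume y: "y \<in> A i" "conn n E z y"
    have "dst x ?p \<le> dst x y" using px y conn_trans[OF cz(1) y(2)] by (simp add: nearest_def)
    then show "dst z ?p \<le> dst z y" using dst_triangle[OF cz(1) y(2)] split by linarith
  qed
  have nx: "nearest i x (pivot i z)"
    unfolding nearest_def
  proof (intro conjI ballI impI)
    note pz = nearest_pivot[OF r, unfolded nearest_def]
    show "pivot i z \<in> A i" "conn n E x (pivot i z)" using pz conn_trans[OF cz(1)] by auto
    fix y assume y: "y \<in> A i" "conn n E x y"
    have "dst x (pivot i z) \<le> dst x z + dst z ?p"
      using dst_triangle[OF cz(1), of "pivot i z"] pz px cz by (force simp: nearest_def)
    moreover have "dst x ?p \<le> dst x y" using px y unfolding nearest_def by blast
    ultimately show "dst x (pivot i z) \<le> dst x y" using split by linarith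
  qed
  show "pivot i z = ?p"
    using Least_le[of "nearest i z", OF nz] Least_le[of "nearest i x", OF nx]
    unfolding pivot_def by simp
qed

lemma next_up_along:
  assumes "(x, y) \<in> up i" "Suc j < length (\<pi> x y)"
  shows "next_up i (\<pi> x y ! j) = \<pi> x y ! Suc j"
proof -
  let ?q = "\<pi> x y"
  have c: "conn n E x y" using assms up_conn by blast
  have x: "reach (Suc i) x" "y = pivot (Suc i) x" using assms by (auto simp: up_def)
  have pz: "pivot (Suc i) (?q ! j) = y" using pivot_along(2)[OF x(1), of "?q ! j"] assms x by simp
  have lst: "?q ! (length ?q - 1) = y" using \<pi>_path[OF c] by (metis last_conv_nth)
  have "\<pi> (?q ! j) y = take (length ?q - j) (drop j ?q)"
    using \<pi>_nth(1)[OF c, of j "length ?q - 1"] assms lst by auto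
  then show ?thesis using assms by (simp add: next_up_def pz)
qed

text \<open>The next vertex on a pivot path depends only on the level and the current vertex, so
  each vertex accounts for one edge per level. Together with the vertices of low degree this causes
  the term \<open>n * ln k\<close>.\<close>

lemma card_up_edges: "card (up_edges i) \<le> n"
proof -
  have "up_edges i \<subseteq> (\<lambda>z. {z, next_up i z}) ` {..<n}"
  proof
    fix e assume "e \<in> up_edges i"
    then obtain x y where xy: "(x, y) \<in> up i" "e \<in> edge_set (\<pi> x y)" by (auto simp: up_edges_def)
    then obtain j where j: "e = {\<pi> x y ! j, \<pi> x y ! Suc j}" "Suc j < length (\<pi> x y)"
      by (auto simp: edge_set_conv_nth)
    have "\<pi> x y ! j \<in> set (\<pi> x y)" using j by simp
    then have "\<pi> x y ! j < n" using \<pi>_path(5)[OF up_conn[OF xy(1)]] by auto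
    then show "e \<in> (\<lambda>z. {z, next_up i z}) ` {..<n}"
      using next_up_along[OF xy(1) j(2)] j(1) by auto
  qed
  then have "card (up_edges i) \<le> card ((\<lambda>z. {z, next_up i z}) ` {..<n})" by (intro card_mono) auto
  also have "\<dots> \<le> n" using card_image_le[of "{..<n}" "\<lambda>z. {z, next_up i z}"] by simp
  finally show ?thesis .
qed

section \<open>Branching vertices and crossings\<close>

definition nbr :: "nat \<Rightarrow> nat \<Rightarrow> nat set" where
  "nbr i z = {y. {z, y} \<in> half_edges i}"

definition special :: "nat \<Rightarrow> nat \<Rightarrow> bool" where
  "special i z \<longleftrightarrow> 3 \<le> card (nbr i z)"

lemma half_edges_less: "{z, y} \<in> half_edges i \<Longrightarrow> z < n \<and> y < n"
proof -
  assume "{z, y} \<in> half_edges i"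
  then obtain a b where ab: "(a, b) \<in> half i" "{z, y} \<in> edge_set (\<pi> a b)"
    by (auto simp: half_edges_def)
  then show ?thesis using edge_set_subset[OF ab(2)] \<pi>_path(5)[OF half_conn[OF ab(1)]] by auto
qed

lemma finite_nbr: "finite (nbr i z)"
  by (rule finite_subset[of _ "{..<n}"]) (auto simp: nbr_def dest: half_edges_less)

definition incidences :: "nat \<Rightarrow> ((nat \<times> nat) \<times> nat) set" where
  "incidences i = (SIGMA (x, y):half i. {z \<in> set (\<pi> x y). special i z})"

definition crossing :: "nat \<Rightarrow> ((nat \<times> nat) \<times> (nat \<times> nat)) set" where
  "crossing i = {((x, y), (x', y')). (x, y) \<in> half i \<and> (x', y') \<in> half i \<and>
     set (\<pi> x y) \<inter> set (\<pi> x' y') \<noteq> {}}"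

lemma dst_on_path:
  assumes c: "conn n E x y" and z: "z \<in> set (\<pi> x y)"
  shows "conn n E x z" "conn n E z y" "dst x z + dst z y = dst x y"
proof -
  let ?q = "\<pi> x y"
  obtain j where j: "j < length ?q" "z = ?q ! j" using z by (auto simp: in_set_conv_nth)
  have h: "?q ! 0 = x" using \<pi>_path[OF c] by (auto simp: hd_conv_nth)
  have lst: "?q ! (length ?q - 1) = y" using \<pi>_path[OF c] by (metis last_conv_nth)
  show "conn n E x z" "conn n E z y"
    using \<pi>_nth(2)[OF c, of 0 j] \<pi>_nth(2)[OF c, of j "length ?q - 1"] j h lst by auto
  have "dst z y = pos x y (length ?q - 1) - pos x y j"
    using dst_along[OF c, of j "length ?q - 1"] j lst by auto
  then show "dst x z + dst z y = dst x y" using j lst by (simp add: pos_def)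
qed

text \<open>Through a common vertex, \<open>x\<close> reaches both \<open>x'\<close> and
  \<open>y'\<close> within \<open>dst x y + dst x' y' \<le> 2 * dst x y\<close>, which is below the
  distance to the next level because the longer pair is a half-bunch pair.\<close>

lemma crossing_bun:
  assumes "((x, y), (x', y')) \<in> crossing i" "dst x' y' \<le> dst x y"
  shows "x \<in> A i" "y \<in> bun i x" "x' \<in> bun i x" "y' \<in> bun i x"
proof -
  have xy: "(x, y) \<in> half i" and xy': "(x', y') \<in> half i" using assms by (auto simp: crossing_def)
  note c = half_conn[OF xy] and c' = half_conn[OF xy']
  show "x \<in> A i" "y \<in> bun i x" using half_bun xy by auto
  obtain z where z: "z \<in> set (\<pi> x y)" "z \<in> set (\<pi> x' y')" using assms by (auto simp: crossing_def)
  note d = dst_on_path[OF c z(1)] and d' = dst_on_path[OF c' z(2)]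
  have cx: "conn n E x x'" "conn n E x y'"
    using conn_trans d(1) d'(1,2) conn_sym by blast+
  have nn: "0 \<le> dst z y" "0 \<le> dst x' z" "0 \<le> dst z y'" using d d' dst_nonneg by auto
  have "dst x x' \<le> 2 * dst x y"
    using dst_triangle[OF d(1) conn_sym[OF d'(1)]] dst_sym[OF d'(1)] d(3) d'(3) nn assms(2) by
      linarith
  moreover have "dst x y' \<le> 2 * dst x y"
    using dst_triangle[OF d(1) d'(2)] d(3) d'(3) nn assms(2) by linarith
  moreover have "ereal (2 * dst x y) < setdist (Suc i) x" using xy by (simp add: half_def)
  ultimately show "x' \<in> bun i x" "y' \<in> bun i x"
    using cx xy' by (auto simp: half_def intro!: bunI intro: le_less_trans[rotated])
qed

text \<open>A crossing is determined by the first vertex of its longer pair and three elements of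
  the bunch there; the factor 2 records which of the pairs is the longer one.\<close>

lemma card_crossing: "finite (crossing i)" "card (crossing i) \<le> 2 * cube i"
proof -
  define X where "X = (\<lambda>(x, y, x', y'). ((x, y), (x', y'))) ` (SIGMA x:A i. bun i x \<times> bun i x \<times> bun
    i x)"
  have finX: "finite X" unfolding X_def using finite_A finite_bun by auto
  have "card X \<le> card (SIGMA x:A i. bun i x \<times> bun i x \<times> bun i x)"
    unfolding X_def using finite_A finite_bun by (intro card_image_le) auto
  also have "\<dots> = cube i"
    using finite_A finite_bun by (simp add: cube_def card_cartesian_product power3_eq_cube
      mult.assoc)
  finally have cX: "card X \<le> cube i" .
  have sub: "crossing i \<subseteq> X \<union> X\<inverse>"
  proof
    fix c assume c: "c \<in> crossing i"
    obtain x y x' y' where e: "c = ((x, y), (x', y'))" by (metis surj_pair)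
    have in_X: "((x, y), (x', y')) \<in> X"
      if "((x, y), (x', y')) \<in> crossing i" "dst x' y' \<le> dst x y" for x y x' y'
      using crossing_bun[OF that] unfolding X_def by force
    have "((x', y'), (x, y)) \<in> crossing i" using c unfolding e crossing_def by auto
    then show "c \<in> X \<union> X\<inverse>" using in_X[of x y x' y'] in_X[of x' y' x y] c unfolding e
      by (cases "dst x' y' \<le> dst x y") auto
  qed
  have fin: "finite (X \<union> X\<inverse>)" using finX by simp
  show "finite (crossing i)" using finite_subset[OF sub fin] .
  have "card (crossing i) \<le> card (X \<union> X\<inverse>)" using card_mono[OF fin sub] .
  also have "\<dots> \<le> card X + card (X\<inverse>)" by (rule card_Un_le)
  also have "card (X\<inverse>) = card X" by simp
  finally show "card (crossing i) \<le> 2 * cube i" using cX by simp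
qed

text \<open>A path uses at most two of the three or more edges at a special vertex, so another
  half-bunch path leaves it there. The incidence is charged to this crossing, and by
  \<open>card_leaving\<close> a crossing is charged at most twice.\<close>

lemma card_incidences: "finite (incidences i)" "card (incidences i) \<le> 4 * cube i"
proof -
  show fin: "finite (incidences i)" unfolding incidences_def using finite_half by auto
  define Z where "Z = (\<lambda>((x, y), (x', y')). {z \<in> set (\<pi> x y). \<exists>a. {z, a} \<in> edge_set (\<pi> x' y') \<and>
    {z, a} \<notin> edge_set (\<pi> x y)})"
  have sub: "incidences i \<subseteq> (\<Union>c\<in>crossing i. {fst c} \<times> Z c)"
  proof
    fix s assume "s \<in> incidences i"
    then obtain x y z where s: "s = ((x, y), z)" "(x, y) \<in> half i" "z \<in> set (\<pi> x y)" "special i z"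
      by (auto simp: incidences_def)
    note c = half_conn[OF s(2)]
    have "\<not> nbr i z \<subseteq> {a. {z, a} \<in> edge_set (\<pi> x y)}"
    proof
      assume "nbr i z \<subseteq> {a. {z, a} \<in> edge_set (\<pi> x y)}"
      then have "card (nbr i z) \<le> 2"
        using card_mono[OF card_path_neighbours(1)[OF \<pi>_path(4)[OF c]]]
          card_path_neighbours(2)[OF \<pi>_path(4)[OF c]] le_trans by blast
      then show False using s(4) by (simp add: special_def)
    qed
    then obtain a where a: "{z, a} \<in> half_edges i" "{z, a} \<notin> edge_set (\<pi> x y)"
      by (auto simp: nbr_def)
    then obtain x' y' where xy': "(x', y') \<in> half i" "{z, a} \<in> edge_set (\<pi> x' y')"
      by (auto simp: half_edges_def)
    then have "z \<in> set (\<pi> x' y')" using edge_set_subset by fastforce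
    then have cr: "((x, y), (x', y')) \<in> crossing i" using s xy' by (auto simp: crossing_def)
    have "z \<in> Z ((x, y), (x', y'))" using s xy' a by (auto simp: Z_def)
    then show "s \<in> (\<Union>c\<in>crossing i. {fst c} \<times> Z c)" using cr s by force
  qed
  have Z2: "finite (Z c)" "card (Z c) \<le> 2" if "c \<in> crossing i" for c
    using that card_leaving half_conn unfolding Z_def crossing_def by (auto split: prod.splits)
  have "card (incidences i) \<le> card (\<Union>c\<in>crossing i. {fst c} \<times> Z c)"
    using sub Z2 card_crossing(1) by (intro card_mono) auto
  also have "\<dots> \<le> (\<Sum>c\<in>crossing i. card ({fst c} \<times> Z c))"
    by (rule card_UN_le) (rule card_crossing)
  also have "\<dots> \<le> (\<Sum>c\<in>crossing i. 2)"
    using Z2 by (intro sum_mono) (simp add: card_cartesian_product)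
  also have "\<dots> \<le> 4 * cube i" using card_crossing(2)[of i] by simp
  finally show "card (incidences i) \<le> 4 * cube i" .
qed

text \<open>An edge is charged to its first endpoint along a path. A vertex that is not special has
  at most two edges; at a special one, path and vertex form an incidence, which carries at most two
  edges of that path.\<close>

lemma card_half_edges: "card (half_edges i) \<le> 2 * n + 8 * cube i"
proof -
  define X where "X = (\<Union>z\<in>{z. z < n \<and> \<not> special i z}. (\<lambda>y. {z, y}) ` nbr i z)"
  define Y where "Y = (\<Union>s\<in>incidences i. (\<lambda>y. {snd s, y}) ` {y. {snd s, y} \<in> edge_set (\<pi> (fst (fst
    s)) (snd (fst s)))})"
  have "half_edges i \<subseteq> X \<union> Y"
  proof
    fix e assume e: "e \<in> half_edges i"
    then obtain a b where ab: "(a, b) \<in> half i" "e \<in> edge_set (\<pi> a b)"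
      by (auto simp: half_edges_def)
    then obtain j where j: "e = {\<pi> a b ! j, \<pi> a b ! Suc j}" "Suc j < length (\<pi> a b)"
      by (auto simp: edge_set_conv_nth)
    let ?z = "\<pi> a b ! j"
    show "e \<in> X \<union> Y"
    proof (cases "special i ?z")
      case True
      then have "((a, b), ?z) \<in> incidences i" using ab j by (auto simp: incidences_def)
      then show ?thesis using ab j unfolding Y_def by force
    next
      case False
      then show ?thesis using half_edges_less e j unfolding X_def nbr_def by blast
    qed
  qed
  moreover have fX: "finite X" unfolding X_def using finite_nbr by auto
  moreover have path: "distinct (\<pi> (fst (fst s)) (snd (fst s)))" if "s \<in> incidences i" for s
    using that \<pi>_path(4) half_conn unfolding incidences_def by auto
  then have fY: "finite Y" unfolding Y_def
    using card_path_neighbours(1) card_incidences(1) by auto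
  ultimately have "card (half_edges i) \<le> card (X \<union> Y)" by (intro card_mono) auto
  also have "\<dots> \<le> card X + card Y" by (rule card_Un_le)
  also have "card X \<le> (\<Sum>z\<in>{z. z < n \<and> \<not> special i z}. card ((\<lambda>y. {z, y}) ` nbr i z))"
    unfolding X_def by (rule card_UN_le) auto
  also have "\<dots> \<le> (\<Sum>z\<in>{z. z < n \<and> \<not> special i z}. 2)"
  proof (rule sum_mono)
    fix z assume "z \<in> {z. z < n \<and> \<not> special i z}"
    then show "card ((\<lambda>y. {z, y}) ` nbr i z) \<le> 2"
      using card_image_le[OF finite_nbr[of i z], of "\<lambda>y. {z, y}"] by (auto simp: special_def)
  qed
  also have "\<dots> \<le> 2 * n" using card_mono[of "{..<n}" "{z. z < n \<and> \<not> special i z}"] by auto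
  also have "card Y \<le> (\<Sum>s\<in>incidences i. card ((\<lambda>y. {snd s, y}) ` {y. {snd s, y} \<in> edge_set (\<pi> (fst
    (fst s)) (snd (fst s)))}))"
    unfolding Y_def by (rule card_UN_le) (rule card_incidences)
  also have "\<dots> \<le> (\<Sum>s\<in>incidences i. 2)"
    using card_path_neighbours path by (intro sum_mono) (meson card_image_le order_trans)
  also have "\<dots> \<le> 8 * cube i" using card_incidences(2)[of i] by simp
  finally show ?thesis by simp
qed

lemma card_support: "card support \<le> (\<Sum>i\<le>l. 3 * n + 8 * cube i)"
proof -
  have "card support \<le> (\<Sum>i\<le>l. card (half_edges i \<union> up_edges i))"
    unfolding support_def by (rule card_UN_le) auto
  also have "\<dots> \<le> (\<Sum>i\<le>l. 3 * n + 8 * cube i)"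
  proof (rule sum_mono)
    fix i
    show "card (half_edges i \<union> up_edges i) \<le> 3 * n + 8 * cube i"
      using card_Un_le[of "half_edges i" "up_edges i"] card_half_edges[of i] card_up_edges[of i] by
        simp
  qed
  finally show ?thesis .
qed

text \<open>The two path neighbours already exhaust the at most two neighbours of such a vertex;
  hence the sum of all neighbours minus the predecessor is the successor.\<close>

lemma nbr_along:
  assumes xy: "(x, y) \<in> half i" and j: "0 < j" "Suc j < length (\<pi> x y)"
    and ns: "\<not> special i (\<pi> x y ! j)"
  shows "nbr i (\<pi> x y ! j) = {\<pi> x y ! (j - 1), \<pi> x y ! Suc j}" "\<pi> x y ! (j - 1) \<noteq> \<pi> x y ! Suc j"
proof -
  let ?q = "\<pi> x y"
  note c = half_conn[OF xy]
  show ne: "?q ! (j - 1) \<noteq> ?q ! Suc j"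
    using \<pi>_path(4)[OF c] j by (simp add: nth_eq_iff_index_eq)
  have "{?q ! j, ?q ! Suc j} \<in> edge_set ?q" "{?q ! (j - 1), ?q ! Suc (j - 1)} \<in> edge_set ?q"
    unfolding edge_set_conv_nth using j by auto
  then have "{?q ! (j - 1), ?q ! Suc j} \<subseteq> nbr i (?q ! j)"
    using xy j by (auto simp: nbr_def half_edges_def insert_commute)
  moreover have "card (nbr i (?q ! j)) \<le> card {?q ! (j - 1), ?q ! Suc j}"
    using ns ne by (simp add: special_def)
  ultimately show "nbr i (?q ! j) = {?q ! (j - 1), ?q ! Suc j}"
    using card_seteq[OF finite_nbr] by metis
qed

end

section \<open>Decomposing a short path into pieces of hop paths\<close>

context hierarchy
begin

text \<open>Closed under cutting, unlike \<open>steps\<close>. This is the unit in which answers are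
  stored.\<close>

definition seg :: "nat \<Rightarrow> nat \<Rightarrow> bool" where
  "seg a b \<longleftrightarrow> a \<noteq> b \<and> conn n E a b \<and> (\<exists>(x, y)\<in>steps. sublist (\<pi> a b) (\<pi> x y))"

fun glue :: "nat list \<Rightarrow> nat list" where
  "glue (a # b # q) = butlast (\<pi> a b) @ glue (b # q)"
| "glue q = q"

lemma hd_glue: "successively seg q \<Longrightarrow> q \<noteq> [] \<Longrightarrow> glue q \<noteq> [] \<and> hd (glue q) = hd q"
proof (induction q rule: glue.induct)
  case (1 a b q)
  then have ab: "seg a b" by simp
  then have c: "conn n E a b" by (simp add: seg_def)
  obtain p where p: "\<pi> a b = a # p" using \<pi>_path(1,2)[OF c] by (cases "\<pi> a b") auto
  have "p \<noteq> []" using p ab \<pi>_path(3)[OF c] by (auto simp: seg_def split: if_splits)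
  then show ?case using p by simp
qed auto

lemma glue_Cons:
  assumes "successively seg (a # b # q)"
  obtains r where "glue (b # q) = b # r" "\<pi> a b = butlast (\<pi> a b) @ [b]"
    "glue (a # b # q) = butlast (\<pi> a b) @ b # r"
proof -
  have c: "conn n E a b" using assms by (simp add: seg_def)
  have "glue (b # q) \<noteq> [] \<and> hd (glue (b # q)) = b" using hd_glue[of "b # q"] assms by auto
  then obtain r where r: "glue (b # q) = b # r" by (cases "glue (b # q)") auto
  have "\<pi> a b = butlast (\<pi> a b) @ [b]"
    using \<pi>_path(1,3)[OF c] append_butlast_last_id by metis
  then show thesis using that[OF r] r by simp
qed

lemma wt_glue:
  assumes "successively seg (a # b # q)"
  shows "wt f (glue (a # b # q)) = wt f (\<pi> a b) + wt f (glue (b # q))"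
proof -
  from glue_Cons[OF assms] obtain r where "glue (b # q) = b # r" "\<pi> a b = butlast (\<pi> a b) @ [b]"
    "glue (a # b # q) = butlast (\<pi> a b) @ b # r" .
  then show ?thesis using wt_append by metis
qed

lemma edge_set_glue:
  assumes "successively seg (a # b # q)"
  shows "edge_set (glue (a # b # q)) = edge_set (\<pi> a b) \<union> edge_set (glue (b # q))"
proof -
  from glue_Cons[OF assms] obtain r where "glue (b # q) = b # r" "\<pi> a b = butlast (\<pi> a b) @ [b]"
    "glue (a # b # q) = butlast (\<pi> a b) @ b # r" .
  then show ?thesis using edge_set_append by metis
qed

lemma last_glue: "successively seg q \<Longrightarrow> q \<noteq> [] \<Longrightarrow> last (glue q) = last q"
proof (induction q rule: glue.induct)
  case (1 a b q)
  then show ?case using hd_glue[of "b # q"] by auto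
qed auto

lemma set_glue: "successively seg q \<Longrightarrow> set q \<subseteq> {..<n} \<Longrightarrow> set (glue q) \<subseteq> {..<n}"
proof (induction q rule: glue.induct)
  case (1 a b q)
  then have "set (butlast (\<pi> a b)) \<subseteq> {..<n}"
    using \<pi>_path(5)[of a b] in_set_butlastD by (fastforce simp: seg_def)
  then show ?case using 1 by auto
qed auto

lemma length_glue: "successively seg q \<Longrightarrow> length q \<le> length (glue q)"
proof (induction q rule: glue.induct)
  case (1 a b q)
  have c: "conn n E a b" "a \<noteq> b" using 1 by (auto simp: seg_def)
  have "butlast (\<pi> a b) \<noteq> []"
    using \<pi>_path(1,2,3)[OF c(1)] c(2) by (cases "\<pi> a b") (auto split: if_splits)
  then obtain y p where "butlast (\<pi> a b) = y # p" by (cases "butlast (\<pi> a b)") auto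
  then show ?case using 1 by simp
qed auto

lemma seg_sublist:
  assumes c: "conn n E x y" and s: "\<And>m. sublist m (\<pi> x y) \<Longrightarrow> (\<exists>(x, y)\<in>steps. sublist m (\<pi> x y))"
    and m: "sublist (a # m @ [b]) (\<pi> x y)"
  shows "seg a b" "\<pi> a b = a # m @ [b]"
proof -
  have e: "\<pi> a b = a # m @ [b]" using consistent[OF c m] by simp
  then show "\<pi> a b = a # m @ [b]" .
  have p: "is_path n E (hd (a # m @ [b])) (last (a # m @ [b])) (a # m @ [b])"
    by (rule is_path_sublist[OF path[OF c] m]) simp
  then have p': "is_path n E a b (a # m @ [b])" by simp
  then have "conn n E a b" "a \<noteq> b" by (auto simp: conn_def, auto simp: is_path_iff)
  then show "seg a b" using s[OF m] e by (simp add: seg_def)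
qed

text \<open>A cut inside a piece keeps the end of that piece, again a contiguous part of the same
  step, so the number of pieces does not grow.\<close>

lemma glue_suffix:
  assumes "successively seg q" "z \<in> set (glue q)"
  shows "\<exists>q'. q' \<noteq> [] \<and> successively seg q' \<and> hd q' = z \<and> last q' = last q \<and>
     length q' \<le> length q \<and> suffix (glue q') (glue q) \<and> (set q \<subseteq> {..<n} \<longrightarrow> set q' \<subseteq> {..<n})"
  using assms
proof (induction q rule: glue.induct)
  case (1 a b q)
  show ?case
  proof (cases "z \<in> set (butlast (\<pi> a b))")
    case True
    have ab: "seg a b" using 1 by simp
    then have c: "conn n E a b" by (simp add: seg_def)
    from glue_Cons[OF 1(2)] obtain r where r: "glue (b # q) = b # r"
      "\<pi> a b = butlast (\<pi> a b) @ [b]" "glue (a # b # q) = butlast (\<pi> a b) @ b # r" .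
    obtain p1 p2 where p: "butlast (\<pi> a b) = p1 @ z # p2" using True by (meson split_list)
    have e: "\<pi> a b = p1 @ z # p2 @ [b]" using r(2) unfolding p by simp
    have sub: "sublist (z # p2 @ [b]) (\<pi> a b)" unfolding e by (rule sublist_append_leftI)
    have s: "\<exists>(x, y)\<in>steps. sublist m (\<pi> x y)" if "sublist m (\<pi> a b)" for m
      using that ab sublist_order.order_trans unfolding seg_def by blast
    have zb: "seg z b" "\<pi> z b = z # p2 @ [b]" using seg_sublist[OF c s sub] by auto
    have "glue (z # b # q) = z # p2 @ glue (b # q)" using zb by (simp add: butlast_append)
    moreover have "glue (a # b # q) = p1 @ z # p2 @ glue (b # q)" using p by simp
    ultimately have "suffix (glue (z # b # q)) (glue (a # b # q))" by (simp add: suffix_def)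
    moreover have "z < n" using zb(1) conn_less by (auto simp: seg_def)
    ultimately show ?thesis using zb 1 by (intro exI[of _ "z # b # q"]) auto
  next
    case False
    then have "z \<in> set (glue (b # q))" using 1 by auto
    then obtain q' where "q' \<noteq> []" "successively seg q'" "hd q' = z" "last q' = last (b # q)"
      "length q' \<le> length (b # q)" "suffix (glue q') (glue (b # q))"
      "set (b # q) \<subseteq> {..<n} \<longrightarrow> set q' \<subseteq> {..<n}" using 1 by auto
    then show ?thesis by (intro exI[of _ q']) (auto intro: suffix_appendI)
  qed
next
  case ("2_2" v)
  then show ?case by (intro exI[of _ "[v]"]) auto
qed auto

lemma glue_edges_E: "successively seg q \<Longrightarrow> edge_set (glue q) \<subseteq> E"
proof (induction q rule: glue.induct)
  case (1 a b q)
  then show ?case using edge_set_glue[OF 1(2)] \<pi>_path(6)[of a b] by (auto simp: seg_def)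
qed auto

lemma wt_suffix:
  assumes "suffix p q" "edge_set q \<subseteq> E"
  shows "wt w p \<le> wt w q"
proof -
  obtain a where a: "q = a @ p" using assms by (auto simp: suffix_def)
  show ?thesis
  proof (cases p)
    case (Cons x p')
    have "edge_set (a @ [x]) \<subseteq> edge_set q" unfolding a Cons
      using edge_set_append[of a x p'] by auto
    then have "0 \<le> wt w (a @ [x])" using assms E_nonneg by (intro wt_nonneg) auto
    then show ?thesis unfolding a Cons using wt_append[of w a x p'] by simp
  qed (use assms E_nonneg in \<open>auto intro: wt_nonneg\<close>)
qed

lemma walk_pieces:
  assumes "walk t c u v" "v < n"
  shows "\<exists>q. q \<noteq> [] \<and> successively seg q \<and> hd q = u \<and> last q = v \<and> length q \<le> Suc t \<and>
    set q \<subseteq> {..<n} \<and> distinct (glue q) \<and> wt w (glue q) \<le> c"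
  using assms
proof (induction rule: kwalk.induct)
  case (kwalk_refl u)
  then show ?case by (intro exI[of _ "[u]"]) auto
next
  case (kwalk_step u x t c v)
  then obtain q where q: "q \<noteq> []" "successively seg q" "hd q = x" "last q = v" "length q \<le> Suc t"
    "set q \<subseteq> {..<n}" "distinct (glue q)" "wt w (glue q) \<le> c" by auto
  have c: "conn n E u x" using kwalk_step steps_conn by blast
  have "\<exists>z\<in>set (\<pi> u x). z \<in> set (glue q)"
    using hd_glue[OF q(2,1)] q(3) \<pi>_path(1,3)[OF c] hd_in_set last_in_set by metis
  \<comment> \<open>The new step is followed only to its first vertex on the path built so far,
    which is cut there. Taking the first such vertex keeps the result simple.\<close>
  then obtain ys z zs where z: "\<pi> u x = ys @ z # zs" "z \<in> set (glue q)" "\<And>y. y \<in> set ys \<Longrightarrow>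
    y \<notin> set (glue q)"
    using split_list_first_prop[of "\<pi> u x" "\<lambda>z. z \<in> set (glue q)"] by blast
  obtain q' where q': "q' \<noteq> []" "successively seg q'" "hd q' = z" "last q' = v"
    "length q' \<le> length q"
    "suffix (glue q') (glue q)" "set q' \<subseteq> {..<n}" using glue_suffix[OF q(2) z(2)] q by auto
  have wq: "wt w (glue q') \<le> wt w (glue q)" using wt_suffix[OF q'(6)] glue_edges_E[OF q(2)] by auto
  have dq: "distinct (glue q')" using q'(6) q(7) by (auto simp: suffix_def)
  show ?case
  proof (cases ys)
    case Nil
    then have "z = u" using z(1) \<pi>_path(2)[OF c] by simp
    then show ?thesis using q q' wq dq dst_nonneg[OF c] by (intro exI[of _ q']) auto
  next
    case (Cons y ys')
    then have y: "y = u" using z(1) \<pi>_path(2)[OF c] by simp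
    have sub: "sublist (u # ys' @ [z]) (\<pi> u x)" unfolding z(1) Cons y
      by (metis append.assoc append_Cons append_Nil sublist_append_rightI)
    have s: "\<exists>(x, y)\<in>steps. sublist m (\<pi> x y)" if "sublist m (\<pi> u x)" for m
      using that kwalk_step by blast
    have uz: "seg u z" "\<pi> u z = u # ys' @ [z]" using seg_sublist[OF c s sub] by auto
    obtain q'' where q'': "q' = z # q''" using q' by (cases q') auto
    have good: "successively seg (u # q')" using q' uz q'' by auto
    have g: "glue (u # q') = ys @ glue q'" using uz y Cons by (simp add: q'' butlast_append)
    have "wt w (glue (u # q')) = wt w (\<pi> u z) + wt w (glue q')"
      using wt_glue[of u z q''] good q'' by simp
    also have "wt w (\<pi> u z) \<le> dst u x"
    proof -
      have "dst u x = dst u z + dst z x" using dst_on_path[OF c, of z] z(1) by simp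
      then show ?thesis using dst_on_path(2)[OF c, of z] z(1) dst_nonneg[of z x]
        by (simp add: dst_def)
    qed
    finally have "wt w (glue (u # q')) \<le> dst u x + c" using wq q(8) by simp
    moreover have "distinct (glue (u # q'))"
      unfolding g using dq z(3) \<pi>_path(4)[OF c] z(1) q'(6) by (auto simp: suffix_def)
    ultimately show ?thesis using good q' q conn_less[OF c] by (intro exI[of _ "u # q'"]) auto
  qed
qed

lemma seg_cases:
  assumes "seg a b"
  obtains (edge) "\<pi> a b = [a, b]"
  | (half) i x y where "i \<le> l" "(x, y) \<in> half i" "sublist (\<pi> a b) (\<pi> x y)"
  | (up) i x y where "i \<le> l" "(x, y) \<in> up i" "sublist (\<pi> a b) (\<pi> x y)"
  | (down) i x y where "i \<le> l" "(x, y) \<in> up i" "sublist (\<pi> b a) (\<pi> x y)"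
proof -
  have ne: "a \<noteq> b" and c: "conn n E a b" using assms by (auto simp: seg_def)
  obtain x y where xy: "(x, y) \<in> steps" "sublist (\<pi> a b) (\<pi> x y)" using assms
    by (auto simp: seg_def)
  then consider "\<pi> x y = [x, y]" | i where "i \<le> l" "(x, y) \<in> half i" | i where "i \<le> l"
    "(x, y) \<in> up i"
    | i where "i \<le> l" "(y, x) \<in> up i" unfolding steps_def by blast
  then show thesis
  proof cases
    case 1
    obtain m m' where m: "[x, y] = m @ \<pi> a b @ m'" using xy(2) 1 by (auto simp: sublist_def)
    \<comment> \<open>The ends differ, so a part of a single edge is the whole edge.\<close>
    have "2 \<le> length (\<pi> a b)" using \<pi>_path(1,2,3)[OF c] ne
      by (cases "\<pi> a b" rule: edge_set.cases) (auto split: if_splits)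
    moreover have "length [x, y] = length m + length (\<pi> a b) + length m'" by (simp add: m)
    ultimately have "length m = 0 \<and> length m' = 0" by (simp only: list.size) linarith
    then have "m = []" "m' = []" by auto
    then have "\<pi> a b = [x, y]" using m by simp
    then have "\<pi> a b = [a, b]" using \<pi>_path(2,3)[OF c] by simp
    then show thesis by (rule edge)
  next
    case 4
    have "\<pi> x y = rev (\<pi> y x)" using symmetric[OF up_conn[OF 4(2)]] .
    then have "sublist (rev (\<pi> a b)) (\<pi> y x)" using xy(2) sublist_rev by fastforce
    then show thesis using down[OF 4] symmetric[OF c] by simp
  qed (use xy half up in blast)+
qed

lemma glue_edges:
  assumes "successively seg q"
  shows "edge_set (glue q) \<subseteq> support \<union> (edge_set q \<inter> E)"
  using assms
proof (induction q rule: glue.induct)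
  case (1 a b q)
  have ab: "seg a b" using 1 by simp
  then have c: "conn n E a b" by (simp add: seg_def)
  have "edge_set (\<pi> a b) \<subseteq> support \<union> (edge_set (a # b # q) \<inter> E)"
    using ab
  proof (cases rule: seg_cases)
    case edge
    then show ?thesis using \<pi>_path(6)[OF c] by simp
  next
    case (half i x y)
    then show ?thesis using edge_set_sublist[OF half(3)]
      unfolding support_def half_edges_def by blast
  next
    case (up i x y)
    then show ?thesis using edge_set_sublist[OF up(3)] unfolding support_def up_edges_def by blast
  next
    case (down i x y)
    have "edge_set (\<pi> a b) = edge_set (\<pi> b a)" using symmetric[OF c] by (simp add: edge_set_rev)
    then show ?thesis using down edge_set_sublist[OF down(3)]
      unfolding support_def up_edges_def by blast
  qed
  then show ?case using edge_set_glue[OF 1(2)] 1 by auto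
qed auto

end

section \<open>Perfect hashing by multiplication\<close>

text \<open>Multiplicative hashing: the residues are cut into arcs of length \<open>W div m\<close>.
  Rounding may produce more than \<open>m\<close> arcs but at most \<open>2 * m\<close>, hence the
  tables of \<open>2 * m\<close> slots.\<close>

definition hash :: "nat \<Rightarrow> nat \<Rightarrow> nat \<Rightarrow> nat \<Rightarrow> nat" where
  "hash W m a x = (a * x mod W) div (W div m)"

lemma card_spread:
  fixes X :: "nat set"
  assumes "\<And>a b. a \<in> X \<Longrightarrow> b \<in> X \<Longrightarrow> a \<le> b \<Longrightarrow> (b - a) * \<delta> < D" "0 < \<delta>"
  shows "finite X \<and> card X \<le> D div \<delta> + 1"
proof (cases "X = {}")
  case False
  define a where "a = (LEAST a. a \<in> X)"
  have a: "a \<in> X" "\<And>b. b \<in> X \<Longrightarrow> a \<le> b" using False unfolding a_def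
    by (auto intro: LeastI Least_le)
  have sub: "X \<subseteq> {a..a + D div \<delta>}"
  proof
    fix b assume b: "b \<in> X"
    then have "(b - a) * \<delta> \<le> D" using assms(1)[OF a(1) b a(2)[OF b]] by simp
    then have "b - a \<le> D div \<delta>" using assms(2) by (simp add: less_eq_div_iff_mult_less_eq)
    then show "b \<in> {a..a + D div \<delta>}" using a(2)[OF b] by auto
  qed
  then show ?thesis using card_mono[OF _ sub] finite_subset[OF sub] by simp
qed auto

text \<open>Multiplication by \<open>\<delta>\<close> winds around the residues \<open>\<delta>\<close> times, and each turn visits an arc of length
  \<open>D\<close> at most \<open>D / \<delta> + 1\<close> times.\<close>

lemma card_residue_arc:
  assumes "0 < \<delta>" "0 < W"
  shows "card {a. a < W \<and> a * \<delta> mod W < D} \<le> D + \<delta>" (is "card ?L \<le> _")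
    and "card {a. a < W \<and> W < a * \<delta> mod W + D} \<le> D + \<delta>" (is "card ?R \<le> _")
proof -
  define T where "T = (\<lambda>j. {a. a * \<delta> div W = j \<and> a * \<delta> mod W < D})"
  define T' where "T' = (\<lambda>j. {a. a * \<delta> div W = j \<and> W < a * \<delta> mod W + D})"
  have le: "(b - a) * \<delta> < D"
    if "a \<le> b" "a * \<delta> div W = b * \<delta> div W" "b * \<delta> mod W < D + a * \<delta> mod W" for a b
  proof -
    have "(b - a) * \<delta> = b * \<delta> - a * \<delta>" by (simp add: diff_mult_distrib)
    also have "\<dots> = b * \<delta> mod W - a * \<delta> mod W"
      using that(2) by (metis add_diff_cancel_left div_mult_mod_eq)
    finally show ?thesis using that by (cases "a * \<delta> mod W \<le> b * \<delta> mod W") auto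
  qed
  have T: "finite (T j) \<and> card (T j) \<le> D div \<delta> + 1" for j
    by (rule card_spread[OF _ assms(1)]) (auto simp: T_def intro!: le)
  have lt: "b * \<delta> mod W < W" for b using assms by simp
  have T': "finite (T' j) \<and> card (T' j) \<le> D div \<delta> + 1" for j
    by (rule card_spread[OF _ assms(1)]) (auto simp: T'_def intro!: le intro: less_trans[OF lt])
  have j: "a * \<delta> div W < \<delta>" if "a < W" for a
    using that assms by (simp add: div_less_iff_less_mult)
  have *: "card X \<le> D + \<delta>" if "X \<subseteq> (\<Union>j<\<delta>. F j)" "\<And>j. finite (F j) \<and> card (F j) \<le> D div \<delta> + 1"
    for X :: "nat set" and F
  proof -
    have "card X \<le> card (\<Union>j<\<delta>. F j)" using that by (intro card_mono) auto
    also have "\<dots> \<le> (\<Sum>j<\<delta>. card (F j))" by (rule card_UN_le) simp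
    also have "\<dots> \<le> (\<Sum>j<\<delta>. D div \<delta> + 1)" using that by (intro sum_mono) auto
    also have "\<dots> = \<delta> * (D div \<delta>) + \<delta>" by (simp add: algebra_simps)
    also have "\<dots> \<le> D + \<delta>" by simp
    finally show ?thesis .
  qed
  show "card ?L \<le> D + \<delta>" by (rule *[OF _ T]) (auto simp: T_def dest: j)
  show "card ?R \<le> D + \<delta>" by (rule *[OF _ T']) (auto simp: T'_def dest: j)
qed

text \<open>In a collision the residues of \<open>a * x\<close> and \<open>a * y\<close> are closer
  than \<open>W div m\<close>, so that of \<open>a * (y - x)\<close> lies in an arc at one of the
  two ends. Each arc is hit by at most \<open>W div m + (y - x)\<close> multipliers, and small keys
  make this at most \<open>2 * (W div m)\<close>.\<close>

lemma card_hash_collision: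
  assumes xy: "x < y" "y \<le> W div m" and m: "0 < m"
  shows "card {a. a < W \<and> hash W m a x = hash W m a y} \<le> 4 * (W div m)"
proof -
  let ?D = "W div m" and ?d = "y - x"
  have D: "0 < ?D" using xy by simp
  have W: "0 < W" using D by (metis div_0 gr0I less_irrefl)
  have "{a. a < W \<and> hash W m a x = hash W m a y} \<subseteq>
     {a. a < W \<and> a * ?d mod W < ?D} \<union> {a. a < W \<and> W < a * ?d mod W + ?D}"
  proof
    fix a assume "a \<in> {a. a < W \<and> hash W m a x = hash W m a y}"
    then have a: "a < W" "(a * x mod W) div ?D = (a * y mod W) div ?D" by (auto simp: hash_def)
    define p q t where "p = a * x mod W" and "q = a * y mod W" and "t = a * ?d mod W"
    have lt: "p < W" "q < W" "t < W" using W by (auto simp: p_def q_def t_def)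
    have "a * y = a * x + a * ?d" using xy by (simp flip: add_mult_distrib2)
    then have q: "q = (p + t) mod W" by (simp add: q_def p_def t_def mod_add_eq)
    have pq: "p div ?D = q div ?D" using a by (simp add: p_def q_def)
    have "p < q + ?D \<and> q < p + ?D"
    proof -
      define k where "k = p div ?D * ?D"
      have "p = k + p mod ?D" unfolding k_def by (rule div_mult_mod_eq[symmetric])
      moreover have "q = k + q mod ?D" unfolding k_def pq by (rule div_mult_mod_eq[symmetric])
      moreover have "p mod ?D < ?D" "q mod ?D < ?D" using D by simp_all
      ultimately show ?thesis by linarith
    qed
    moreover have "q = p + t \<or> q + W = p + t"
    proof (cases "p + t < W")
      case True
      then show ?thesis using q by simp
    next
      case False
      then have "q = p + t - W" using q lt by (simp add: mod_if)
      then show ?thesis using False by simp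
    qed
    ultimately have "t < ?D \<or> W < t + ?D" using lt by linarith
    then show "a \<in> {a. a < W \<and> a * ?d mod W < ?D} \<union> {a. a < W \<and> W < a * ?d mod W + ?D}"
      using a by (auto simp: t_def)
  qed
  then have "card {a. a < W \<and> hash W m a x = hash W m a y} \<le>
     card ({a. a < W \<and> a * ?d mod W < ?D} \<union> {a. a < W \<and> W < a * ?d mod W + ?D})"
    by (intro card_mono) auto
  also have "\<dots> \<le> card {a. a < W \<and> a * ?d mod W < ?D} + card {a. a < W \<and> W < a * ?d mod W + ?D}"
    by (rule card_Un_le)
  also have "\<dots> \<le> (?D + ?d) + (?D + ?d)"
    using xy W by (intro add_mono card_residue_arc) auto
  also have "\<dots> \<le> 4 * ?D" using xy by simp
  finally show ?thesis .
qed

section \<open>Collision counts and the choice of multipliers\<close>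

definition collisions :: "('a \<Rightarrow> 'b) \<Rightarrow> 'a set \<Rightarrow> ('a \<times> 'a) set" where
  "collisions h X = {(x, y). x \<in> X \<and> y \<in> X \<and> x \<noteq> y \<and> h x = h y}"

text \<open>Averaging over all \<open>W\<close> multipliers: each of at most
  \<open>card X ^ 2\<close> ordered pairs collides for at most \<open>4 * (W div m)\<close> of
  them.\<close>

lemma good_multiplier:
  fixes X :: "nat set"
  assumes X: "finite X" "\<And>x. x \<in> X \<Longrightarrow> x \<le> W div m" and m: "0 < m" and W: "0 < W"
  shows "\<exists>a<W. card (collisions (hash W m a) X) * m \<le> 4 * card X ^ 2"
proof (rule ccontr)
  assume "\<not> ?thesis"
  then have big: "\<And>a. a < W \<Longrightarrow> 4 * card X ^ 2 < card (collisions (hash W m a) X) * m" by force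
  define N where "N = {(x, y). x \<in> X \<and> y \<in> X \<and> x \<noteq> y}"
  have N: "N \<subseteq> X \<times> X" "finite N" using X by (auto simp: N_def intro: finite_subset[of _ "X \<times> X"])
  have cN: "card N \<le> card X ^ 2"
    using card_mono[OF _ N(1)] X by (simp add: card_cartesian_product power2_eq_square)
  have "(\<Sum>a<W. card (collisions (hash W m a) X)) =
      (\<Sum>a<W. \<Sum>(x, y)\<in>N. if hash W m a x = hash W m a y then 1 else 0)"
  proof (rule sum.cong[OF refl])
    fix a
    have "collisions (hash W m a) X = {c\<in>N. hash W m a (fst c) = hash W m a (snd c)}"
      by (auto simp: collisions_def N_def)
    then show "card (collisions (hash W m a) X) =
      (\<Sum>(x, y)\<in>N. if hash W m a x = hash W m a y then 1 else 0)"
      using N(2) by (simp add: case_prod_beta sum.If_cases Int_def)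
  qed
  also have "\<dots> = (\<Sum>(x, y)\<in>N. \<Sum>a<W. if hash W m a x = hash W m a y then 1 else 0)"
    by (subst sum.swap) (simp add: case_prod_beta)
  also have "\<dots> \<le> (\<Sum>(x, y)\<in>N. 4 * (W div m))"
  proof (rule sum_mono, clarify)
    fix x y assume xy: "(x, y) \<in> N"
    have e: "(\<Sum>a<W. if hash W m a x = hash W m a y then 1 else 0) =
        card {a. a < W \<and> hash W m a x = hash W m a y}" for x y
      by (simp add: sum.If_cases Int_def)
    have "card {a. a < W \<and> hash W m a x = hash W m a y} \<le> 4 * (W div m)"
    proof (cases "x < y")
      case True
      then show ?thesis using card_hash_collision[OF True _ m] X xy by (auto simp: N_def)
    next
      case False
      then have "y < x" using xy by (auto simp: N_def)
      then have "card {a. a < W \<and> hash W m a y = hash W m a x} \<le> 4 * (W div m)"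
        using card_hash_collision[OF _ _ m] X xy by (auto simp: N_def)
      then show ?thesis by (simp only: eq_commute)
    qed
    then show "(\<Sum>a<W. if hash W m a x = hash W m a y then 1 else 0) \<le> 4 * (W div m)" using e by simp
  qed
  also have "\<dots> = card N * (4 * (W div m))" by (simp add: case_prod_beta)
  also have "\<dots> \<le> card X ^ 2 * (4 * (W div m))" using cN by (rule mult_right_mono) simp
  finally have "(\<Sum>a<W. card (collisions (hash W m a) X)) * m \<le> card X ^ 2 * (4 * (W div m)) * m"
    by (rule mult_right_mono) simp
  also have "\<dots> = 4 * card X ^ 2 * (W div m * m)" by (simp add: mult.commute mult.left_commute)
  also have "\<dots> \<le> 4 * card X ^ 2 * W" by (intro mult_left_mono) auto
  also have "\<dots> = (\<Sum>a<W. 4 * card X ^ 2)" by simp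
  also have "\<dots> < (\<Sum>a<W. card (collisions (hash W m a) X) * m)"
    using big W by (intro sum_strict_mono) auto
  finally show False by (simp only: sum_distrib_right)
qed

lemma hash_less: "0 < m \<Longrightarrow> m \<le> W \<Longrightarrow> hash W m a x < 2 * m"
proof -
  assume m: "0 < m" "m \<le> W"
  then have D: "1 \<le> W div m" by (simp add: Suc_le_eq div_greater_zero_iff)
  have "W < (W div m + 1) * m" using m by (metis Suc_eq_plus1 dividend_less_times_div mult.commute
    mult_Suc_right add.commute)
  also have "\<dots> \<le> (2 * (W div m)) * m" using D by (intro mult_right_mono) auto
  finally have "W < 2 * m * (W div m)" by (simp add: mult.commute mult.left_commute)
  moreover have "a * x mod W < W" using m by auto
  ultimately show ?thesis unfolding hash_def by (intro less_mult_imp_div_less) simp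
qed

text \<open>The squares count ordered pairs with equal hash value, split into the diagonal and the
  collisions.\<close>

lemma sum_bucket_squares:
  fixes h :: "'a \<Rightarrow> nat"
  assumes "finite X" "\<And>x. x \<in> X \<Longrightarrow> h x < r"
  shows "(\<Sum>j<r. card {x \<in> X. h x = j} ^ 2) = card X + card (collisions h X)"
proof -
  have "(\<Sum>j<r. card {x \<in> X. h x = j} ^ 2) = (\<Sum>j<r. card ({x \<in> X. h x = j} \<times> {x \<in> X. h x = j}))"
    by (simp add: card_cartesian_product power2_eq_square)
  also have "\<dots> = card (\<Union>j<r. {x \<in> X. h x = j} \<times> {x \<in> X. h x = j})"
    using assms by (intro card_UN_disjoint[symmetric]) auto
  also have "(\<Union>j<r. {x \<in> X. h x = j} \<times> {x \<in> X. h x = j}) = (\<lambda>x. (x, x)) ` X \<union> collisions h X"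
    using assms by (auto simp: collisions_def)
  also have "card \<dots> = card ((\<lambda>x. (x, x)) ` X) + card (collisions h X)"
    using assms finite_subset[of "collisions h X" "X \<times> X"]
    by (intro card_Un_disjoint) (auto simp: collisions_def)
  also have "card ((\<lambda>x. (x, x)) ` X) = card X" by (intro card_image) (auto simp: inj_on_def)
  finally show ?thesis .
qed

text \<open>The outer function has at most \<open>4 * card X\<close> collisions, so the squared
  bucket sizes sum to at most \<open>5 * card X\<close>, and inner tables quadratic in their buckets
  have linear total size.\<close>

lemma perfect_hash:
  fixes X :: "nat set"
  assumes X: "finite X" "\<And>x. x \<in> X \<Longrightarrow> x \<le> W div (4 * card X ^ 2 + 2)"
    and W: "4 * card X ^ 2 + 2 \<le> W"
  defines "M \<equiv> card X + 2"
  shows "\<exists>a1 a2 m2. a1 < W \<and> (\<forall>j. a2 j < W \<and> 2 \<le> m2 j \<and> m2 j \<le> 4 * card X ^ 2 + 2) \<and>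
    (\<Sum>j<2 * M. 2 * m2 j) \<le> 48 * card X + 16 \<and>
    (\<forall>x\<in>X. \<forall>y\<in>X. hash W M a1 x = hash W M a1 y \<longrightarrow>
       hash W (m2 (hash W M a1 x)) (a2 (hash W M a1 x)) x = hash W (m2 (hash W M a1 y)) (a2 (hash W
         M a1 y)) y \<longrightarrow> x = y)"
proof -
  let ?K = "4 * card X ^ 2 + 2"
  have W0: "0 < W" using W by linarith
  have le: "x \<le> W div m" if "x \<in> X" "0 < m" "m \<le> ?K" for x m
    using X(2)[OF that(1)] div_le_mono2[OF that(2,3), of W] by linarith
  have MK: "M \<le> ?K" unfolding M_def by (simp add: power2_eq_square le_square trans_le_add1)
  have M0: "0 < M" by (simp add: M_def)
  obtain a1 where a1: "a1 < W" "card (collisions (hash W M a1) X) * M \<le> 4 * card X ^ 2"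
    using good_multiplier[OF X(1) le[OF _ M0 MK] M0 W0] by blast
  let ?h = "hash W M a1"
  define B where "B = (\<lambda>j. {x \<in> X. ?h x = j})"
  have B: "finite (B j)" "card (B j) \<le> card X" for j
    using X by (auto simp: B_def intro: card_mono)
  \<comment> \<open>Exceeding \<open>4 * card (B j) ^ 2\<close> leaves no room for even one
    collision. The offset 2 makes the modulus at least 2 for empty buckets too, so that
    \<open>W div m2 j\<close> is a word.\<close>
  define m2 where "m2 = (\<lambda>j. 4 * card (B j) ^ 2 + 2)"
  have m2: "2 \<le> m2 j" "m2 j \<le> ?K" for j
    using power_mono[OF B(2)[of j], of 2] by (auto simp: m2_def)
  have "\<exists>a<W. card (collisions (hash W (m2 j) a) (B j)) * m2 j \<le> 4 * card (B j) ^ 2" for j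
    using m2[of j] by (intro good_multiplier B le W0) (auto simp: B_def)
  then obtain a2 where a2: "\<And>j. a2 j < W" "\<And>j. card (collisions (hash W (m2 j) (a2 j)) (B j)) * m2 j
    \<le> 4 * card (B j) ^ 2"
    by metis
  have inj: "x = y" if "x \<in> X" "y \<in> X" "?h x = ?h y"
    "hash W (m2 (?h x)) (a2 (?h x)) x = hash W (m2 (?h y)) (a2 (?h y)) y" for x y
  proof (rule ccontr)
    assume "x \<noteq> y"
    let ?j = "?h x"
    let ?C = "collisions (hash W (m2 ?j) (a2 ?j)) (B ?j)"
    have "(x, y) \<in> ?C" using that \<open>x \<noteq> y\<close> by (auto simp: collisions_def B_def)
    moreover have "finite ?C"
      using finite_subset[of ?C "B ?j \<times> B ?j"] B by (auto simp: collisions_def)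
    ultimately have "1 \<le> card ?C" by (metis One_nat_def Suc_leI card_gt_0_iff empty_iff)
    then have "m2 ?j \<le> card ?C * m2 ?j" by simp
    then show False using a2(2)[of ?j] by (simp add: m2_def)
  qed
  have "(\<Sum>j<2 * M. 2 * m2 j) = 8 * (\<Sum>j<2 * M. card (B j) ^ 2) + 8 * M"
  proof -
    have "2 * m2 j = 8 * card (B j) ^ 2 + 4" for j by (simp add: m2_def)
    then show ?thesis by (simp only: sum.distrib sum_distrib_left) simp
  qed
  also have "(\<Sum>j<2 * M. card (B j) ^ 2) = card X + card (collisions ?h X)"
    unfolding B_def using X MK W by (intro sum_bucket_squares hash_less M0) auto
  also have "card (collisions ?h X) \<le> 4 * card X"
  proof -
    have "card (collisions ?h X) * M \<le> 4 * card X * M"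
      using a1(2) by (simp add: M_def power2_eq_square algebra_simps)
    then show ?thesis using M0 by simp
  qed
  finally have "(\<Sum>j<2 * M. 2 * m2 j) \<le> 48 * card X + 16" by (simp add: M_def)
  then show ?thesis using a1(1) a2(1) m2 inj by (intro exI[of _ a1] exI[of _ a2] exI[of _ m2]) blast
qed

section \<open>The query program\<close>

text \<open>The stored data start with \<open>n\<close>, the multiplier and divisor of the outer hash function, and three words
  (multiplier, divisor, table address) per bucket. The hash table leads to the record of the queried pair:
  the number of pieces, followed by seven words per piece, which the program holds in registers 12 to
  18: first vertex, its predecessor, address of the exceptions, last vertex, address of the
  table of local rules, whether predecessors matter (0 or 1), and direction of the output. A piece is
  generated into the scratch memory and is then output forwards or backwards. At a vertex \<open>c\<close> with entry
  \<open>t\<close> in the table of rules, the next vertex is \<open>t - 1\<close> minus the predecessor if \<open>t > 0\<close>, and the next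
  exception if \<open>t = 0\<close>.\<close>

definition query :: "instr list" where
  "query = [
    Const 3 1, Fetch 4 2, Mul 5 0 4, Add 5 5 1, Fetch 6 3, Add 7 3 3, Fetch 8 7, Mul 6 6 5,
    Div 6 6 8, Add 7 7 3, Mul 6 6 7, Add 6 6 7, Fetch 8 6, Add 6 6 3, Fetch 9 6, Add 6 6 3,
    Fetch 6 6, Mul 8 8 5, Div 8 8 9, Add 6 6 8, Fetch 10 6, Fetch 11 10, Add 10 10 3, Output 0,
    JumpLess 2 11 26, JumpLess 2 3 72, Fetch 12 10, Add 10 10 3, Fetch 13 10, Add 10 10 3,
    Fetch 14 10, Add 10 10 3, Fetch 15 10, Add 10 10 3, Fetch 16 10, Add 10 10 3, Fetch 17 10,
    Add 10 10 3, Fetch 18 10, Add 10 10 3, Const 19 0,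
    Store 19 12, Add 19 19 3, JumpLess 12 15 46, JumpLess 15 12 46, JumpLess 2 3 58,
    Add 20 16 12, Fetch 20 20, JumpLess 2 20 53, Mul 13 17 12, Fetch 12 14, Add 14 14 3,
    JumpLess 2 3 41, Sub 20 20 3, Sub 20 20 13, Mul 13 17 12, Add 12 20 2, JumpLess 2 3 41,
    Const 21 0, JumpLess 21 19 62, Sub 11 11 3, JumpLess 2 3 24, Sub 20 19 3, Sub 20 20 21,
    Mul 20 18 20, Sub 22 3 18, Mul 22 22 21, Add 20 20 22, Load 20 20, Output 20, Add 21 21 3,
    JumpLess 2 3 59]"

lemma length_query: "length query = 72"
  by (simp add: query_def)

lemma query_nth:
  "query ! 0 = Const 3 1"
  "query ! Suc 0 = Fetch 4 2"
  "query ! 2 = Mul 5 0 4"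
  "query ! 3 = Add 5 5 1"
  "query ! 4 = Fetch 6 3"
  "query ! 5 = Add 7 3 3"
  "query ! 6 = Fetch 8 7"
  "query ! 7 = Mul 6 6 5"
  "query ! 8 = Div 6 6 8"
  "query ! 9 = Add 7 7 3"
  "query ! 10 = Mul 6 6 7"
  "query ! 11 = Add 6 6 7"
  "query ! 12 = Fetch 8 6"
  "query ! 13 = Add 6 6 3"
  "query ! 14 = Fetch 9 6"
  "query ! 15 = Add 6 6 3"
  "query ! 16 = Fetch 6 6"
  "query ! 17 = Mul 8 8 5"
  "query ! 18 = Div 8 8 9"
  "query ! 19 = Add 6 6 8"
  "query ! 20 = Fetch 10 6"
  "query ! 21 = Fetch 11 10"
  "query ! 22 = Add 10 10 3"
  "query ! 23 = Output 0"
  "query ! 24 = JumpLess 2 11 26"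
  "query ! 25 = JumpLess 2 3 72"
  "query ! 26 = Fetch 12 10"
  "query ! 27 = Add 10 10 3"
  "query ! 28 = Fetch 13 10"
  "query ! 29 = Add 10 10 3"
  "query ! 30 = Fetch 14 10"
  "query ! 31 = Add 10 10 3"
  "query ! 32 = Fetch 15 10"
  "query ! 33 = Add 10 10 3"
  "query ! 34 = Fetch 16 10"
  "query ! 35 = Add 10 10 3"
  "query ! 36 = Fetch 17 10"
  "query ! 37 = Add 10 10 3"
  "query ! 38 = Fetch 18 10"
  "query ! 39 = Add 10 10 3"
  "query ! 40 = Const 19 0"
  "query ! 41 = Store 19 12"
  "query ! 42 = Add 19 19 3"
  "query ! 43 = JumpLess 12 15 46"
  "query ! 44 = JumpLess 15 12 46"
  "query ! 45 = JumpLess 2 3 58"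
  "query ! 46 = Add 20 16 12"
  "query ! 47 = Fetch 20 20"
  "query ! 48 = JumpLess 2 20 53"
  "query ! 49 = Mul 13 17 12"
  "query ! 50 = Fetch 12 14"
  "query ! 51 = Add 14 14 3"
  "query ! 52 = JumpLess 2 3 41"
  "query ! 53 = Sub 20 20 3"
  "query ! 54 = Sub 20 20 13"
  "query ! 55 = Mul 13 17 12"
  "query ! 56 = Add 12 20 2"
  "query ! 57 = JumpLess 2 3 41"
  "query ! 58 = Const 21 0"
  "query ! 59 = JumpLess 21 19 62"
  "query ! 60 = Sub 11 11 3"
  "query ! 61 = JumpLess 2 3 24"
  "query ! 62 = Sub 20 19 3"
  "query ! 63 = Sub 20 20 21"
  "query ! 64 = Mul 20 18 20"
  "query ! 65 = Sub 22 3 18"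
  "query ! 66 = Mul 22 22 21"
  "query ! 67 = Add 20 20 22"
  "query ! 68 = Load 20 20"
  "query ! 69 = Output 20"
  "query ! 70 = Add 21 21 3"
  "query ! 71 = JumpLess 2 3 59"
  by (simp_all add: query_def)

text \<open>The lists that the generating loop can produce from table \<open>b\<close>, predecessor
  \<open>p\<close> and exception address \<open>q\<close>. With \<open>\<sigma> = 1\<close> the
  current vertex becomes the predecessor; with \<open>\<sigma> = 0\<close> and \<open>p = 0\<close>
  the predecessor stays 0, and the same subtraction reads a plain parent pointer.\<close>

fun trace :: "nat list \<Rightarrow> nat \<Rightarrow> nat \<Rightarrow> nat \<Rightarrow> nat \<Rightarrow> nat list \<Rightarrow> bool" where
  "trace D b \<sigma> p q (c # c' # r) \<longleftrightarrow> b + c < length D \<and>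
     (if D ! (b + c) = 0 then q < length D \<and> c' = D ! q \<and> trace D b \<sigma> (\<sigma> * c) (Suc q) (c' # r)
      else c' = D ! (b + c) - 1 - p \<and> trace D b \<sigma> (\<sigma> * c) q (c' # r))"
| "trace D b \<sigma> p q r \<longleftrightarrow> r \<noteq> []"

definition oriented :: "nat \<Rightarrow> nat list \<Rightarrow> nat list" where
  "oriented dir p = (if dir = 0 then p else rev p)"

text \<open>The strict bound \<open>a + 7 < length D\<close> keeps the address a word after the
  seventh word has been read.\<close>

definition piece :: "nat \<Rightarrow> nat list \<Rightarrow> nat \<Rightarrow> nat list \<Rightarrow> bool" where
  "piece W D a p \<longleftrightarrow> (\<exists>g. a + 7 < length D \<and>
     trace D (D ! (a + 4)) (D ! (a + 5)) (D ! (a + 1)) (D ! (a + 2)) g \<and>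
     hd g = D ! a \<and> last g = D ! (a + 3) \<and> distinct g \<and> (\<forall>x\<in>set g. x < W) \<and> length g < W \<and>
     D ! (a + 5) \<le> 1 \<and> D ! (a + 6) \<le> 1 \<and> p = oriented (D ! (a + 6)) g)"

section \<open>Correctness and running time of the query program\<close>

context
  fixes W :: nat and D :: "nat list"
  assumes len_D: "length D < W" and D_W: "\<And>x. x \<in> set D \<Longrightarrow> x < W" and W2: "2 \<le> W"
begin

abbreviation run :: "nat \<Rightarrow> state \<Rightarrow> state" where
  "run k \<equiv> step W D query ^^ k"

abbreviation st :: "nat \<Rightarrow> (nat \<Rightarrow> nat) \<Rightarrow> (nat \<Rightarrow> nat) \<Rightarrow> nat list \<Rightarrow> state" where
  "st p R M os \<equiv> \<lparr>pc = p, reg = R, mem = M, out = os\<rparr>"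

lemma step_st: "i < 72 \<Longrightarrow> step W D query (st i R M os) = exec W D (query ! i) (st i R M os)"
  by (simp add: step_def length_query)

lemma run_numeral: "run (numeral k) s = step W D query (run (pred_numeral k) s)"
  by (simp add: numeral_eq_Suc)

lemma run_one: "run (Suc 0) s = step W D query s" "run 0 s = s"
  by simp_all

lemma run_add: "run (a + b) s = run b (run a s)"
  by (subst add.commute) (simp add: funpow_add)

lemma D_less: "i < length D \<Longrightarrow> D ! i < W"
  using D_W by simp

lemma less_W: "i < length D \<Longrightarrow> i < W" "i < length D \<Longrightarrow> Suc i < W"
  using len_D by simp_all

lemmas sym_exec = run_numeral run_one step_st query_nth set_reg_def numeral_2_eq_2[symmetric]

lemma gen_stop:
  assumes "R 12 = R 15" "R 2 = 0" "R 3 = 1" "Suc (R 19) < W"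
  shows "run 5 (st 41 R M os) = st 58 (R(19 := Suc (R 19))) (M(R 19 := R 12)) os"
  using assms by (simp add: sym_exec)

lemma gen_continue:
  assumes "R 12 \<noteq> R 15" "R 2 = 0" "R 3 = 1" "Suc (R 19) < W"
  shows "\<exists>k\<le>4. run k (st 41 R M os) = st 46 (R(19 := Suc (R 19))) (M(R 19 := R 12)) os"
proof (cases "R 12 < R 15")
  case True
  have "run 3 (st 41 R M os) = st 46 (R(19 := Suc (R 19))) (M(R 19 := R 12)) os"
    using assms True by (simp add: sym_exec)
  then show ?thesis by (intro exI[of _ 3]) simp
next
  case False
  have "run 4 (st 41 R M os) = st 46 (R(19 := Suc (R 19))) (M(R 19 := R 12)) os"
    using assms False by (simp add: sym_exec)
  then show ?thesis by (intro exI[of _ 4]) simp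
qed

lemma gen_exception:
  assumes "R 2 = 0" "R 3 = 1" "R 16 + R 12 < length D" "D ! (R 16 + R 12) = 0"
    "R 17 \<le> 1" "R 12 < W" "R 14 < length D"
  shows "run 7 (st 46 R M os) =
    st 41 (R(20 := 0, 13 := R 17 * R 12, 12 := D ! (R 14), 14 := Suc (R 14))) M os"
proof -
  have "R 17 * R 12 < W" using assms by (cases "R 17") auto
  then show ?thesis using assms less_W D_less by (simp add: sym_exec)
qed

lemma gen_rule:
  assumes "R 2 = 0" "R 3 = 1" "R 16 + R 12 < length D" "0 < D ! (R 16 + R 12)"
    "R 17 \<le> 1" "R 12 < W"
  defines "y \<equiv> D ! (R 16 + R 12) - 1 - R 13"
  shows "run 8 (st 46 R M os) = st 41 (R(20 := y, 13 := R 17 * R 12, 12 := y)) M os"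
proof -
  have "R 17 * R 12 < W" using assms by (cases "R 17") auto
  moreover have "D ! (R 16 + R 12) < W" using assms D_less by simp
  moreover from this have "D ! (R 16 + R 12) - 1 < W" "y < W" by (auto simp: y_def)
  ultimately show ?thesis using assms(1-6) less_W unfolding y_def by (simp add: sym_exec)
qed

text \<open>One round takes at most 4 instructions to store and test a vertex and at most 8 to find
  the next one. As the vertices are distinct, the comparison with the last vertex first succeeds at
  the end.\<close>

lemma generate:
  assumes "trace D (R 16) (R 17) (R 13) (R 14) p" "R 12 = hd p" "R 15 = last p" "distinct p"
    "\<And>x. x \<in> set p \<Longrightarrow> x < W" "R 17 \<le> 1" "R 2 = 0" "R 3 = 1" "R 19 + length p < W"
  shows "\<exists>k R' M'. k \<le> 12 * length p \<and> run k (st 41 R M os) = st 58 R' M' os \<and>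
     R' 19 = R 19 + length p \<and> (\<forall>i<length p. M' (R 19 + i) = p ! i) \<and> (\<forall>a<R 19. M' a = M a) \<and>
     (\<forall>r\<in>{2, 3, 10, 11, 18}. R' r = R r)"
  using assms
proof (induction p arbitrary: R M)
  case Nil
  then show ?case by (cases "R 12") auto
next
  case (Cons c p)
  note prems = Cons.prems
  show ?case
  proof (cases p)
    case Nil
    then have "run 5 (st 41 R M os) = st 58 (R(19 := Suc (R 19))) (M(R 19 := R 12)) os"
      using prems by (intro gen_stop) auto
    moreover have "(5::nat) \<le> 12 * length (c # p)" by simp
    moreover have "(R(19 := Suc (R 19))) 19 = R 19 + length (c # p)" using Nil by simp
    moreover have "\<forall>i<length (c # p). (M(R 19 := R 12)) (R 19 + i) = (c # p) ! i"
      using prems Nil by simp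
    moreover have "\<forall>a<R 19. (M(R 19 := R 12)) a = M a"
      "\<forall>r\<in>{2, 3, 10, 11, 18}. (R(19 := Suc (R 19))) r = R r" by simp_all
    ultimately show ?thesis by blast
  next
    case (Cons c' r)
    have "R 12 \<noteq> R 15" using prems Cons by auto
    then obtain k1 where k1: "k1 \<le> 4"
      "run k1 (st 41 R M os) = st 46 (R(19 := Suc (R 19))) (M(R 19 := R 12)) os"
      using gen_continue[of R M os] prems Cons by auto
    let ?R1 = "R(19 := Suc (R 19))" and ?M1 = "M(R 19 := R 12)"
    obtain k2 R2 where k2: "k2 \<le> 8" "run k2 (st 46 ?R1 ?M1 os) = st 41 R2 ?M1 os"
      "trace D (R2 16) (R2 17) (R2 13) (R2 14) p" "R2 12 = c'"
      "\<forall>r\<in>{2, 3, 10, 11, 15, 16, 17, 18, 19}. R2 r = ?R1 r"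
    proof (cases "D ! (R 16 + c) = 0")
      case True
      let ?R = "?R1(20 := 0, 13 := ?R1 17 * ?R1 12, 12 := D ! (?R1 14), 14 := Suc (?R1 14))"
      have "run 7 (st 46 ?R1 ?M1 os) = st 41 ?R ?M1 os"
        using prems True Cons by (intro gen_exception) auto
      moreover have "trace D (?R 16) (?R 17) (?R 13) (?R 14) p" "?R 12 = c'"
        using prems(1,2) True Cons by (auto simp del: trace.simps(2))
      ultimately show thesis using that[of 7 ?R] by simp
    next
      case False
      let ?y = "D ! (?R1 16 + ?R1 12) - 1 - ?R1 13"
      let ?R = "?R1(20 := ?y, 13 := ?R1 17 * ?R1 12, 12 := ?y)"
      have "run 8 (st 46 ?R1 ?M1 os) = st 41 ?R ?M1 os"
        using prems False Cons by (intro gen_rule) auto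
      moreover have "trace D (?R 16) (?R 17) (?R 13) (?R 14) p" "?R 12 = c'"
        using prems(1,2) False Cons by (auto simp del: trace.simps(2))
      ultimately show thesis using that[of 8 ?R] by simp
    qed
    have "\<exists>k R' M'. k \<le> 12 * length p \<and> run k (st 41 R2 ?M1 os) = st 58 R' M' os \<and>
     R' 19 = R2 19 + length p \<and> (\<forall>i<length p. M' (R2 19 + i) = p ! i) \<and> (\<forall>a<R2 19. M' a = ?M1 a) \<and>
     (\<forall>r\<in>{2, 3, 10, 11, 18}. R' r = R2 r)"
      using prems k2 Cons by (intro Cons.IH) auto
    then obtain k3 R' M' where k3: "k3 \<le> 12 * length p" "run k3 (st 41 R2 ?M1 os) = st 58 R' M' os"
     "R' 19 = R2 19 + length p" "\<forall>i<length p. M' (R2 19 + i) = p ! i" "\<forall>a<R2 19. M' a = ?M1 a"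
     "\<forall>r\<in>{2, 3, 10, 11, 18}. R' r = R2 r" by blast
    have R2: "R2 19 = Suc (R 19)" using k2 by simp
    have "run (k1 + k2 + k3) (st 41 R M os) = st 58 R' M' os"
      using k1 k2 k3 by (simp add: run_add)
    moreover have "k1 + k2 + k3 \<le> 12 * length (c # p)" using k1 k2 k3 by simp
    moreover have "M' (R 19 + i) = (c # p) ! i" if "i < length (c # p)" for i
    proof (cases i)
      case 0
      then show ?thesis using k3(5) R2 prems by simp
    next
      case (Suc j)
      then show ?thesis using k3(4) R2 that by simp
    qed
    moreover have "\<forall>a<R 19. M' a = M a" using k3(5) R2 by simp
    ultimately show ?thesis using k2 k3 R2
      by (rule_tac exI[of _ "k1 + k2 + k3"], rule_tac exI[of _ R'], rule_tac exI[of _ M']) auto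
  qed
qed

text \<open>The direction is handled without a branch: the program reads the scratch word at
  \<open>d * (len - 1 - j) + (1 - d) * j\<close> for the direction bit \<open>d\<close>.\<close>

lemma emit_one:
  assumes "R 2 = 0" "R 3 = 1" "R 18 \<le> 1" "R 21 < R 19" "R 19 = length p" "R 19 < W"
    "\<And>i. i < length p \<Longrightarrow> M i = p ! i" "\<And>x. x \<in> set p \<Longrightarrow> x < W"
  shows "\<exists>R'. run 11 (st 59 R M os) = st 59 R' M (os @ [oriented (R 18) p ! R 21]) \<and>
    R' 21 = Suc (R 21) \<and> (\<forall>r\<in>{2, 3, 10, 11, 18, 19}. R' r = R r)"
proof -
  have lt: "R 19 - 1 - R 21 < W" "R 19 - 1 < W" "Suc (R 21) < W" "R 21 < W" using assms by auto
  have pW: "p ! i < W" if "i < length p" for i using assms(8) that by simp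
  consider "R 18 = 0" | "R 18 = 1" using assms by linarith
  then show ?thesis
  proof cases
    case 1
    then show ?thesis using assms lt pW
      by (simp add: sym_exec oriented_def)
  next
    case 2
    then have "oriented (R 18) p ! R 21 = p ! (length p - 1 - R 21)"
      using assms by (simp add: oriented_def rev_nth)
    then show ?thesis using assms lt pW 2
      by (simp add: sym_exec)
  qed
qed

lemma emit:
  assumes "R 2 = 0" "R 3 = 1" "R 18 \<le> 1" "R 21 \<le> R 19" "R 19 = length p" "R 19 < W"
    "\<And>i. i < length p \<Longrightarrow> M i = p ! i" "\<And>x. x \<in> set p \<Longrightarrow> x < W"
  shows "\<exists>R'. run (11 * (R 19 - R 21) + 1) (st 59 R M os) =
      st 60 R' M (os @ drop (R 21) (oriented (R 18) p)) \<and>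
    (\<forall>r\<in>{2, 3, 10, 11}. R' r = R r)"
  using assms
proof (induction "R 19 - R 21" arbitrary: R os)
  case 0
  then have "run 1 (st 59 R M os) = st 60 R M os" by (simp add: sym_exec)
  moreover have "drop (R 21) (oriented (R 18) p) = []" using 0 by (simp add: oriented_def)
  ultimately show ?case using 0 by (intro exI[of _ R]) simp
next
  case (Suc d)
  have lt: "R 21 < R 19" using Suc by simp
  obtain R1 where R1: "run 11 (st 59 R M os) = st 59 R1 M (os @ [oriented (R 18) p ! R 21])"
    "R1 21 = Suc (R 21)" "\<forall>r\<in>{2, 3, 10, 11, 18, 19}. R1 r = R r"
    using emit_one[OF Suc.prems(1,2,3) lt Suc.prems(5-8)] by blast
  have "\<exists>R'. run (11 * (R1 19 - R1 21) + 1) (st 59 R1 M (os @ [oriented (R 18) p ! R 21])) =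
      st 60 R' M ((os @ [oriented (R 18) p ! R 21]) @ drop (R1 21) (oriented (R1 18) p)) \<and>
    (\<forall>r\<in>{2, 3, 10, 11}. R' r = R1 r)"
    using Suc R1 lt by (intro Suc.hyps(1)) auto
  then obtain R' where k:
    "run (11 * (R1 19 - R1 21) + 1) (st 59 R1 M (os @ [oriented (R 18) p ! R 21])) =
      st 60 R' M ((os @ [oriented (R 18) p ! R 21]) @ drop (R1 21) (oriented (R1 18) p))"
    "\<forall>r\<in>{2, 3, 10, 11}. R' r = R1 r" by blast
  have "drop (R 21) (oriented (R 18) p) = oriented (R 18) p ! R 21 # drop (Suc (R 21)) (oriented (R
    18) p)"
    using lt Suc.prems(5) by (intro Cons_nth_drop_Suc[symmetric]) (simp add: oriented_def)
  then have d: "os @ drop (R 21) (oriented (R 18) p) =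
      (os @ [oriented (R 18) p ! R 21]) @ drop (R1 21) (oriented (R1 18) p)"
    using R1 by simp
  have e: "11 * (R 19 - R 21) + 1 = 11 + (11 * (R1 19 - R1 21) + 1)" using R1 Suc(2) by simp
  have "run (11 * (R 19 - R 21) + 1) (st 59 R M os) =
      st 60 R' M (os @ drop (R 21) (oriented (R 18) p))"
  proof -
    have "run (11 * (R 19 - R 21) + 1) (st 59 R M os) =
        run (11 * (R1 19 - R1 21) + 1) (run 11 (st 59 R M os))"
      unfolding e by (rule run_add)
    then show ?thesis unfolding R1(1) k(1) d .
  qed
  then show ?case using k R1 by (intro exI[of _ R']) auto
qed

lemma load_piece:
  assumes "R 2 = 0" "R 3 = 1" "0 < R 11" "R 10 + 7 < length D"
  shows "run 16 (st 24 R M os) = st 41 (R(12 := D ! R 10, 13 := D ! (R 10 + 1), 14 := D ! (R 10 +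
    2),
    15 := D ! (R 10 + 3), 16 := D ! (R 10 + 4), 17 := D ! (R 10 + 5), 18 := D ! (R 10 + 6),
    10 := R 10 + 7, 19 := 0)) M os"
proof -
  have "D ! R 10 < W" "D ! (R 10 + 1) < W" "D ! (R 10 + 2) < W" "D ! (R 10 + 3) < W"
    "D ! (R 10 + 4) < W" "D ! (R 10 + 5) < W" "D ! (R 10 + 6) < W"
    using assms by (auto intro!: D_less)
  moreover have "R 10 + 7 < W" using assms len_D by simp
  moreover have "Suc (Suc (Suc (R 10))) = R 10 + 3" "Suc (R 10 + 3) = R 10 + 4"
    "Suc (R 10 + 4) = R 10 + 5" "Suc (R 10 + 5) = R 10 + 6" "Suc (R 10 + 6) = R 10 + 7"
    by simp_all
  note e = this
  ultimately show ?thesis using assms W2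
    by (simp add: sym_exec fun_eq_iff e)
qed

text \<open>Generating and emitting cost \<open>12 + 11\<close> instructions per vertex; loading
  takes 16, and 4 more go to initialising the output counter, the last loop test and the
  return.\<close>

lemma do_piece:
  assumes R: "R 2 = 0" "R 3 = 1" "0 < R 11" "R 11 < W" and p: "piece W D (R 10) p"
  shows "\<exists>k R' M'. k \<le> 20 + 23 * length p \<and> run k (st 24 R M os) = st 24 R' M' (os @ p) \<and>
    R' 2 = 0 \<and> R' 3 = 1 \<and> R' 10 = R 10 + 7 \<and> R' 11 = R 11 - 1"
proof -
  obtain g where g: "R 10 + 7 < length D"
     "trace D (D ! (R 10 + 4)) (D ! (R 10 + 5)) (D ! (R 10 + 1)) (D ! (R 10 + 2)) g"
     "hd g = D ! R 10" "last g = D ! (R 10 + 3)" "distinct g" "\<forall>x\<in>set g. x < W" "length g < W"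
     "D ! (R 10 + 5) \<le> 1" "D ! (R 10 + 6) \<le> 1" "p = oriented (D ! (R 10 + 6)) g"
    using p unfolding piece_def by blast
  let ?R1 = "R(12 := D ! R 10, 13 := D ! (R 10 + 1), 14 := D ! (R 10 + 2),
    15 := D ! (R 10 + 3), 16 := D ! (R 10 + 4), 17 := D ! (R 10 + 5), 18 := D ! (R 10 + 6),
    10 := R 10 + 7, 19 := 0)"
  have 1: "run 16 (st 24 R M os) = st 41 ?R1 M os" using load_piece[OF R(1,2,3) g(1)] .
  have "\<exists>k R' M'. k \<le> 12 * length g \<and> run k (st 41 ?R1 M os) = st 58 R' M' os \<and>
     R' 19 = ?R1 19 + length g \<and> (\<forall>i<length g. M' (?R1 19 + i) = g ! i) \<and> (\<forall>a<?R1 19. M' a = M a) \<and>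
     (\<forall>r\<in>{2, 3, 10, 11, 18}. R' r = ?R1 r)"
    by (rule generate) (use g R in simp_all)
  then obtain k2 R2 M2 where 2: "k2 \<le> 12 * length g" "run k2 (st 41 ?R1 M os) = st 58 R2 M2 os"
    "R2 19 = length g" "\<forall>i<length g. M2 i = g ! i" "\<forall>r\<in>{2, 3, 10, 11, 18}. R2 r = ?R1 r"
    by auto
  let ?R3 = "R2(21 := 0)"
  have 3: "run 1 (st 58 R2 M2 os) = st 59 ?R3 M2 os" using W2 by (simp add: sym_exec)
  have "\<exists>R'. run (11 * (?R3 19 - ?R3 21) + 1) (st 59 ?R3 M2 os) =
      st 60 R' M2 (os @ drop (?R3 21) (oriented (?R3 18) g)) \<and>
    (\<forall>r\<in>{2, 3, 10, 11}. R' r = ?R3 r)"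
    by (rule emit) (use 2 g R in simp_all)
  then obtain R4 where 4: "run (11 * length g + 1) (st 59 ?R3 M2 os) = st 60 R4 M2 (os @ p)"
    "\<forall>r\<in>{2, 3, 10, 11}. R4 r = ?R3 r" using 2 g by auto
  have 5: "run 2 (st 60 R4 M2 (os @ p)) = st 24 (R4(11 := R 11 - 1)) M2 (os @ p)"
    using 4(2) 2(5) R by (simp add: sym_exec)
  have "run (16 + k2 + 1 + (11 * length g + 1) + 2) (st 24 R M os) = st 24 (R4(11 := R 11 - 1)) M2
    (os @ p)"
    using 1 2(2) 3 4(1) 5 by (simp only: run_add)
  moreover have "length p = length g" using g by (simp add: oriented_def)
  ultimately show ?thesis using 2 4 R
    by (rule_tac exI[of _ "16 + k2 + 1 + (11 * length g + 1) + 2"],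
        rule_tac exI[of _ "R4(11 := R 11 - 1)"], rule_tac exI[of _ M2]) simp
qed

lemma do_pieces:
  assumes "R 2 = 0" "R 3 = 1" "R 11 = length ps" "R 11 < W"
    "\<And>j. j < length ps \<Longrightarrow> piece W D (R 10 + 7 * j) (ps ! j)"
  shows "\<exists>k R' M'. k \<le> 2 + 20 * length ps + 23 * length (concat ps) \<and>
    run k (st 24 R M os) = st 72 R' M' (os @ concat ps)"
  using assms
proof (induction ps arbitrary: R M os)
  case Nil
  then have "run 2 (st 24 R M os) = st 72 R M os" by (simp add: sym_exec)
  then show ?case by (intro exI[of _ 2] exI) simp
next
  case (Cons p ps)
  have "piece W D (R 10) p" using Cons.prems(5)[of 0] by simp
  then obtain k1 R1 M1 where 1: "k1 \<le> 20 + 23 * length p"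
    "run k1 (st 24 R M os) = st 24 R1 M1 (os @ p)"
    "R1 2 = 0" "R1 3 = 1" "R1 10 = R 10 + 7" "R1 11 = R 11 - 1"
    using do_piece[of R p M os] Cons.prems by auto
  have "\<exists>k R' M'. k \<le> 2 + 20 * length ps + 23 * length (concat ps) \<and>
    run k (st 24 R1 M1 (os @ p)) = st 72 R' M' ((os @ p) @ concat ps)"
  proof (rule Cons.IH)
    fix j assume "j < length ps"
    then show "piece W D (R1 10 + 7 * j) (ps ! j)" using Cons.prems(5)[of "Suc j"] 1
      by (simp add: add.commute add.left_commute)
  qed (use 1 Cons.prems in auto)
  then obtain k2 R2 M2 where 2: "k2 \<le> 2 + 20 * length ps + 23 * length (concat ps)"
    "run k2 (st 24 R1 M1 (os @ p)) = st 72 R2 M2 ((os @ p) @ concat ps)" by blast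
  have "run (k1 + k2) (st 24 R M os) = st 72 R2 M2 (os @ concat (p # ps))"
    using 1 2 by (simp add: run_add)
  then show ?case using 1 2
    by (rule_tac exI[of _ "k1 + k2"], rule_tac exI[of _ R2], rule_tac exI[of _ M2]) simp
qed

text \<open>The lookup, which also outputs \<open>u\<close>, takes 24 instructions, and the test
  that ends the program takes 2.\<close>

lemma query_answers:
  assumes key: "u * D ! 0 + v < W" and len: "3 \<le> length D"
    and h: "h = (D ! 1 * (u * D ! 0 + v) mod W) div D ! 2" and bucket: "5 + 3 * h < length D"
    and idx: "i = D ! (5 + 3 * h) + (D ! (3 + 3 * h) * (u * D ! 0 + v) mod W) div D ! (4 + 3 * h)"
    and rec: "i < length D" "Suc (D ! i) < length D" "D ! (D ! i) = length ps"
    and pieces: "\<And>j. j < length ps \<Longrightarrow> piece W D (Suc (D ! i) + 7 * j) (ps ! j)"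
  shows "\<exists>t. answers W D query u v t (u # concat ps) \<and>
    t \<le> 26 + 20 * length ps + 23 * length (concat ps)"
proof -
  let ?key = "u * D ! 0 + v"
  let ?R0 = "(\<lambda>_. 0)(0 := u, 1 := v) :: nat \<Rightarrow> nat"
  have un: "u * D ! 0 < W" using key by simp
  have d: "D ! 0 < W" "D ! 1 < W" "D ! 2 < W" "D ! (3 + 3 * h) < W" "D ! (4 + 3 * h) < W"
    "D ! (5 + 3 * h) < W"
    "D ! i < W"
    using len bucket rec by (auto intro!: D_less)
  have w: "1 < W" "2 < W" "3 < W" "3 * h < W" "h < W" "3 + 3 * h < W" "4 + 3 * h < W"
    "5 + 3 * h < W" "i < W"
    "Suc (D ! i) < W"
    using len_D len bucket rec by auto
  have lps: "length ps < W" using D_less[of "D ! i"] rec by simp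
  have ne: "D \<noteq> []" using len by auto
  define x where "x = (D ! (3 + 3 * h) * ?key mod W) div D ! (4 + 3 * h)"
  have x: "i = D ! (5 + 3 * h) + x" "x < W" using idx w(9) by (auto simp: x_def)
  have "query_start u v = st 0 ?R0 (\<lambda>_. 0) []" by (simp add: query_start_def)
  moreover have "run 12 (st 0 ?R0 (\<lambda>_. 0) []) = st 12 (?R0(3 := 1, 4 := D ! 0, 5 := ?key,
     6 := 3 + 3 * h, 7 := 3, 8 := D ! 2)) (\<lambda>_. 0) []"
    using d(1-3) w(1-8) key un len ne h[symmetric]
    by (simp add: sym_exec fun_eq_iff add.commute mult.commute)
  moreover have "run 12 (st 12 (?R0(3 := 1, 4 := D ! 0, 5 := ?key,
     6 := 3 + 3 * h, 7 := 3, 8 := D ! 2)) (\<lambda>_. 0) []) = st 24 (?R0(3 := 1, 4 := D ! 0, 5 := ?key,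
     6 := i, 7 := 3, 8 := x, 9 := D ! (4 + 3 * h), 10 := Suc (D ! i), 11 := length ps)) (\<lambda>_. 0) [u]"
    using d w lps bucket rec x(2) x(1)[symmetric] x_def[symmetric]
    by (simp add: sym_exec fun_eq_iff)
  ultimately have start: "run (12 + 12) (query_start u v) = st 24 (?R0(3 := 1, 4 := D ! 0, 5 :=
    ?key,
     6 := i, 7 := 3, 8 := x, 9 := D ! (4 + 3 * h), 10 := Suc (D ! i), 11 := length ps)) (\<lambda>_. 0) [u]"
    (is "_ = st 24 ?R _ _") by (simp only: run_add)
  have "\<exists>k R' M'. k \<le> 2 + 20 * length ps + 23 * length (concat ps) \<and>
    run k (st 24 ?R (\<lambda>_. 0) [u]) = st 72 R' M' ([u] @ concat ps)"
    by (rule do_pieces) (use pieces lps in simp_all)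
  then obtain k R' M' where k: "k \<le> 2 + 20 * length ps + 23 * length (concat ps)"
    "run k (st 24 ?R (\<lambda>_. 0) [u]) = st 72 R' M' ([u] @ concat ps)" by blast
  have "run (12 + 12 + k) (query_start u v) = st 72 R' M' ([u] @ concat ps)"
    using start k(2) by (simp only: run_add)
  then have "answers W D query u v (12 + 12 + k) (u # concat ps)"
    by (simp only: answers_def Let_def length_query) simp
  then show ?thesis using k(1) by (intro exI[of _ "12 + 12 + k"]) simp
qed

end

section \<open>The stored data\<close>

lemma allocate:
  fixes sz :: "'a \<Rightarrow> nat"
  assumes "finite B"
  shows "\<exists>off. (\<forall>i\<in>B. base \<le> off i \<and> off i + sz i \<le> base + sum sz B) \<and>
    (\<forall>i\<in>B. \<forall>j\<in>B. i \<noteq> j \<longrightarrow> off i + sz i \<le> off j \<or> off j + sz j \<le> off i)"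
  using assms
proof (induction B rule: finite_induct)
  case (insert b B)
  then obtain off where off: "\<And>i. i \<in> B \<Longrightarrow> base \<le> off i \<and> off i + sz i \<le> base + sum sz B"
    "\<And>i j. i \<in> B \<Longrightarrow> j \<in> B \<Longrightarrow> i \<noteq> j \<Longrightarrow> off i + sz i \<le> off j \<or> off j + sz j \<le> off i"
    by auto
  let ?off = "off(b := base + sum sz B)"
  have "base \<le> ?off i \<and> ?off i + sz i \<le> base + sum sz (insert b B)" if "i \<in> insert b B" for i
    using off(1)[of i] that insert by (cases "i = b") (auto intro: trans_le_add2 simp: add.commute
      add.left_commute)
  moreover have "?off i + sz i \<le> ?off j \<or> ?off j + sz j \<le> ?off i"
    if "i \<in> insert b B" "j \<in> insert b B" "i \<noteq> j" for i j
    using off that insert by auto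
  ultimately show ?case by blast
qed auto

lemma fill:
  fixes sz :: "'a \<Rightarrow> nat" and c :: "'a \<Rightarrow> nat \<Rightarrow> nat"
  assumes off: "\<And>i. i \<in> B \<Longrightarrow> base \<le> off i \<and> off i + sz i \<le> base + sum sz B"
    "\<And>i j. i \<in> B \<Longrightarrow> j \<in> B \<Longrightarrow> i \<noteq> j \<Longrightarrow> off i + sz i \<le> off j \<or> off j + sz j \<le> off i"
    and h: "\<And>a. a < base \<Longrightarrow> h a < W" and c: "\<And>i k. i \<in> B \<Longrightarrow> k < sz i \<Longrightarrow> c i k < W" and W: "0 < W"
  shows "\<exists>D. length D = base + sum sz B \<and> (\<forall>a<base. D ! a = h a) \<and>
    (\<forall>i\<in>B. \<forall>k<sz i. D ! (off i + k) = c i k) \<and> (\<forall>x\<in>set D. x < W)"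
proof -
  \<comment> \<open>\<open>Q a x\<close> says that some block wants \<open>x\<close> at address
    \<open>a\<close>. Disjointness makes \<open>x\<close> unique, so the choice in \<open>F\<close>
    returns it; addresses that no block claims hold 0.\<close>
  define Q where "Q = (\<lambda>a x. \<exists>i k. i \<in> B \<and> k < sz i \<and> a = off i + k \<and> x = c i k)"
  define F where "F = (\<lambda>a. if a < base then h a else if \<exists>x. Q a x then (SOME x. Q a x) else
    (0::nat))"
  define D where "D = map F [0..<base + sum sz B]"
  have unique: "x = c i k" if q: "Q (off i + k) x" and ik: "i \<in> B" "k < sz i" for x i k
  proof -
    obtain i' k' where "i' \<in> B" "k' < sz i'" "off i + k = off i' + k'" "x = c i' k'"
      using q unfolding Q_def by blast
    then show ?thesis using off(2)[of i i'] ik by (cases "i = i'") auto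
  qed
  have "D ! (off i + k) = c i k" if "i \<in> B" "k < sz i" for i k
  proof -
    have q: "Q (off i + k) (c i k)" using that by (auto simp: Q_def)
    then have "(SOME x. Q (off i + k) x) = c i k" using unique that by (metis someI)
    moreover have "\<not> off i + k < base" "off i + k < base + sum sz B"
      using off(1)[OF that(1)] that by auto
    ultimately show ?thesis using q by (auto simp: D_def F_def)
  qed
  moreover have "F a < W" for a
  proof -
    have "(SOME x. Q a x) < W" if "\<exists>x. Q a x" using someI_ex[OF that] c by (auto simp: Q_def)
    then show ?thesis using h W by (simp add: F_def)
  qed
  then have "\<forall>x\<in>set D. x < W" by (auto simp: D_def)
  moreover have "length D = base + sum sz B" "\<forall>a<base. D ! a = h a" by (auto simp: D_def F_def)
  ultimately show ?thesis by blast
qed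

lemma sum_Un_le: "finite A \<Longrightarrow> finite B \<Longrightarrow> sum f (A \<union> B) \<le> sum f A + sum f (B :: 'a set)" for f ::
  "'a \<Rightarrow> nat"
  using sum.union_inter[of A B f] by simp

lemma sum_UN_le:
  fixes f :: "'a \<Rightarrow> nat"
  assumes "finite I" "\<And>i. i \<in> I \<Longrightarrow> finite (A i)"
  shows "sum f (\<Union>i\<in>I. A i) \<le> (\<Sum>i\<in>I. sum f (A i))"
  using assms
proof (induction I rule: finite_induct)
  case (insert i I)
  have "sum f (A i \<union> (\<Union>i\<in>I. A i)) \<le> sum f (A i) + sum f (\<Union>i\<in>I. A i)"
    using insert by (intro sum_Un_le) auto
  then show ?case using insert by fastforce
qed auto

lemma sum_image_le_nat:
  fixes f :: "'b \<Rightarrow> nat"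
  shows "finite I \<Longrightarrow> sum f (g ` I) \<le> (\<Sum>i\<in>I. f (g i))"
  using sum_image_le[of I f g] by simp

lemma filter_upt_nth:
  assumes "P s" "s < N"
  shows "length (filter P [0..<s]) < length (filter P [0..<N])"
    and "filter P [0..<N] ! length (filter P [0..<s]) = s"
proof -
  have "[0..<N] = [0..<s] @ s # [Suc s..<N]" using assms(2)
    by (metis less_imp_add_positive upt_add_eq_append upt_conv_Cons zero_le)
  then have "filter P [0..<N] = filter P [0..<s] @ s # filter P [Suc s..<N]" using assms(1) by simp
  then show "length (filter P [0..<s]) < length (filter P [0..<N])"
    "filter P [0..<N] ! length (filter P [0..<s]) = s" by auto
qed

datatype block =
    Buckets nat
  | Half_Table nat
  | Up_Table nat
  | Exceptions nat nat nat
  | Record nat nat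

section \<open>Contents of the tables and the pieces read from them\<close>

context hierarchy
begin

text \<open>Here the first vertex of each piece is dropped, whereas \<open>glue\<close> drops the
  last: the program outputs \<open>u\<close> at the start, and every piece then begins with the
  successor of a vertex already written.\<close>

fun pieces :: "nat list \<Rightarrow> nat list list" where
  "pieces (a # b # q) = tl (\<pi> a b) # pieces (b # q)"
| "pieces _ = []"

lemma length_pieces: "length (pieces q) = length q - 1"
  by (induction q rule: pieces.induct) auto

lemma nth_pieces: "j < length q - 1 \<Longrightarrow> pieces q ! j = tl (\<pi> (q ! j) (q ! Suc j))"
proof (induction q arbitrary: j rule: pieces.induct)
  case (1 a b q)
  then show ?case by (cases j) auto
qed auto

lemma glue_pieces: "successively seg q \<Longrightarrow> q \<noteq> [] \<Longrightarrow> glue q = hd q # concat (pieces q)"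
proof (induction q rule: pieces.induct)
  case (1 a b q)
  have c: "conn n E a b" using 1 by (simp add: seg_def)
  have "\<pi> a b = butlast (\<pi> a b) @ [b]" using \<pi>_path(1,3)[OF c] append_butlast_last_id by metis
  then have "butlast (\<pi> a b) @ b # r = \<pi> a b @ r" for r
    by (metis append.assoc append_Cons append_Nil)
  moreover have "\<pi> a b = a # tl (\<pi> a b)" using \<pi>_path(1,2)[OF c] by (metis list.collapse)
  ultimately show ?case using 1 by simp
qed auto

text \<open>The shift by one reserves the entry 0 for special vertices.\<close>

definition rule_half :: "nat \<Rightarrow> nat \<Rightarrow> nat" where
  "rule_half i z = (if special i z then 0 else 1 + \<Sum>(nbr i z))"

definition rule_up :: "nat \<Rightarrow> nat \<Rightarrow> nat" where
  "rule_up i z = (if next_up i z < n then 1 + next_up i z else 0)"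

definition exceptions :: "nat \<Rightarrow> nat \<Rightarrow> nat \<Rightarrow> nat list" where
  "exceptions i x y = map (\<lambda>j. \<pi> x y ! Suc j) (filter (\<lambda>j. special i (\<pi> x y ! j)) [0..<length (\<pi> x
    y) - 1])"

text \<open>The tables of all levels at or above \<open>n\<close> would be empty, and leaving them out keeps all
  addresses polynomial in \<open>n\<close>.\<close>

definition levels :: "nat set" where
  "levels = {i. i \<le> l \<and> i < n}"

definition tables_stored :: "(block \<Rightarrow> nat) \<Rightarrow> nat list \<Rightarrow> bool" where
  "tables_stored off D \<longleftrightarrow>
     (\<forall>i\<in>levels. \<forall>z<n. off (Half_Table i) + z < length D \<and>
       D ! (off (Half_Table i) + z) = rule_half i z) \<and>
     (\<forall>i\<in>levels. \<forall>z<n. off (Up_Table i) + z < length D \<and> D ! (off (Up_Table i) + z) = rule_up i z) \<and>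
     (\<forall>i\<in>levels. \<forall>(x, y)\<in>half i. \<forall>k<length (exceptions i x y).
        off (Exceptions i x y) + k < length D \<and> D ! (off (Exceptions i x y) + k) = exceptions i x y
          ! k)"

text \<open>A piece may begin inside the path of a hop, so the exception address skips one word for
  every special vertex passed before. \<open>0 < s\<close> guarantees a predecessor on the
  path.\<close>

lemma trace_half:
  assumes D: "tables_stored off D" and i: "i \<in> levels" and xy: "(x, y) \<in> half i"
    and s: "0 < s" "s \<le> e" "e < length (\<pi> x y)"
  shows "trace D (off (Half_Table i)) 1 (\<pi> x y ! (s - 1))
    (off (Exceptions i x y) + length (filter (\<lambda>j. special i (\<pi> x y ! j)) [0..<s]))
    (map ((!) (\<pi> x y)) [s..<Suc e])"
  using s(2,1)
proof (induction s rule: inc_induct)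
  case base
  then show ?case by simp
next
  case (step s)
  let ?p = "\<pi> x y"
  let ?sp = "\<lambda>j. special i (?p ! j)"
  have c: "conn n E x y" using half_conn[OF xy] .
  have L: "Suc s < length ?p" "s < length ?p - 1" using step s by auto
  have "?p ! s \<in> set ?p" using L by simp
  then have lt: "?p ! s < n" using \<pi>_path(5)[OF c] by auto
  have tab: "off (Half_Table i) + ?p ! s < length D"
    "D ! (off (Half_Table i) + ?p ! s) = rule_half i (?p ! s)"
    using D i lt by (auto simp: tables_stored_def)
  have IH: "trace D (off (Half_Table i)) 1 (?p ! s)
    (off (Exceptions i x y) + length (filter ?sp [0..<Suc s])) (map ((!) ?p) [Suc s..<Suc e])"
    using step by simp
  have l1: "[s..<Suc e] = s # Suc s # [Suc (Suc s)..<Suc e]"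
    "[Suc s..<Suc e] = Suc s # [Suc (Suc s)..<Suc e]"
    using step by (simp_all add: upt_conv_Cons del: upt_Suc)
  show ?case
  proof (cases "special i (?p ! s)")
    case True
    let ?k = "length (filter ?sp [0..<s])"
    have k: "?k < length (exceptions i x y)" "exceptions i x y ! ?k = ?p ! Suc s"
      using filter_upt_nth[of ?sp s "length ?p - 1", OF True L(2)] by (simp_all add: exceptions_def)
    then have "off (Exceptions i x y) + ?k < length D"
      "D ! (off (Exceptions i x y) + ?k) = ?p ! Suc s"
      using D i xy by (fastforce simp: tables_stored_def)+
    moreover have "length (filter ?sp [0..<Suc s]) = Suc ?k" using True by simp
    moreover have "rule_half i (?p ! s) = 0" using True by (simp add: rule_half_def)
    ultimately show ?thesis using IH tab unfolding l1 by (simp del: upt_Suc)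
  next
    case False
    have "0 < s" using step by simp
    note nb = nbr_along[OF xy this L(1) False]
    have "rule_half i (?p ! s) = 1 + (?p ! (s - 1) + ?p ! Suc s)" using False nb
      by (simp add: rule_half_def)
    moreover have "length (filter ?sp [0..<Suc s]) = length (filter ?sp [0..<s])"
      using False by simp
    ultimately show ?thesis using IH tab unfolding l1 by (simp del: upt_Suc)
  qed
qed

lemma trace_up:
  assumes D: "tables_stored off D" and i: "i \<in> levels" and xy: "(x, y) \<in> up i"
    and s: "s \<le> e" "e < length (\<pi> x y)"
  shows "trace D (off (Up_Table i)) 0 0 q (map ((!) (\<pi> x y)) [s..<Suc e])"
  using s(1)
proof (induction s rule: inc_induct)
  case base
  then show ?case by simp
next
  case (step s)
  let ?p = "\<pi> x y"
  have c: "conn n E x y" using up_conn[OF xy] .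
  have L: "Suc s < length ?p" using step s by auto
  have "?p ! s \<in> set ?p" "?p ! Suc s \<in> set ?p" using L by simp_all
  then have lt: "?p ! s < n" "?p ! Suc s < n" using \<pi>_path(5)[OF c] by auto
  have tab: "off (Up_Table i) + ?p ! s < length D"
    "D ! (off (Up_Table i) + ?p ! s) = rule_up i (?p ! s)"
    using D i lt by (auto simp: tables_stored_def)
  have "rule_up i (?p ! s) = 1 + ?p ! Suc s" using next_up_along[OF xy L] lt
    by (simp add: rule_up_def)
  moreover have l1: "[s..<Suc e] = s # Suc s # [Suc (Suc s)..<Suc e]"
    "[Suc s..<Suc e] = Suc s # [Suc (Suc s)..<Suc e]"
    using step by (simp_all add: upt_conv_Cons del: upt_Suc)
  ultimately show ?case using step.IH tab unfolding l1 by (simp del: upt_Suc)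
qed

lemma sublist_nth:
  assumes "conn n E x y" "sublist (\<pi> a b) (\<pi> x y)" "conn n E a b" "a \<noteq> b"
  obtains s e where "s < e" "e < length (\<pi> x y)" "\<pi> a b = map ((!) (\<pi> x y)) [s..<Suc e]"
    "\<pi> x y ! s = a" "\<pi> x y ! e = b"
proof -
  obtain p1 p2 where p: "\<pi> x y = p1 @ \<pi> a b @ p2" using assms(2) by (auto simp: sublist_def)
  let ?s = "length p1" and ?e = "length p1 + length (\<pi> a b) - 1"
  have "2 \<le> length (\<pi> a b)" using \<pi>_path(1,2,3)[OF assms(3)] assms(4)
    by (cases "\<pi> a b" rule: edge_set.cases) (auto split: if_splits)
  then have se: "?s < ?e" "?e < length (\<pi> x y)" "Suc ?e = length p1 + length (\<pi> a b)"
    using p by auto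
  have m: "\<pi> a b = map ((!) (\<pi> x y)) [?s..<Suc ?e]"
    unfolding se(3) by (rule nth_equalityI) (auto simp: p nth_append)
  have "hd (\<pi> a b) = \<pi> x y ! ?s"
    using arg_cong[OF m, of hd] se by (simp add: hd_map del: upt_Suc)
  moreover have "last (\<pi> a b) = \<pi> x y ! ?e"
    using arg_cong[OF m, of last] se by simp
  ultimately show thesis using that[OF se(1,2) m] \<pi>_path(2,3)[OF assms(3)] by simp
qed

text \<open>The seven words have to be chosen before the array exists, so they must work for every
  array that stores the tables at the given addresses.\<close>

definition answers_piece :: "nat \<Rightarrow> (block \<Rightarrow> nat) \<Rightarrow> nat \<Rightarrow> nat \<Rightarrow> (nat \<Rightarrow> nat) \<Rightarrow> bool" where
  "answers_piece W off a b f \<longleftrightarrow> (\<forall>k<7. f k < W) \<and>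
     (\<forall>D r. tables_stored off D \<and> r + 7 < length D \<and> (\<forall>k<7. D ! (r + k) = f k) \<longrightarrow>
        piece W D r (tl (\<pi> a b)))"

lemma answers_pieceI:
  assumes "f0 < W" "f1 < W" "f2 < W" "f3 < W" "f4 < W" "f5 \<le> 1" "f6 \<le> 1" "2 \<le> W"
    and "\<And>D. tables_stored off D \<Longrightarrow> trace D f4 f5 f1 f2 g"
    and "hd g = f0" "last g = f3" "distinct g" "set g \<subseteq> {..<n}" "n < W" "tl (\<pi> a b) = oriented f6 g"
  shows "\<exists>f. answers_piece W off a b f"
proof -
  let ?f = "(!) [f0, f1, f2, f3, f4, f5, f6]"
  have *: "(\<forall>k<7. P k) \<longleftrightarrow> P 0 \<and> P 1 \<and> P 2 \<and> P 3 \<and> P 4 \<and> P 5 \<and> P 6" for P :: "nat \<Rightarrow> bool"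
    by (simp add: numeral_eq_Suc All_less_Suc conj_commute conj_left_commute)
  have len: "length g < W"
    using assms(12-14) card_mono[of "{..<n}" "set g"] distinct_card[of g] by auto
  have "answers_piece W off a b ?f"
    unfolding answers_piece_def
  proof (intro conjI allI impI)
    have "\<forall>k<7. ?f k < W" unfolding * using assms(1-8) by simp
    then show "k < 7 \<Longrightarrow> ?f k < W" for k by blast
  next
    fix D r assume D: "tables_stored off D \<and> r + 7 < length D \<and> (\<forall>k<7. D ! (r + k) = ?f k)"
    then have "D ! r = f0 \<and> D ! (r + 1) = f1 \<and> D ! (r + 2) = f2 \<and> D ! (r + 3) = f3 \<and>
      D ! (r + 4) = f4 \<and> D ! (r + 5) = f5 \<and> D ! (r + 6) = f6" unfolding * by simp
    then show "piece W D r (tl (\<pi> a b))"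
      using D assms len unfolding piece_def by (intro exI[of _ g]) auto
  qed
  then show ?thesis by blast
qed

lemma half_levels: "(x, y) \<in> half i \<Longrightarrow> i \<le> l \<Longrightarrow> (\<And>i. n \<le> i \<Longrightarrow> A i = {}) \<Longrightarrow> i \<in> levels"
  unfolding levels_def half_def by (auto simp: not_less[symmetric])

lemma up_levels: "(x, y) \<in> up i \<Longrightarrow> i \<le> l \<Longrightarrow> (\<And>i. n \<le> i \<Longrightarrow> A i = {}) \<Longrightarrow> i \<in> levels"
  unfolding levels_def up_def by (auto simp: not_less[symmetric])

lemma seg_answers_piece:
  assumes ab: "seg a b" and A: "\<And>i. n \<le> i \<Longrightarrow> A i = {}" and W: "2 \<le> W" "n < W"
    and off: "\<And>i. i \<in> levels \<Longrightarrow> off (Half_Table i) < W \<and> off (Up_Table i) < W"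
    "\<And>i x y. i \<in> levels \<Longrightarrow> (x, y) \<in> half i \<Longrightarrow> off (Exceptions i x y) + length (exceptions i x y) < W"
  shows "\<exists>f. answers_piece W off a b f"
proof -
  have c: "conn n E a b" "a \<noteq> b" using ab by (auto simp: seg_def)
  have lt: "a < n" "b < n" "a < W" "b < W" using conn_less[OF c(1)] W by auto
  from ab show ?thesis
  proof (cases rule: seg_cases)
    case edge
    \<comment> \<open>The piece is the single vertex \<open>b\<close>: first and last coincide, so
      the loop stops before it consults any table.\<close>
    show ?thesis
      by (rule answers_pieceI[of b W 0 0 b 0 0 0 off
        "[b]"]) (use edge W lt in \<open>auto simp: oriented_def\<close>)
  next
    case (half i x y)
    have i: "i \<in> levels" using half_levels[OF half(2,1) A] .
    let ?p = "\<pi> x y"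
    have cxy: "conn n E x y" using half_conn[OF half(2)] .
    obtain s e where se: "s < e" "e < length ?p" "\<pi> a b = map ((!) ?p) [s..<Suc e]" "?p ! s = a"
      "?p ! e = b"
      using sublist_nth[OF cxy half(3) c] .
    have tl: "tl (\<pi> a b) = map ((!) ?p) [Suc s..<Suc e]"
      unfolding se(3) using se(1) by (simp add: upt_conv_Cons[of s] del: upt_Suc)
    let ?q = "off (Exceptions i x y) + length (filter (\<lambda>j. special i (?p ! j)) [0..<Suc s])"
    have in_n: "?p ! j < n" if "j < length ?p" for j
      using that \<pi>_path(5)[OF cxy] nth_mem by blast
    have q: "?q < W"
    proof -
      have "length (filter (\<lambda>j. special i (?p ! j)) [0..<Suc s]) \<le> length (exceptions i x y)"
      proof -
        have "[0..<length ?p - 1] = [0..<Suc s] @ [Suc s..<length ?p - 1]"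
          using se by (metis Suc_leI less_diff_conv add.commute plus_1_eq_Suc le_less_trans
            upt_add_eq_append zero_le le_add_diff_inverse Suc_le_eq)
        then show ?thesis by (simp add: exceptions_def del: upt_Suc)
      qed
      then show ?thesis using off(2)[OF i half(2)] by linarith
    qed
    show ?thesis
    proof (rule answers_pieceI[of "?p ! Suc s" W a ?q b "off (Half_Table i)" 1 0 off "tl (\<pi> a b)"])
      show "?p ! Suc s < W" using in_n[of "Suc s"] se W by simp
      show "off (Half_Table i) < W" using off(1)[OF i] by simp
      show "trace D (off (Half_Table i)) 1 a ?q (tl (\<pi> a b))" if "tables_stored off D" for D
        using trace_half[OF that i half(2), of "Suc s" e] se unfolding tl by simp
      show "hd (tl (\<pi> a b)) = ?p ! Suc s"
        unfolding tl using se by (simp add: upt_conv_Cons del: upt_Suc)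
      show "last (tl (\<pi> a b)) = b" unfolding tl using se by simp
      show "distinct (tl (\<pi> a b))" using \<pi>_path(4)[OF c(1)] by (rule distinct_tl)
      show "set (tl (\<pi> a b)) \<subseteq> {..<n}" using \<pi>_path(5)[OF c(1)]
        by (meson list.set_sel(2) subset_iff subsetI \<pi>_path(1)[OF c(1)])
    qed (use W lt q in \<open>auto simp: oriented_def\<close>)
  next
    case (up i x y)
    have i: "i \<in> levels" using up_levels[OF up(2,1) A] .
    let ?p = "\<pi> x y"
    have cxy: "conn n E x y" using up_conn[OF up(2)] .
    obtain s e where se: "s < e" "e < length ?p" "\<pi> a b = map ((!) ?p) [s..<Suc e]" "?p ! s = a"
      "?p ! e = b"
      using sublist_nth[OF cxy up(3) c] .
    have tl: "tl (\<pi> a b) = map ((!) ?p) [Suc s..<Suc e]"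
      unfolding se(3) using se(1) by (simp add: upt_conv_Cons[of s] del: upt_Suc)
    have in_n: "?p ! j < n" if "j < length ?p" for j
      using that \<pi>_path(5)[OF cxy] nth_mem by blast
    show ?thesis
    proof (rule answers_pieceI[of "?p ! Suc s" W 0 0 b "off (Up_Table i)" 0 0 off "tl (\<pi> a b)"])
      show "?p ! Suc s < W" using in_n[of "Suc s"] se W by simp
      show "off (Up_Table i) < W" using off(1)[OF i] by simp
      show "trace D (off (Up_Table i)) 0 0 0 (tl (\<pi> a b))" if "tables_stored off D" for D
        using trace_up[OF that i up(2), of "Suc s" e] se unfolding tl by simp
      show "hd (tl (\<pi> a b)) = ?p ! Suc s"
        unfolding tl using se by (simp add: upt_conv_Cons del: upt_Suc)
      show "last (tl (\<pi> a b)) = b" unfolding tl using se by simp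
      show "distinct (tl (\<pi> a b))" using \<pi>_path(4)[OF c(1)] by (rule distinct_tl)
      show "set (tl (\<pi> a b)) \<subseteq> {..<n}" using \<pi>_path(5)[OF c(1)]
        by (meson list.set_sel(2) subset_iff subsetI \<pi>_path(1)[OF c(1)])
    qed (use W lt in \<open>auto simp: oriented_def\<close>)
  next
    case (down i x y)
    have i: "i \<in> levels" using up_levels[OF down(2,1) A] .
    let ?p = "\<pi> x y" and ?g = "butlast (\<pi> b a)"
    have cxy: "conn n E x y" using up_conn[OF down(2)] .
    have cba: "conn n E b a" using conn_sym[OF c(1)] .
    obtain s e where se: "s < e" "e < length ?p" "\<pi> b a = map ((!) ?p) [s..<Suc e]" "?p ! s = b"
      "?p ! e = a"
      using sublist_nth[OF cxy down(3) cba] c(2) by metis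
    obtain e' where e': "e = Suc e'" using se(1) by (cases e) auto
    have g: "?g = map ((!) ?p) [s..<Suc e']" unfolding se(3) e' using se(1) e'
      by (simp add: butlast_append)
    have in_n: "?p ! j < n" if "j < length ?p" for j
      using that \<pi>_path(5)[OF cxy] nth_mem by blast
    show ?thesis
    \<comment> \<open>Parent pointers lead only upwards, so the piece is generated from
      \<open>b\<close> to the vertex before \<open>a\<close> and then output in reverse.\<close>
    proof (rule answers_pieceI[of b W 0 0 "?p ! e'" "off (Up_Table i)" 0 1 off ?g])
      show "?p ! e' < W" using in_n[of e'] se W e' by simp
      show "off (Up_Table i) < W" using off(1)[OF i] by simp
      show "trace D (off (Up_Table i)) 0 0 0 ?g" if "tables_stored off D" for D
        using trace_up[OF that i down(2), of s e'] se e' unfolding g by simp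
      show "hd ?g = b" unfolding g using se e' by (simp add: upt_conv_Cons del: upt_Suc)
      show "last ?g = ?p ! e'" unfolding g using se e' by simp
      show "distinct ?g" using \<pi>_path(4)[OF cba] by (rule distinct_butlast)
      show "set ?g \<subseteq> {..<n}" using \<pi>_path(5)[OF cba] in_set_butlastD by fast
      show "tl (\<pi> a b) = oriented 1 ?g"
        using symmetric[OF cba] by (simp add: oriented_def butlast_rev rev_swap)
          (metis butlast_rev rev_rev_ident)
    qed (use W lt in auto)
  qed
qed

end

section \<open>Size bounds and assembly of the data structure\<close>

context hierarchy
begin

lemma length_exceptions:
  assumes "(x, y) \<in> half i"
  shows "length (exceptions i x y) \<le> card {z \<in> set (\<pi> x y). special i z}"
proof -
  let ?p = "\<pi> x y"
  let ?J = "{j. j < length ?p - 1 \<and> special i (?p ! j)}"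
  have "length (exceptions i x y) = card ?J"
    unfolding exceptions_def using distinct_card[of
      "filter (\<lambda>j. special i (?p ! j)) [0..<length ?p - 1]"]
    by (simp add: conj_commute)
  also have "\<dots> = card ((!) ?p ` ?J)"
  proof (rule card_image[symmetric])
    show "inj_on ((!) ?p) ?J" using \<pi>_path(4)[OF half_conn[OF assms]]
      by (auto intro!: inj_onI simp: nth_eq_iff_index_eq)
  qed
  also have "\<dots> \<le> card {z \<in> set ?p. special i z}" by (intro card_mono) auto
  finally show ?thesis .
qed

lemma sum_exceptions: "(\<Sum>(x, y)\<in>half i. length (exceptions i x y)) \<le> 4 * cube i"
proof -
  have "(\<Sum>(x, y)\<in>half i. length (exceptions i x y)) \<le> (\<Sum>(x, y)\<in>half i. card {z \<in> set (\<pi> x y).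
    special i z})"
    using length_exceptions by (intro sum_mono) auto
  also have "\<dots> = card (incidences i)"
    unfolding incidences_def using finite_half
    by (subst card_SigmaI) (auto simp: case_prod_beta)
  finally show ?thesis using card_incidences(2)[of i] by simp
qed

text \<open>A crude bound, good enough to make addresses fit into words.\<close>

lemma cube_le: "cube i \<le> n ^ 4"
proof -
  have c: "card (A i) \<le> n" "card (bun i x) \<le> n" for x
  proof -
    have "A i \<subseteq> {..<n}" "bun i x \<subseteq> {..<n}" using A_less by (auto simp: bun_iff)
    from card_mono[OF _ this(1)] card_mono[OF _ this(2)]
    show "card (A i) \<le> n" "card (bun i x) \<le> n" by simp_all
  qed
  have "cube i \<le> (\<Sum>x\<in>A i. n ^ 3)" unfolding cube_def using c by (intro sum_mono power_mono) auto
  also have "\<dots> \<le> n * n ^ 3" using c(1) by simp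
  finally show ?thesis by (simp add: power_eq_if)
qed

lemma rule_half_le: "rule_half i z \<le> 1 + 2 * n"
proof (cases "special i z")
  case False
  have "\<Sum>(nbr i z) \<le> card (nbr i z) * n"
    using sum_bounded_above[of "nbr i z" "\<lambda>x. x" n] half_edges_less
    by (force simp: nbr_def dest: less_imp_le)
  also have "\<dots> \<le> 2 * n" using False by (intro mult_right_mono) (auto simp: special_def)
  finally show ?thesis using False by (simp add: rule_half_def)
qed (simp add: rule_half_def)

lemma rule_up_le: "rule_up i z \<le> n"
  by (simp add: rule_up_def)

definition goodq :: "nat \<Rightarrow> nat \<Rightarrow> nat list \<Rightarrow> bool" where
  "goodq u v q \<longleftrightarrow> q \<noteq> [] \<and> successively seg q \<and> hd q = u \<and> last q = v \<and> set q \<subseteq> {..<n} \<and>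
    distinct (glue q)"

text \<open>The glued path is simple and at least as long as its list of breakpoints, so there are
  at most \<open>n\<close> of these.\<close>

lemma goodq_length: "goodq u v q \<Longrightarrow> length q \<le> n"
proof -
  assume q: "goodq u v q"
  have "length q \<le> length (glue q)" using q length_glue by (simp add: goodq_def)
  also have "\<dots> = card (set (glue q))" using q by (simp add: goodq_def distinct_card)
  also have "\<dots> \<le> card {..<n}" using q set_glue by (intro card_mono) (auto simp: goodq_def)
  finally show ?thesis by simp
qed

lemma data_structure:
  fixes W :: nat and P :: "(nat \<times> nat) set" and Q :: "nat \<Rightarrow> nat \<Rightarrow> nat list"
  assumes n: "0 < n" and A: "\<And>i. n \<le> i \<Longrightarrow> A i = {}" and W: "(n + 1) ^ 12 \<le> W"
    and P: "P \<subseteq> {..<n} \<times> {..<n}" and Q: "\<And>u v. (u, v) \<in> P \<Longrightarrow> goodq u v (Q u v)"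
  shows "\<exists>D. (\<forall>x\<in>set D. x < W) \<and>
    length D \<le> 31 + 54 * card P + 2 * (n * (l + 1)) + 4 * (\<Sum>i\<le>l. cube i) + (\<Sum>(u, v)\<in>P. 2 + 7 *
      (length (Q u v) - 1)) \<and>
    (\<forall>(u, v)\<in>P. \<exists>t. answers W D query u v t (glue (Q u v)) \<and>
       t \<le> 26 + 20 * (length (Q u v) - 1) + 23 * (length (glue (Q u v)) - 1))"
proof -
  have finP: "finite P" using P finite_subset by blast
  define key where "key = (\<lambda>(u, v). u * n + v)"
  have key_inj: "inj_on key P"
  proof (rule inj_onI)
    fix p p' assume p: "p \<in> P" "p' \<in> P" "key p = key p'"
    obtain u v u' v' where e: "p = (u, v)" "p' = (u', v')" by (metis surj_pair)
    have lt: "v < n" "v' < n" using p P e by auto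
    have "(u * n + v) div n = (u' * n + v') div n" "(u * n + v) mod n = (u' * n + v') mod n"
      using p(3) e by (simp_all add: key_def)
    then show "p = p'" using lt n e by simp
  qed
  define s where "s = card P"
  have s: "s \<le> n ^ 2"
    using card_mono[OF _ P] by (simp add: s_def card_cartesian_product power2_eq_square)
  define X where "X = key ` P"
  have X: "finite X" "card X = s" using finP key_inj by (auto simp: X_def s_def card_image)
  have pow: "n ^ i \<le> n ^ j" if "i \<le> j" for i j using power_increasing[OF that, of n] n by simp
  \<comment> \<open>Room for all addresses, which stay below \<open>128 * n ^ 5\<close>. Seven of
    the twelve factors \<open>n + 1\<close> supply \<open>2 ^ 7\<close>.\<close>
  have n12: "128 * n ^ 5 \<le> W"
  proof -
    have "(128::nat) \<le> (n + 1) ^ 7" using power_mono[of 2 "n + 1" 7] n by simp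
    moreover have "n ^ 5 \<le> (n + 1) ^ 5" by (intro power_mono) auto
    ultimately have "128 * n ^ 5 \<le> (n + 1) ^ 7 * (n + 1) ^ 5" by (rule mult_mono) auto
    also have "\<dots> = (n + 1) ^ 12" by (simp flip: power_add)
    finally show ?thesis using W by simp
  qed
  \<comment> \<open>Keys are below \<open>n ^ 2\<close> and moduli at most \<open>6 * n ^ 4\<close>;
    the product must fit so that every key is at most the divisor \<open>W div m\<close>, as hashing
    requires.\<close>
  have n6: "6 * n ^ 6 \<le> W"
  proof -
    have "(6::nat) \<le> (n + 1) ^ 6" using power_mono[of 2 "n + 1" 6] n by simp
    moreover have "n ^ 6 \<le> (n + 1) ^ 6" by (intro power_mono) auto
    ultimately have "6 * n ^ 6 \<le> (n + 1) ^ 6 * (n + 1) ^ 6" by (rule mult_mono) auto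
    also have "\<dots> = (n + 1) ^ 12" by (simp flip: power_add)
    finally show ?thesis using W by simp
  qed
  have nW: "n < W" "2 \<le> W" "1 + 2 * n < W" "n ^ 2 < W"
    using n12 pow[of 1 5] pow[of 2 5] pow[of 0 5] n by auto
  have K: "4 * s ^ 2 + 2 \<le> 6 * n ^ 4"
    using power_mono[OF s, of 2] pow[of 0 4] by (simp flip: power_mult)
  have key_less: "key p < n ^ 2" if "p \<in> P" for p
  proof -
    obtain u v where p: "p = (u, v)" "u < n" "v < n" using \<open>p \<in> P\<close> P by auto
    then have "u * n + v < Suc u * n" by simp
    also have "\<dots> \<le> n * n" using p by (intro mult_right_mono) auto
    finally show ?thesis using p by (simp add: key_def power2_eq_square)
  qed
  have XW: "x \<le> W div (4 * card X ^ 2 + 2)" if "x \<in> X" for x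
  proof -
    have "x \<le> n ^ 2" using that key_less by (auto simp: X_def less_imp_le)
    then have "x * (4 * s ^ 2 + 2) \<le> n ^ 2 * (6 * n ^ 4)" using K by (rule mult_mono) auto
    also have "\<dots> = 6 * n ^ 6" by (simp flip: power_add)
    finally have "x * (4 * s ^ 2 + 2) \<le> W" using n6 by simp
    then show ?thesis by (simp add: X less_eq_div_iff_mult_less_eq)
  qed
  have KW: "4 * card X ^ 2 + 2 \<le> W" using K pow[of 4 6] n6 X by simp
  define M where "M = s + 2"
  obtain a1 a2 m2 where H: "a1 < W" "\<And>j. a2 j < W" "\<And>j. 2 \<le> m2 j" "\<And>j. m2 j \<le> 4 * s ^ 2 + 2"
    "(\<Sum>j<2 * M. 2 * m2 j) \<le> 48 * s + 16"
    "\<And>x y. x \<in> X \<Longrightarrow> y \<in> X \<Longrightarrow> hash W M a1 x = hash W M a1 y \<Longrightarrow>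
       hash W (m2 (hash W M a1 x)) (a2 (hash W M a1 x)) x = hash W (m2 (hash W M a1 y)) (a2 (hash W
         M a1 y)) y \<Longrightarrow> x = y"
    using perfect_hash[OF X(1) XW KW] unfolding X M_def by blast
  have MW: "2 \<le> M" "M \<le> W"
  proof -
    show "2 \<le> M" by (simp add: M_def)
    have "M \<le> 4 * s ^ 2 + 2" unfolding M_def by (simp add: power2_eq_square)
    then show "M \<le> W" using KW X by simp
  qed
  have m2W: "m2 j \<le> W" for j using H(4)[of j] KW X by simp
  define h1 where "h1 = (\<lambda>p. hash W M a1 (key p))"
  define h2 where "h2 = (\<lambda>j p. hash W (m2 j) (a2 j) (key p))"
  have h: "h1 p < 2 * M" "h2 j p < 2 * m2 j" for p j
    unfolding h1_def h2_def using MW m2W[of j] H(3)[of j] by (auto intro!: hash_less)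
  \<comment> \<open>A record holds the number of pieces, seven words per piece and one spare word,
    which keeps the address behind the last piece inside the array.\<close>
  define sz where "sz = (\<lambda>b. case b of Buckets j \<Rightarrow> 2 * m2 j | Half_Table i \<Rightarrow> n | Up_Table i \<Rightarrow> n
    | Exceptions i x y \<Rightarrow> length (exceptions i x y) | Record u v \<Rightarrow> 2 + 7 * (length (Q u v) - 1))"
  have finL: "finite levels" by (simp add: levels_def)
  define B where "B = Buckets ` {..<2 * M} \<union> Half_Table ` levels \<union> Up_Table ` levels \<union>
    (\<Union>i\<in>levels. (\<lambda>(x, y). Exceptions i x y) ` half i) \<union> (\<lambda>(u, v). Record u v) ` P"
  have finB: "finite B" using finL finP finite_half by (simp add: B_def)
  define base where "base = 3 + 3 * (2 * M)"
  have sumB: "sum sz B \<le> (48 * s + 16) + n * card levels + n * card levels + 4 * (\<Sum>i\<in>levels. cube i)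
      + (\<Sum>(u, v)\<in>P. 2 + 7 * (length (Q u v) - 1))"
  proof -
    let ?E = "\<Union>i\<in>levels. (\<lambda>(x, y). Exceptions i x y) ` half i"
    have "sum sz (Buckets ` {..<2 * M}) \<le> (\<Sum>j<2 * M. sz (Buckets j))"
      by (rule sum_image_le_nat) simp
    also have "\<dots> \<le> 48 * s + 16" using H(5) by (simp add: sz_def)
    finally have 1: "sum sz (Buckets ` {..<2 * M}) \<le> 48 * s + 16" .
    have "sum sz (Half_Table ` levels) \<le> (\<Sum>j\<in>levels. sz (Half_Table j))"
      by (rule sum_image_le_nat) fact
    then have 2: "sum sz (Half_Table ` levels) \<le> n * card levels" by (simp add: sz_def mult.commute)
    have "sum sz (Up_Table ` levels) \<le> (\<Sum>j\<in>levels. sz (Up_Table j))" by (rule sum_image_le_nat) fact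
    then have 3: "sum sz (Up_Table ` levels) \<le> n * card levels" by (simp add: sz_def mult.commute)
    have "sum sz ?E \<le> (\<Sum>i\<in>levels. sum sz ((\<lambda>(x, y). Exceptions i x y) ` half i))"
      using finL finite_half by (intro sum_UN_le) auto
    also have "\<dots> \<le> (\<Sum>i\<in>levels. 4 * cube i)"
    proof (rule sum_mono)
      fix i
      have "sum sz ((\<lambda>(x, y). Exceptions i x y) ` half i) \<le> (\<Sum>c\<in>half i. sz ((\<lambda>(x, y). Exceptions i x
        y) c))"
        by (rule sum_image_le_nat) (rule finite_half)
      also have "\<dots> = (\<Sum>(x, y)\<in>half i. length (exceptions i x y))"
        by (intro sum.cong) (auto simp: sz_def)
      finally show "sum sz ((\<lambda>(x, y). Exceptions i x y) ` half i) \<le> 4 * cube i"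
        using sum_exceptions[of i] by simp
    qed
    finally have 4: "sum sz ?E \<le> 4 * (\<Sum>i\<in>levels. cube i)" by (simp only: sum_distrib_left)
    have "sum sz ((\<lambda>(u, v). Record u v) ` P) \<le> (\<Sum>p\<in>P. sz ((\<lambda>(u, v). Record u v) p))"
      by (rule sum_image_le_nat) fact
    also have "\<dots> = (\<Sum>(u, v)\<in>P. 2 + 7 * (length (Q u v) - 1))"
      by (intro sum.cong) (auto simp: sz_def)
    finally have 5: "sum sz ((\<lambda>(u, v). Record u v) ` P) \<le> (\<Sum>(u, v)\<in>P. 2 + 7 * (length (Q u v) - 1))"
      .
    have f: "finite (Buckets ` {..<2 * M})" "finite (Half_Table ` levels)"
      "finite (Up_Table ` levels)"
      "finite ?E" "finite ((\<lambda>(u, v). Record u v) ` P)"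
      using finL finP finite_half by auto
    have "sum sz B \<le> sum sz (Buckets ` {..<2 * M}) + sum sz (Half_Table ` levels) + sum sz (Up_Table
      ` levels)
        + sum sz ?E + sum sz ((\<lambda>(u, v). Record u v) ` P)"
      unfolding B_def using f by (intro order_trans[OF sum_Un_le] add_mono) auto
    then show ?thesis using 1 2 3 4 5 by linarith
  qed
  have cl: "card levels \<le> l + 1" "card levels \<le> n"
    using card_mono[of "{..l}" levels] card_mono[of "{..<n}" levels] by (auto simp: levels_def)
  have TW: "base + sum sz B < W"
  proof -
    have "(\<Sum>i\<in>levels. cube i) \<le> (\<Sum>i\<in>levels. n ^ 4)" using cube_le by (intro sum_mono)
    also have "\<dots> \<le> n * n ^ 4" using cl(2) by simp
    finally have 1: "(\<Sum>i\<in>levels. cube i) \<le> n ^ 5" by (simp add: power_eq_if)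
    have "(\<Sum>(u, v)\<in>P. 2 + 7 * (length (Q u v) - 1)) \<le> (\<Sum>(u, v)\<in>P. 2 + 7 * n)"
      using goodq_length Q by (intro sum_mono) (fastforce intro: diff_le_self le_trans)
    also have "\<dots> = s * (2 + 7 * n)" by (simp add: s_def case_prod_beta)
    also have "\<dots> \<le> n ^ 2 * (9 * n)" using s n by (intro mult_mono) auto
    also have "\<dots> = 9 * n ^ 3" by (simp add: power2_eq_square power3_eq_cube)
    finally have 2: "(\<Sum>(u, v)\<in>P. 2 + 7 * (length (Q u v) - 1)) \<le> 9 * n ^ 5"
      using pow[of 3 5] by linarith
    have "n * card levels \<le> n * n" using cl(2) by (rule mult_left_mono) simp
    also have "\<dots> \<le> n ^ 5" using pow[of 2 5] by (simp add: power2_eq_square)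
    finally have 3: "n * card levels \<le> n ^ 5" .
    have 4: "s \<le> n ^ 5" "1 \<le> n ^ 5" using s pow[of 2 5] pow[of 0 5] by auto
    \<comment> \<open>For \<open>p = n ^ 5\<close> the blocks take at most
      \<open>48 + 16 + 1 + 1 + 4 + 9 = 79\<close> and the header at most \<open>15 + 6 = 21\<close>
      multiples of \<open>p\<close>, together below 128.\<close>
    have "15 + 6 * s + S < W"
      if "S \<le> 48 * s + 16 + x + x + 4 * y + z" "y \<le> p" "z \<le> 9 * p" "x \<le> p" "s \<le> p" "1 \<le> p"
        "128 * p \<le> W"
      for S x y z p :: nat
    proof -
      have "S \<le> 79 * p" using that by linarith
      moreover have "15 + 6 * s \<le> 21 * p" using that by linarith
      ultimately show ?thesis using that by linarith
    qed
    from this[OF sumB 1 2 3 4 n12] show ?thesis by (simp add: base_def M_def)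
  qed
  obtain off where off: "\<And>b. b \<in> B \<Longrightarrow> base \<le> off b \<and> off b + sz b \<le> base + sum sz B"
    "\<And>b b'. b \<in> B \<Longrightarrow> b' \<in> B \<Longrightarrow> b \<noteq> b' \<Longrightarrow> off b + sz b \<le> off b' \<or> off b' + sz b' \<le> off b"
    using allocate[OF finB, of base sz] by blast
  have offW: "off b < W" "off b + sz b < W" if "b \<in> B" for b using off(1)[OF that] TW by auto
  have inB: "\<And>j. j < 2 * M \<Longrightarrow> Buckets j \<in> B" "\<And>i. i \<in> levels \<Longrightarrow> Half_Table i \<in> B \<and> Up_Table i \<in> B"
    "\<And>i x y. i \<in> levels \<Longrightarrow> (x, y) \<in> half i \<Longrightarrow> Exceptions i x y \<in> B"
    "\<And>u v. (u, v) \<in> P \<Longrightarrow> Record u v \<in> B"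
    by (auto simp: B_def)
  define f where "f = (\<lambda>a b. SOME f. answers_piece W off a b f)"
  have ex_f: "\<exists>f. answers_piece W off a b f" if "seg a b" for a b
  proof (rule seg_answers_piece[OF that A nW(2,1)])
    show "off (Half_Table i) < W \<and> off (Up_Table i) < W" if "i \<in> levels" for i
      using offW(1) inB(2) that by blast
    show "off (Exceptions i x y) + length (exceptions i x y) < W" if "i \<in> levels"
      "(x, y) \<in> half i" for i x y
      using offW(2)[OF inB(3)[OF that]] by (simp add: sz_def)
  qed
  have f: "answers_piece W off a b (f a b)" if "seg a b" for a b
    unfolding f_def using ex_f[OF that] by (rule someI_ex)
  \<comment> \<open>The pairs hashed to slot \<open>t\<close> of bucket \<open>j\<close>. By
    injectivity the slot of a queried pair holds that pair alone, so the choice made in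
    \<open>c\<close> finds it.\<close>
  define Kp where "Kp = (\<lambda>j t. {p \<in> P. h1 p = j \<and> h2 j p = t})"
  have Kp: "Kp (h1 p) (h2 (h1 p) p) = {p}" if "p \<in> P" for p
  proof -
    have "p' = p" if "p' \<in> P" "h1 p' = h1 p" "h2 (h1 p) p' = h2 (h1 p) p" for p'
    proof -
      have "key p' = key p" using H(6)[of "key p'" "key p"] that \<open>p \<in> P\<close>
        by (simp add: X_def h1_def h2_def)
      then show ?thesis using key_inj that \<open>p \<in> P\<close> by (simp add: inj_on_def)
    qed
    then show ?thesis using that by (auto simp: Kp_def)
  qed
  define c where "c = (\<lambda>b k. case b of
      Buckets j \<Rightarrow> if Kp j k = {} then 0 else (case (SOME p. p \<in> Kp j k) of (u, v) \<Rightarrow> off (Record u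
        v))
    | Half_Table i \<Rightarrow> rule_half i k | Up_Table i \<Rightarrow> rule_up i k
    | Exceptions i x y \<Rightarrow> exceptions i x y ! k
    | Record u v \<Rightarrow> if k = 0 then length (Q u v) - 1 else
        if (k - 1) div 7 < length (Q u v) - 1 then
          f (Q u v ! ((k - 1) div 7)) (Q u v ! Suc ((k - 1) div 7)) ((k - 1) mod 7) else 0)"
  have segQ: "seg (Q u v ! j) (Q u v ! Suc j)" if "(u, v) \<in> P" "j < length (Q u v) - 1" for u v j
    using Q[OF that(1)] that(2) unfolding goodq_def by (simp add: successively_conv_nth)
  have cW: "c b k < W" if b: "b \<in> B" and k: "k < sz b" for b k
  proof (cases b)
    case (Buckets j)
    have "off (Record u v) < W" if "Kp j k \<noteq> {}" "(SOME p. p \<in> Kp j k) = (u, v)" for u v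
    proof -
      have "(u, v) \<in> Kp j k" using that some_in_eq by metis
      then show ?thesis using offW(1) inB(4) by (simp add: Kp_def)
    qed
    then show ?thesis using nW Buckets by (auto simp: c_def split: prod.splits)
  next
    case (Half_Table i)
    then show ?thesis using rule_half_le[of i k] nW by (simp add: c_def)
  next
    case (Up_Table i)
    then show ?thesis using rule_up_le[of i k] nW by (simp add: c_def)
  next
    case (Exceptions i x y)
    then have xy: "(x, y) \<in> half i" using b by (auto simp: B_def)
    have "exceptions i x y ! k \<in> set (exceptions i x y)" using k Exceptions by (simp add: sz_def)
    also have "\<dots> \<subseteq> set (\<pi> x y)" by (auto simp: exceptions_def)
    also have "\<dots> \<subseteq> {..<n}" using \<pi>_path(5)[OF half_conn[OF xy]] .
    finally show ?thesis using Exceptions nW by (simp add: c_def)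
  next
    case (Record u v)
    then have uv: "(u, v) \<in> P" using b by (auto simp: B_def)
    have "length (Q u v) - 1 < W" using goodq_length[OF Q[OF uv]] nW by linarith
    moreover have "f (Q u v ! j) (Q u v ! Suc j) (i mod 7) < W" if "j < length (Q u v) - 1" for i j
      using f[OF segQ[OF uv that]] by (simp add: answers_piece_def)
    ultimately show ?thesis using Record nW by (simp add: c_def)
  qed
  define hd' where "hd' = (\<lambda>a. if a = 0 then n else if a = 1 then a1 else if a = 2 then W div M else
     if (a - 3) mod 3 = 0 then a2 ((a - 3) div 3) else if (a - 3) mod 3 = 1 then W div m2 ((a - 3)
       div 3)
     else off (Buckets ((a - 3) div 3)))"
  have hW: "hd' a < W" if "a < base" for a
  proof -
    have d: "W div m < W" if "2 \<le> m" for m using that nW(2) by (intro div_less_dividend) auto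
    have "(a - 3) div 3 < 2 * M" if "3 \<le> a" using that \<open>a < base\<close> unfolding base_def
      by (simp add: less_mult_imp_div_less)
    moreover have "W div M < W" "W div m2 j < W" for j using d MW(1) H(3) by blast+
    ultimately show ?thesis using nW H(1,2) offW(1) inB(1) by (auto simp: hd'_def)
  qed
  obtain D where D: "length D = base + sum sz B" "\<And>a. a < base \<Longrightarrow> D ! a = hd' a"
    "\<And>b k. b \<in> B \<Longrightarrow> k < sz b \<Longrightarrow> D ! (off b + k) = c b k" "\<And>x. x \<in> set D \<Longrightarrow> x < W"
    using fill[of B base off sz hd' W c, OF off hW cW] nW by auto
  have inD: "off b + k < length D" if "b \<in> B" "k < sz b" for b k
    using off(1)[OF that(1)] that(2) D(1) by simp
  have tables: "tables_stored off D"
    unfolding tables_stored_def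
  proof (intro conjI ballI allI impI; (clarify)?)
    fix i z assume i: "i \<in> levels" and z: "z < n"
    show "off (Half_Table i) + z < length D" "off (Up_Table i) + z < length D"
      using inB(2)[OF i] z inD by (simp_all add: sz_def)
    show "D ! (off (Half_Table i) + z) = rule_half i z" "D ! (off (Up_Table i) + z) = rule_up i z"
      using inB(2)[OF i] z D(3) by (simp_all add: sz_def c_def)
  next
    fix i x y k assume "i \<in> levels" "(x, y) \<in> half i" and k: "k < length (exceptions i x y)"
    then have b: "Exceptions i x y \<in> B" using inB(3) by blast
    show "off (Exceptions i x y) + k < length D \<and> D ! (off (Exceptions i x y) + k) = exceptions i x
      y ! k"
      using inD[OF b] D(3)[OF b] k by (simp add: sz_def c_def)
  qed
  have answer: "\<exists>t. answers W D query u v t (glue (Q u v)) \<and>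
       t \<le> 26 + 20 * (length (Q u v) - 1) + 23 * (length (glue (Q u v)) - 1)" if uv:
         "(u, v) \<in> P" for u v
  proof -
    let ?q = "Q u v"
    note g = Q[OF uv, unfolded goodq_def]
    define j where "j = h1 (u, v)"
    define t where "t = h2 j (u, v)"
    have j: "j < 2 * M" using h(1) by (simp add: j_def)
    have t: "t < 2 * m2 j" using h(2) by (simp add: t_def)
    have key: "key (u, v) = u * n + v" by (simp add: key_def)
    have D0: "D ! 0 = n" "D ! 1 = a1" "D ! 2 = W div M" using D(2)
      by (simp_all add: base_def hd'_def)
    have b: "3 + 3 * j < base" "4 + 3 * j < base" "5 + 3 * j < base" using j
      by (simp_all add: base_def)
    have Dj: "D ! (3 + 3 * j) = a2 j" "D ! (4 + 3 * j) = W div m2 j"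
      "D ! (5 + 3 * j) = off (Buckets j)"
    proof -
      show "D ! (3 + 3 * j) = a2 j" using D(2)[OF b(1)] by (simp add: hd'_def)
      have "(4 + 3 * j - 3) mod 3 = 1" "(4 + 3 * j - 3) div 3 = j" by simp_all
      then show "D ! (4 + 3 * j) = W div m2 j" using D(2)[OF b(2)] by (simp add: hd'_def)
      have e: "5 + 3 * j - 3 = 2 + 3 * j" by simp
      have "(2 + 3 * j) mod 3 = 2 mod 3" by (rule mod_mult_self2)
      moreover have "(2 + 3 * j) div 3 = j + 2 div 3" by (rule div_mult_self2) simp
      ultimately have "(5 + 3 * j - 3) mod 3 = 2" "(5 + 3 * j - 3) div 3 = j"
        unfolding e by simp_all
      then show "D ! (5 + 3 * j) = off (Buckets j)" using D(2)[OF b(3)] by (simp add: hd'_def)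
    qed
    have Bj: "Buckets j \<in> B" "t < sz (Buckets j)" using inB(1)[OF j] t by (simp_all add: sz_def)
    have R: "Record u v \<in> B" using inB(4)[OF uv] .
    have "Kp j t = {(u, v)}" using Kp[OF uv] by (simp add: j_def t_def)
    then have i: "D ! (off (Buckets j) + t) = off (Record u v)" using D(3)[OF Bj]
      by (simp add: c_def)
    have szR: "sz (Record u v) = 2 + 7 * (length ?q - 1)" by (simp add: sz_def)
    have pieces: "piece W D (Suc (off (Record u v)) + 7 * m) (pieces ?q ! m)" if m:
      "m < length (pieces ?q)" for m
    proof -
      have m': "m < length ?q - 1" using m by (simp add: length_pieces)
      let ?r = "Suc (off (Record u v)) + 7 * m"
      have "D ! (?r + k) = f (?q ! m) (?q ! Suc m) k" if k: "k < 7" for k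
      proof -
        have "D ! (off (Record u v) + (1 + 7 * m + k)) = c (Record u v) (1 + 7 * m + k)"
          using m' k by (intro D(3)[OF R]) (simp add: szR)
        moreover have "(7 * m + k) div 7 = m" "(7 * m + k) mod 7 = k" using k by simp_all
        ultimately show ?thesis using m' by (simp add: c_def add.assoc add.left_commute)
      qed
      moreover have "?r + 7 < length D" using inD[OF R, of "8 + 7 * m"] m'
        by (simp add: szR add.commute add.left_commute)
      ultimately show ?thesis
        using f[OF segQ[OF uv m']] tables m' unfolding answers_piece_def by (simp add: nth_pieces)
    qed
    have lenD: "length D < W" using D(1) TW by simp
    have "\<exists>t. answers W D query u v t (u # concat (pieces ?q)) \<and>
      t \<le> 26 + 20 * length (pieces ?q) + 23 * length (concat (pieces ?q))"
    proof (rule query_answers[OF lenD D(4) nW(2), where h = j and i = "off (Buckets j) + t"])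
      show "u * D ! 0 + v < W" using key_less[OF uv] nW(4) by (simp add: D0 key)
      show "3 \<le> length D" using D(1) by (simp add: base_def)
      show "j = (D ! 1 * (u * D ! 0 + v) mod W) div D ! 2"
        unfolding D0 j_def h1_def hash_def key ..
      show "5 + 3 * j < length D" using b(3) D(1) by simp
      show "off (Buckets j) + t = D ! (5 + 3 * j) + (D ! (3 + 3 * j) * (u * D ! 0 + v) mod W) div D
        ! (4 + 3 * j)"
        unfolding Dj D0 t_def h2_def hash_def key ..
      show "off (Buckets j) + t < length D" using inD[OF Bj] .
      show "Suc (D ! (off (Buckets j) + t)) < length D" using inD[OF R, of 1] by (simp add: i szR)
      show "D ! (D ! (off (Buckets j) + t)) = length (pieces ?q)"
        using D(3)[OF R, of 0] by (simp add: i szR c_def length_pieces)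
      show "piece W D (Suc (D ! (off (Buckets j) + t)) + 7 * m) (pieces ?q ! m)" if
        "m < length (pieces ?q)" for m
        using pieces[OF that] by (simp only: i)
    qed
    moreover have "glue ?q = u # concat (pieces ?q)" using glue_pieces g by simp
    ultimately show ?thesis by (simp add: length_pieces)
  qed
  have "length D \<le> 31 + 54 * s + 2 * (n * (l + 1)) + 4 * (\<Sum>i\<le>l. cube i) + (\<Sum>(u, v)\<in>P. 2 + 7 *
    (length (Q u v) - 1))"
  proof -
    have 1: "(\<Sum>i\<in>levels. cube i) \<le> (\<Sum>i\<le>l. cube i)" by (intro sum_mono2) (auto simp: levels_def)
    have 2: "n * card levels \<le> n * (l + 1)" using cl(1) by (rule mult_left_mono) simp
    have 3: "length D = 15 + 6 * s + sum sz B" using D(1) by (simp add: base_def M_def)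
    have "L \<le> 31 + 54 * s + 2 * y + 4 * z + r"
      if "L = 15 + 6 * s + S" "S \<le> 48 * s + 16 + x + x + 4 * c + r" "c \<le> z" "x \<le> y"
      for L S x y z r c :: nat using that by linarith
    from this[OF 3 sumB 1 2] show ?thesis .
  qed
  then show ?thesis using D(4) answer unfolding s_def by (intro exI[of _ D]) auto
qed

end

section \<open>The preserver and the constants\<close>

context hierarchy
begin

lemma preserver:
  fixes \<beta> :: real
  assumes n: "0 < n" and A: "\<And>i. n \<le> i \<Longrightarrow> A i = {}" and P: "P \<subseteq> {..<n} \<times> {..<n}"
    and \<epsilon>: "0 < \<epsilon>'" "\<epsilon>' \<le> real l + 3" "\<epsilon>' \<le> \<epsilon>" and \<beta>: "5 * (16 * (real l + 3) / \<epsilon>') ^ l \<le> \<beta>"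
    and W: "(n + 1) ^ 12 \<le> num_words b n" and C: "43 \<le> C"
  shows "\<exists>S D. interactive_preserver b query C 1 n E w P (1 + \<epsilon>) S D \<and>
    real (card S) \<le> (\<Sum>i\<le>l. 3 * n + 8 * cube i) + card P * \<beta> \<and>
    real (length D) \<le> 31 + 54 * real (card P) + 2 * (n * (l + 1)) + 4 * (\<Sum>i\<le>l. cube i) + card P * (2
      + 7 * \<beta>)"
proof -
  define P' where "P' = {(u, v) \<in> P. conn n E u v}"
  have finP: "finite P" using P finite_subset by blast
  have P': "P' \<subseteq> P" "finite P'" "card P' \<le> card P" "P' \<subseteq> {..<n} \<times> {..<n}"
    using finP P by (auto simp: P'_def intro: card_mono finite_subset)
  have "\<exists>q. goodq u v q \<and> real (length q - 1) \<le> \<beta> \<and> wt w (glue q) \<le> (1 + \<epsilon>) * dst u v" if uv: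
    "(u, v) \<in> P'" for u v
  proof -
    have c: "conn n E u v" "v < n" using uv P'(4) by (auto simp: P'_def)
    obtain t c' where t: "walk t c' u v" "c' \<le> (1 + \<epsilon>') * dst u v"
      "real t \<le> 5 * (16 * (real l + 3) / \<epsilon>') ^ l"
      using hop_walk[OF \<epsilon>(1,2) c(1)] by blast
    obtain q where q: "q \<noteq> []" "successively seg q" "hd q = u" "last q = v" "length q \<le> Suc t"
      "set q \<subseteq> {..<n}" "distinct (glue q)" "wt w (glue q) \<le> c'"
        using walk_pieces[OF t(1) c(2)] by blast
    have "(1 + \<epsilon>') * dst u v \<le> (1 + \<epsilon>) * dst u v"
      using \<epsilon>(3) dst_nonneg[OF c(1)] by (intro mult_right_mono) auto
    moreover have "real (length q - 1) \<le> real t" using q(5) by (intro of_nat_mono) simp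
    ultimately show ?thesis using q t \<beta> by (intro exI[of _ q]) (simp add: goodq_def)
  qed
  then obtain Q where Q: "\<And>u v. (u, v) \<in> P' \<Longrightarrow> goodq u v (Q u v)"
    "\<And>u v. (u, v) \<in> P' \<Longrightarrow> real (length (Q u v) - 1) \<le> \<beta>"
    "\<And>u v. (u, v) \<in> P' \<Longrightarrow> wt w (glue (Q u v)) \<le> (1 + \<epsilon>) * dst u v" by metis
  obtain D where D: "\<forall>x\<in>set D. x < num_words b n"
    "length D \<le> 31 + 54 * card P' + 2 * (n * (l + 1)) + 4 * (\<Sum>i\<le>l. cube i) + (\<Sum>(u, v)\<in>P'. 2 + 7 *
      (length (Q u v) - 1))"
    "\<And>u v. (u, v) \<in> P' \<Longrightarrow> \<exists>t. answers (num_words b n) D query u v t (glue (Q u v)) \<and>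
       t \<le> 26 + 20 * (length (Q u v) - 1) + 23 * (length (glue (Q u v)) - 1)"
    using data_structure[OF n A W P'(4) Q(1)] by blast
  \<comment> \<open>Pieces of hop paths are covered by \<open>support\<close>. A piece that is a
    single edge joins consecutive breakpoints, so it is found among the edges of
    \<open>Q u v\<close> that belong to \<open>E\<close>, at most one per piece.\<close>
  define S where "S = support \<union> (\<Union>(u, v)\<in>P'. edge_set (Q u v) \<inter> E)"
  have SE: "S \<subseteq> E" using support_subset by (auto simp: S_def)
  have path: "is_path n S u v (glue (Q u v))" if uv: "(u, v) \<in> P'" for u v
  proof -
    note g = Q(1)[OF uv, unfolded goodq_def]
    have "edge_set (glue (Q u v)) \<subseteq> S" using glue_edges[of "Q u v"] g uv by (auto simp: S_def)
    then show ?thesis using g hd_glue[of "Q u v"] last_glue[of "Q u v"] set_glue[of "Q u v"]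
      by (simp add: is_path_iff)
  qed
  have weight: "gdist n E w u v \<le> path_weight (edge_cost w) (glue (Q u v))"
    "path_weight (edge_cost w) (glue (Q u v)) \<le> ereal (1 + \<epsilon>) * gdist n E w u v" if uv:
      "(u, v) \<in> P'" for u v
  proof -
    have c: "conn n E u v" using uv by (simp add: P'_def)
    show "gdist n E w u v \<le> path_weight (edge_cost w) (glue (Q u v))"
      unfolding gdist_def using is_path_mono[OF path[OF uv] SE] by (intro INF_lower) simp
    show "path_weight (edge_cost w) (glue (Q u v)) \<le> ereal (1 + \<epsilon>) * gdist n E w u v"
      using Q(3)[OF uv] by (simp add: path_weight_edge_cost gdist_conn[OF c])
  qed
  have pres: "distance_preserver n E w P (1 + \<epsilon>) S"
    unfolding distance_preserver_def
  proof (intro conjI SE ballI, clarify)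
    fix u v assume uv: "(u, v) \<in> P"
    show "gdist n S w u v \<le> ereal (1 + \<epsilon>) * gdist n E w u v"
    proof (cases "conn n E u v")
      case True
      then have uv': "(u, v) \<in> P'" using uv by (simp add: P'_def)
      show ?thesis
        using weight(2)[OF uv'] path[OF uv'] unfolding gdist_def[of n S]
        by (intro INF_lower2[of "glue (Q u v)"]) auto
    next
      case False
      then show ?thesis using gdist_not_conn \<epsilon> by simp
    qed
  qed
  have "interactive_preserver b query C 1 n E w P (1 + \<epsilon>) S D"
    unfolding interactive_preserver_def
  proof (intro conjI pres D(1) ballI, clarify)
    fix u v assume uv: "(u, v) \<in> P" and "gdist n E w u v < \<infinity>"
    then have uv': "(u, v) \<in> P'" using gdist_less_top by (simp add: P'_def)
    let ?p = "glue (Q u v)"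
    obtain t where t: "answers (num_words b n) D query u v t ?p"
       "t \<le> 26 + 20 * (length (Q u v) - 1) + 23 * (length ?p - 1)" using D(3)[OF uv'] by blast
    have "length (Q u v) \<le> length ?p" using length_glue Q(1)[OF uv'] by (simp add: goodq_def)
    \<comment> \<open>The number of pieces is at most the number of edges of the answer, so the two
      linear terms combine to \<open>20 + 23\<close>.\<close>
    then have "t \<le> 43 * (1 + num_edges ?p)" using t(2) by (simp add: num_edges_def)
    then have "real t \<le> 43 * (1 + real (num_edges ?p))" using of_nat_mono[of t
      "43 * (1 + num_edges ?p)"] by simp
    also have "\<dots> \<le> C * (1 + real (num_edges ?p))" using C by (intro mult_right_mono) auto
    finally show "\<exists>p t. answers (num_words b n) D query u v t p \<and>
      real t \<le> C * (1 + real (num_edges p)) \<and>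
       is_path n S u v p \<and> gdist n E w u v \<le> path_weight (edge_cost w) p \<and>
       path_weight (edge_cost w) p \<le> ereal (1 + \<epsilon>) * gdist n E w u v"
      using t(1) path[OF uv'] weight[OF uv'] by blast
  qed
  moreover have "real (card S) \<le> (\<Sum>i\<le>l. 3 * n + 8 * cube i) + card P * \<beta>"
  proof -
    have "card S \<le> card support + card (\<Union>(u, v)\<in>P'. edge_set (Q u v) \<inter> E)"
      unfolding S_def by (rule card_Un_le)
    also have "card (\<Union>(u, v)\<in>P'. edge_set (Q u v) \<inter> E) \<le> (\<Sum>(u, v)\<in>P'. card (edge_set (Q u v) \<inter> E))"
      using card_UN_le[OF P'(2), of "\<lambda>(u, v). edge_set (Q u v) \<inter> E"] by (simp add: case_prod_beta)
    also have "\<dots> \<le> (\<Sum>(u, v)\<in>P'. length (Q u v) - 1)"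
    proof (intro sum_mono, clarify)
      fix u v
      have "card (edge_set q) \<le> length q - 1" for q
        by (induction q rule: edge_set.induct) (auto intro: order_trans[OF card_insert_le_m1])
      then show "card (edge_set (Q u v) \<inter> E) \<le> length (Q u v) - 1"
        using card_mono[OF finite_edge_set, of "edge_set (Q u v) \<inter> E" "Q u v"]
          by (meson inf_le1 order_trans)
    qed
    finally have "real (card S) \<le> card support + (\<Sum>(u, v)\<in>P'. real (length (Q u v) - 1))"
      using of_nat_mono[of "card S" _, where ?'a = real] by (fastforce simp: case_prod_beta)
    also have "(\<Sum>(u, v)\<in>P'. real (length (Q u v) - 1)) \<le> (\<Sum>(u, v)\<in>P'. \<beta>)"
      using Q(2) by (intro sum_mono) auto
    also have "\<dots> \<le> card P * \<beta>"
    proof -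
      have "0 \<le> 5 * (16 * (real l + 3) / \<epsilon>') ^ l" using \<epsilon> by simp
      then have "0 \<le> \<beta>" using \<beta> by linarith
      then show ?thesis using P'(3) by (simp add: case_prod_beta mult_right_mono)
    qed
    finally show ?thesis using of_nat_mono[OF card_support, where ?'a = real] by linarith
  qed
  moreover have "real (length D) \<le> 31 + 54 * real (card P) + 2 * (n * (l + 1)) + 4 * (\<Sum>i\<le>l. cube i)
    + card P * (2 + 7 * \<beta>)"
  proof -
    have "real (length D) \<le> real (31 + 54 * card P' + 2 * (n * (l + 1)) + 4 * (\<Sum>i\<le>l. cube i) + (\<Sum>(u,
      v)\<in>P'. 2 + 7 * (length (Q u v) - 1)))"
      using D(2) by (rule of_nat_mono)
    also have "\<dots> = 31 + 54 * real (card P') + 2 * (n * (l + 1)) + 4 * (\<Sum>i\<le>l. cube i) + (\<Sum>(u, v)\<in>P'.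
      2 + 7 * real (length (Q u v) - 1))"
      by (simp add: case_prod_beta)
    also have "(\<Sum>(u, v)\<in>P'. 2 + 7 * real (length (Q u v) - 1)) \<le> (\<Sum>(u, v)\<in>P'. 2 + 7 * \<beta>)"
      using Q(2) by (intro sum_mono) auto
    also have "\<dots> = card P' * (2 + 7 * \<beta>)" by (simp add: case_prod_beta)
    also have "\<dots> \<le> card P * (2 + 7 * \<beta>)"
    proof -
      have "0 \<le> 5 * (16 * (real l + 3) / \<epsilon>') ^ l" using \<epsilon> by simp
      then show ?thesis using P'(3) \<beta> by (intro mult_right_mono) auto
    qed
    finally show ?thesis using P'(3) by simp
  qed
  ultimately show ?thesis by blast
qed

end

section \<open>Word size, number of levels and hop bound\<close>

lemma num_words_ge: "(n + 1) ^ b \<le> num_words b n"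
proof -
  define m where "m = nat \<lceil>log 2 (real n + 1)\<rceil>"
  have "real n + 1 = 2 powr (log 2 (real n + 1))" by simp
  also have "\<dots> \<le> 2 powr real m" unfolding m_def by (intro powr_mono) linarith+
  also have "\<dots> = real (2 ^ m)" by (simp add: powr_realpow)
  finally have "n + 1 \<le> 2 ^ m" by (metis of_nat_1 of_nat_add of_nat_le_iff)
  then have "(n + 1) ^ b \<le> (2 ^ m) ^ b" by (rule power_mono) simp
  also have "\<dots> = num_words b n" by (simp add: num_words_def m_def mult.commute flip: power_mult)
  finally show ?thesis .
qed

text \<open>\<open>ln (4/3) \<ge> 1/4\<close> gives \<open>l \<le> 4 * ln k + 1\<close>, and
  \<open>ln k \<ge> 1\<close> absorbs the constants. One factor \<open>4/3\<close> beyond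
  \<open>k\<close> reaches \<open>k + 1\<close> because \<open>k \<ge> 3\<close>.\<close>

lemma level_bounds:
  assumes k: "3 \<le> k" and l: "l = nat \<lceil>log (4/3) (real k)\<rceil>"
  shows "1 \<le> ln (real k)" "real k + 1 \<le> (4 / 3) ^ Suc l" "real l + 3 \<le> 8 * ln (real k)" "1 \<le> l"
proof -
  have "ln (exp 1) \<le> ln (real k)" using k exp_le by (subst ln_le_cancel_iff) auto
  then show lnk: "1 \<le> ln (real k)" by simp
  have ln43: "1 / 4 \<le> ln (4 / 3 :: real)"
    using ln_add_one_self_le_self2[of "- 1 / 4 :: real"] ln_div[of 1 "4/3 :: real"]
    by (simp add: ln_div)
  have lg: "0 < log (4/3) (real k)" using k by (simp add: log_def)
  have lr: "log (4/3) (real k) \<le> real l" "real l \<le> log (4/3) (real k) + 1"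
    using lg unfolding l by linarith+
  show "1 \<le> l" using lr lg by linarith
  have "real k = (4/3) powr log (4/3) (real k)" using k by simp
  also have "\<dots> \<le> (4/3) powr real l" using lr by (intro powr_mono) auto
  also have "\<dots> = (4/3) ^ l" by (simp add: powr_realpow)
  finally have "real k \<le> (4/3) ^ l" .
  then have "4/3 * real k \<le> (4 / 3) ^ Suc l" by simp
  then show "real k + 1 \<le> (4 / 3) ^ Suc l" using k by linarith
  have "log (4/3) (real k) \<le> ln (real k) / (1 / 4)"
    unfolding log_def using ln43 lnk by (intro divide_left_mono) auto
  then have "log (4/3) (real k) \<le> 4 * ln (real k)" by simp
  then show "real l + 3 \<le> 8 * ln (real k)" using lr lnk by linarith
qed

text \<open>As \<open>l \<ge> 1\<close>, the factor 5 moves inside the power. If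
  \<open>\<epsilon> \<le> l + 3\<close>, the base is at most \<open>5 * 16 * 8 = 640\<close> times
  \<open>ln k / \<epsilon>\<close>; otherwise it equals 80, which is at most
  \<open>80 * a * ln k / \<epsilon>\<close> by the upper bound on \<open>\<epsilon>\<close>.\<close>

lemma hopbound_le_gamma43:
  assumes k: "3 \<le> k" and l: "l = nat \<lceil>log (4/3) (real k)\<rceil>"
    and \<epsilon>: "0 < \<epsilon>" "\<epsilon> \<le> a * ln (real k)" and a: "0 < a"
  defines "\<epsilon>' \<equiv> min \<epsilon> (real l + 3)"
  shows "5 * (16 * (real l + 3) / \<epsilon>') ^ l \<le> gamma43 (640 + 80 * a) \<epsilon> k" and
    "1 \<le> gamma43 (640 + 80 * a) \<epsilon> k"
proof -
  note lb = level_bounds[OF k l]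
  let ?x = "16 * (real l + 3) / \<epsilon>'"
  have \<epsilon>': "0 < \<epsilon>'" "\<epsilon>' \<le> real l + 3" using \<epsilon> by (auto simp: \<epsilon>'_def)
  have x: "1 \<le> ?x" using \<epsilon>' by (simp add: field_simps)
  have "5 * ?x \<le> (640 + 80 * a) * (ln (real k) / \<epsilon>)"
  proof (cases "\<epsilon> \<le> real l + 3")
    case True
    then have e: "\<epsilon>' = \<epsilon>" by (simp add: \<epsilon>'_def)
    have "80 * (real l + 3) \<le> 640 * ln (real k)" using lb(3) by simp
    also have "\<dots> \<le> (640 + 80 * a) * ln (real k)" using a lb(1) by (intro mult_right_mono) auto
    finally have "80 * (real l + 3) / \<epsilon> \<le> (640 + 80 * a) * ln (real k) / \<epsilon>"
      using \<epsilon> by (intro divide_right_mono) auto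
    then show ?thesis unfolding e by simp
  next
    case False
    then have "\<epsilon>' = real l + 3" by (simp add: \<epsilon>'_def)
    then have "5 * ?x = 80" by (simp add: field_simps)
    have "80 * \<epsilon> \<le> 80 * (a * ln (real k))" using \<epsilon>(2) by simp
    also have "\<dots> = 80 * a * ln (real k)" by simp
    also have "\<dots> \<le> (640 + 80 * a) * ln (real k)" using a lb(1) by (intro mult_right_mono) auto
    finally have "80 \<le> (640 + 80 * a) * ln (real k) / \<epsilon>" using \<epsilon> by (simp add: field_simps)
    then show ?thesis using \<open>5 * ?x = 80\<close> by simp
  qed
  moreover have "0 \<le> 5 * ?x" by (intro mult_nonneg_nonneg order_trans[OF zero_le_one x]) simp
  ultimately have "(5 * ?x) ^ l \<le> gamma43 (640 + 80 * a) \<epsilon> k"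
    unfolding gamma43_def l[symmetric] by (rule power_mono)
  moreover have "5 * ?x ^ l \<le> (5 * ?x) ^ l"
  proof -
    have "(5::real) \<le> 5 ^ l" using lb(4) by (intro self_le_power) auto
    then show ?thesis using x by (simp only: power_mult_distrib) (intro mult_right_mono, auto)
  qed
  ultimately show 1: "5 * ?x ^ l \<le> gamma43 (640 + 80 * a) \<epsilon> k" by linarith
  have "1 \<le> ?x ^ l" using x by (rule one_le_power)
  then show "1 \<le> gamma43 (640 + 80 * a) \<epsilon> k" using 1 by linarith
qed

theorem theorem2:
  "\<forall>A>0. \<exists>c>0. \<exists>C>0. \<exists>b>0. \<exists>Q. \<forall>n E w k.
     wgraph n E w \<and> 3 \<le> k \<longrightarrow>
       (\<forall>\<epsilon> P. 0 < \<epsilon> \<and> \<epsilon> \<le> A * ln (real k) \<and> P \<subseteq> {..<n} \<times> {..<n} \<longrightarrow>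
          (\<exists>S D. interactive_preserver b Q C 1 n E w P (1 + \<epsilon>) S D \<and>
             real (preserver_size S D)
               \<le> C * (real (card P) * gamma43 c \<epsilon> k + real n * ln (real k)
                      + real n powr (1 + 1 / real k)))) \<and>
       (\<exists>H. universal_hopset n E w {0<..A * ln (real k)} (\<lambda>\<epsilon>. gamma43 c \<epsilon> k) H \<and>
          real (card H) \<le> C * real n powr (1 + 1 / real k) \<and>
          support_size n E w H
            \<le> ereal (C * (real n powr (1 + 1 / real k) + real n * ln (real k))))"
proof (intro allI impI)
  fix a :: real assume a: "0 < a"
  define c where "c = 640 + 80 * a"
  \<comment> \<open>A round number above \<open>8 * 110592 = 884736\<close>, the largest coefficient
    that occurs, which comes from the support.\<close>
  define C :: real where "C = 1000000"
  have main: "(\<forall>\<epsilon> P. 0 < \<epsilon> \<and> \<epsilon> \<le> a * ln (real k) \<and> P \<subseteq> {..<n} \<times> {..<n} \<longrightarrow>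
          (\<exists>S D. interactive_preserver 12 query C 1 n E w P (1 + \<epsilon>) S D \<and>
             real (preserver_size S D)
               \<le> C * (real (card P) * gamma43 c \<epsilon> k + real n * ln (real k)
                      + real n powr (1 + 1 / real k)))) \<and>
       (\<exists>H. universal_hopset n E w {0<..a * ln (real k)} (\<lambda>\<epsilon>. gamma43 c \<epsilon> k) H \<and>
          real (card H) \<le> C * real n powr (1 + 1 / real k) \<and>
          support_size n E w H
            \<le> ereal (C * (real n powr (1 + 1 / real k) + real n * ln (real k))))"
    if wg: "wgraph n E w" and k: "3 \<le> k" for n E w k
  proof -
    define l where "l = nat \<lceil>log (4/3) (real k)\<rceil>"
    note lb = level_bounds[OF k l_def]
    obtain \<pi> where \<pi>: "shortest_paths n E w \<pi>" using shortest_paths_exist[OF wg] by blast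
    obtain A where A: "A 0 = {..<n}" "\<And>i. A (Suc i) \<subseteq> A i" "A (Suc l) = {}" "\<And>i. n \<le> i \<Longrightarrow> A i = {}"
      "\<And>i. real (card (A i)) \<le> real n / 2 ^ i"
      "(\<Sum>i\<le>l. \<Sum>x\<in>A i. real (card (bunch (gdist n E w) (A i) (A (Suc i)) x)) ^ 3)
        \<le> 110592 * real n powr (1 + 1 / real k)"
      using hierarchy[OF k lb(2), of n "gdist n E w"] by blast
    interpret hierarchy n E w \<pi> A l
      using \<pi> A(1-3) by (intro hierarchy.intro hierarchy_axioms.intro)
    define N where "N = real n powr (1 + 1 / real k)"
    have nN: "real n \<le> N"
    proof (cases "n = 0")
      case False
      then have "real n powr 1 \<le> N" unfolding N_def by (intro powr_mono) auto
      then show ?thesis by simp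
    qed (simp add: N_def)
    have N0: "0 \<le> N" by (simp add: N_def)
    have cubes: "(\<Sum>i\<le>l. real (cube i)) \<le> 110592 * N"
      using A(6) by (simp add: cube_def bun_def N_def)
    have nl: "real n * (real l + 1) \<le> 8 * (real n * ln (real k))"
      using mult_left_mono[of "real l + 1" "8 * ln (real k)" "real n"] lb(3) by simp
    have supp: "real (\<Sum>i\<le>l. 3 * n + 8 * cube i) \<le> 24 * (real n * ln (real k)) + 884736 * N"
    proof -
      have "real (\<Sum>i\<le>l. 3 * n + 8 * cube i) = 3 * (real n * (real l + 1)) + 8 * (\<Sum>i\<le>l. real (cube
        i))"
        by (simp add: sum.distrib sum_distrib_left algebra_simps)
      then show ?thesis using cubes nl by linarith
    qed
    have nlnk: "0 \<le> real n * ln (real k)" using lb by simp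
    have size_A: "(\<Sum>i\<le>l. real (card (A i))) \<le> 2 * N"
    proof -
      have "(\<Sum>i\<le>l. real (card (A i))) \<le> (\<Sum>i\<le>l. real n * (1/2) ^ i)"
        using A(5) by (intro sum_mono) (simp add: power_divide)
      also have "\<dots> = real n * (\<Sum>i\<le>l. (1/2) ^ i)" by (simp only: sum_distrib_left)
      also have "\<dots> \<le> real n * 2" by (intro mult_left_mono) (auto simp: sum_gp0)
      finally show ?thesis using nN by linarith
    qed
    let ?\<epsilon>' = "\<lambda>\<epsilon>. min \<epsilon> (real l + 3)"
    have \<epsilon>': "0 < ?\<epsilon>' \<epsilon>" "?\<epsilon>' \<epsilon> \<le> real l + 3" "?\<epsilon>' \<epsilon> \<le> \<epsilon>" if "0 < \<epsilon>" for \<epsilon> using that by auto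
    have \<beta>: "5 * (16 * (real l + 3) / ?\<epsilon>' \<epsilon>) ^ l \<le> gamma43 c \<epsilon> k" "1 \<le> gamma43 c \<epsilon> k"
      if "0 < \<epsilon>" "\<epsilon> \<le> a * ln (real k)" for \<epsilon>
      using hopbound_le_gamma43[OF k l_def that a] unfolding c_def by auto
    have pres: "\<exists>S D. interactive_preserver 12 query C 1 n E w P (1 + \<epsilon>) S D \<and>
        real (preserver_size S D) \<le> C * (real (card P) * gamma43 c \<epsilon> k + real n * ln (real k) + N)"
      if e: "0 < \<epsilon>" "\<epsilon> \<le> a * ln (real k)" and P: "P \<subseteq> {..<n} \<times> {..<n}" for \<epsilon> P
    proof (cases "n = 0")
      case True
      then have "P = {}" using P by auto
      then have "interactive_preserver 12 query C 1 n E w P (1 + \<epsilon>) {} []"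
        by (simp add: interactive_preserver_def distance_preserver_def)
      moreover have "real (preserver_size {} []) \<le> C * (real (card P) * gamma43 c \<epsilon> k + real n * ln
        (real k) + N)"
        using True N0 \<open>P = {}\<close> by (simp add: preserver_size_def C_def)
      ultimately show ?thesis by blast
    next
      case False
      let ?g = "gamma43 c \<epsilon> k"
      obtain S D where SD: "interactive_preserver 12 query C 1 n E w P (1 + \<epsilon>) S D"
        "real (card S) \<le> (\<Sum>i\<le>l. 3 * n + 8 * cube i) + card P * ?g"
        "real (length D) \<le> 31 + 54 * real (card P) + 2 * (n * (l + 1)) + 4 * (\<Sum>i\<le>l. cube i) + card P
          * (2 + 7 * ?g)"
        using preserver[OF _ A(4) P \<epsilon>'[OF e(1)] \<beta>(1)[OF e] num_words_ge, of C] False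
          by (auto simp: C_def)
      \<comment> \<open>This absorbs the additive 31 in the length of the array.\<close>
      have N1: "1 \<le> N" using nN False by linarith
      have Pg: "real (card P) \<le> card P * ?g" "0 \<le> card P * ?g"
        using mult_left_mono[OF \<beta>(2)[OF e], of "real (card P)"] by auto
      have "s \<le> C * (x + y + z)"
        if "s \<le> t + x" "t \<le> 24 * y + 884736 * z" "0 \<le> x" "0 \<le> y" "0 \<le> z" for s t x y z :: real
        using that by (simp add: C_def)
      from this[OF SD(2) supp Pg(2) nlnk N0]
      have "real (card S) \<le> C * (real (card P) * ?g + real n * ln (real k) + N)" .
      moreover have "real (length D) \<le> C * (real (card P) * ?g + real n * ln (real k) + N)"
      proof -
        have "real (2 * (n * (l + 1))) \<le> 16 * (real n * ln (real k))" using nl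
          by (simp add: algebra_simps)
        moreover have "real (4 * (\<Sum>i\<le>l. cube i)) \<le> 442368 * N" using cubes by simp
        moreover have "card P * (2 + 7 * ?g) = 2 * real (card P) + 7 * (card P * ?g)"
          by (simp add: algebra_simps)
        moreover have "s \<le> C * (x + y + z)"
          if "s \<le> 31 + 54 * p + q + t + r" "q \<le> 16 * y" "t \<le> 442368 * z" "r = 2 * p + 7 * x"
            "p \<le> x" "0 \<le> x" "0 \<le> y" "1 \<le> z" for s p q t r x y z :: real
          using that by (simp add: C_def)
        ultimately show ?thesis using SD(3) Pg nlnk N1 by blast
      qed
      ultimately show ?thesis using SD(1)
        by (intro exI[of _ S] exI[of _ D]) (simp add: preserver_size_def max_def)
    qed
    have uni: "universal_hopset n E w {0<..a * ln (real k)} (\<lambda>\<epsilon>. gamma43 c \<epsilon> k) hops"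
      unfolding universal_hopset_def
    proof
      fix \<epsilon> assume "\<epsilon> \<in> {0<..a * ln (real k)}"
      then have "0 < \<epsilon>" "\<epsilon> \<le> a * ln (real k)" by auto
      then show "hopset n E w (1 + \<epsilon>) (gamma43 c \<epsilon> k) hops"
        by (intro hopset_hops[OF \<epsilon>' \<beta>(1)])
    qed
    have "real (card hops) \<le> real (\<Sum>i\<le>l. cube i + card (A i))" using card_hops by (rule of_nat_mono)
    also have "\<dots> = (\<Sum>i\<le>l. real (cube i)) + (\<Sum>i\<le>l. real (card (A i)))" by (simp add: sum.distrib)
    finally have hops: "real (card hops) \<le> C * N" using cubes size_A N0 unfolding C_def by linarith
    have "support_size n E w hops \<le> ereal (real (card support))"
      unfolding support_size_def using supporting_support by (intro INF_lower) simp
    also have "real (card support) \<le> C * (N + real n * ln (real k))"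
    proof -
      have "real (card support) \<le> real (\<Sum>i\<le>l. 3 * n + 8 * cube i)"
        using card_support by (rule of_nat_mono)
      also note supp
      also have "24 * (real n * ln (real k)) + 884736 * N \<le> C * (N + real n * ln (real k))"
        using nlnk N0 by (simp add: C_def)
      finally show ?thesis .
    qed
    finally have "support_size n E w hops \<le> ereal (C * (N + real n * ln (real k)))" by simp
    then show ?thesis using pres uni hops unfolding N_def by blast
  qed
  show "\<exists>c>0. \<exists>C>0. \<exists>b>0. \<exists>Q. \<forall>n E w k.
     wgraph n E w \<and> 3 \<le> k \<longrightarrow>
       (\<forall>\<epsilon> P. 0 < \<epsilon> \<and> \<epsilon> \<le> a * ln (real k) \<and> P \<subseteq> {..<n} \<times> {..<n} \<longrightarrow>
          (\<exists>S D. interactive_preserver b Q C 1 n E w P (1 + \<epsilon>) S D \<and>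
             real (preserver_size S D)
               \<le> C * (real (card P) * gamma43 c \<epsilon> k + real n * ln (real k)
                      + real n powr (1 + 1 / real k)))) \<and>
       (\<exists>H. universal_hopset n E w {0<..a * ln (real k)} (\<lambda>\<epsilon>. gamma43 c \<epsilon> k) H \<and>
          real (card H) \<le> C * real n powr (1 + 1 / real k) \<and>
          support_size n E w H
            \<le> ereal (C * (real n powr (1 + 1 / real k) + real n * ln (real k))))"
  proof (rule exI[of _ c], intro conjI, goal_cases)
    case 1
    show ?case using a by (simp add: c_def)
  next
    case 2
    show ?case
      using main by (intro exI[of _ C] exI[of _ 12] exI[of _ query] conjI allI impI) (simp_all add:
        C_def)
  qed
qed

end
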